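(* Let $d\in\mathbf{Z}\setminus\{0\}$ and $0<\kappa<\infty$ be fixed. For any compact interval $J\subset(0,\infty)$ there exists $C_0=C_0(\kappa,d,J)>0$ such that every admissible solution $(f,S,m)$ of $(GL)_{\kappa,g}$ with $g\in J$ satisfies $\|(f,S,m)\|_Y\le C_0$.
   Context: All functions are real-valued functions of $r$, and $\int u\,r\,dr=\int_0^\infty u(r)\,r\,dr$. $H$ is the space of radial functions in $H^1(\mathbf{R}^2)$, with $\|u\|_H^2=\int[(u')^2+u^2]\,r\,dr$; $X=\{u\in H:\int\frac{u^2}{r^2}\,r\,dr<\infty\}$ with $\|u\|_X^2=\int[(u')^2+u^2+\frac{u^2}{r^2}]\,r\,dr$. $(GL)_{\kappa,g}$ is the system $-f''-\frac1r f'+\frac{(d-S)^2}{r^2}f=\kappa^2(1-f^2-m^2)f$, $\;-S''+\frac1r S'=(d-S)f^2$, $\;-m''-\frac1r m'+\kappa^2gm=\kappa^2(1-f^2-m^2)m$, with energy $$\mathcal{E}_{\kappa,g}(f,S,m)=\frac12\int\Big\{(f')^2+\big[\tfrac{S'}{r}\big]^2+(m')^2+\kappa^2gm^2+\tfrac{(d-S)^2f^2}{r^2}+\tfrac{\kappa^2}{2}(1-f^2-m^2)^2\Big\}r\,dr.$$ $(f,S,m)$ is an admissible solution if: the system holds for all $r\in(0,\infty)$; $\mathcal{E}_{\kappa,g}(f,S,m)<\infty$; $f(r)\ge0$ and $m(r)\ge0$ for all $r\ge0$; $S(0)=0$ and $m'(0)=0$. Fix a normal core solution $(\tilde f_\kappa,\tilde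 S_\kappa)$, i.e. $(\tilde f_\kappa,\tilde S_\kappa,0)$ is an admissible solution of $(GL)_{\kappa,g}$ (a condition independent of $g$). $Y=\{(\tilde f_\kappa+u,\tilde S_\kappa+rv,m):u,v\in X,\ m\in H\}$; admissible solutions belong to $Y$. For $(f,S,m)=(\tilde f_\kappa+u,\tilde S_\kappa+rv,m)\in Y$, $\|(f,S,m)\|_Y$ denotes the norm of $(u,v,m)$ in $X\times X\times H$. *)

theory Defs
  imports "HOL-Analysis.Analysis"
begin

section \<open>Weak derivatives and the Sobolev space \<open>H\<^sup>1\<close>\<close>

primrec C_k :: "nat \<Rightarrow> ('a::euclidean_space \<Rightarrow> real) \<Rightarrow> bool" where
  "C_k 0 \<phi> \<longleftrightarrow> continuous_on UNIV \<phi>"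
| "C_k (Suc k) \<phi> \<longleftrightarrow>
     (\<forall>x. \<phi> differentiable (at x)) \<and>
     (\<forall>b\<in>Basis. C_k k (\<lambda>x. frechet_derivative \<phi> (at x) b))"

definition test_functions :: "'a::euclidean_space set \<Rightarrow> ('a \<Rightarrow> real) set" where
  "test_functions \<Omega> =
     {\<phi>. (\<forall>k. C_k k \<phi>) \<and> (\<exists>K. compact K \<and> K \<subseteq> \<Omega> \<and> (\<forall>x. x \<notin> K \<longrightarrow> \<phi> x = 0))}"

definition loc_integrable_on :: "('a::euclidean_space \<Rightarrow> real) \<Rightarrow> 'a set \<Rightarrow> bool" where
  "loc_integrable_on u \<Omega> \<longleftrightarrow> (\<forall>K. compact K \<and> K \<subseteq> \<Omega> \<longrightarrow> set_integrable lebesgue K u)"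

definition weak_partial ::
    "'a::euclidean_space set \<Rightarrow> 'a \<Rightarrow> ('a \<Rightarrow> real) \<Rightarrow> ('a \<Rightarrow> real) \<Rightarrow> bool" where
  "weak_partial \<Omega> b u w \<longleftrightarrow>
     loc_integrable_on u \<Omega> \<and> loc_integrable_on w \<Omega> \<and>
     (\<forall>\<phi>\<in>test_functions \<Omega>.
        (LINT x:\<Omega>|lebesgue. u x * frechet_derivative \<phi> (at x) b)
          = - (LINT x:\<Omega>|lebesgue. w x * \<phi> x))"

definition L2_functions :: "('a::euclidean_space \<Rightarrow> real) set" where
  "L2_functions = {u \<in> borel_measurable lebesgue. integrable lebesgue (\<lambda>x. (u x)\<^sup>2)}"

definition Sobolev_H1 :: "('a::euclidean_space \<Rightarrow> real) set" where
  "Sobolev_H1 = {u \<in> L2_functions. \<forall>b\<in>Basis. \<exists>w\<in>L2_functions. weak_partial UNIV b u w}"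

section \<open>The spaces \<open>H\<close> and \<open>X\<close> of radial functions\<close>

text \<open>A radial function on the plane is represented by its profile \<open>u\<close>, a function of
  \<open>r = |x|\<close>; the values of \<open>u\<close> on \<open>{..0}\<close> play no role.\<close>

definition H_space :: "(real \<Rightarrow> real) set" where
  "H_space = {u. (\<lambda>x::real^2. u (norm x)) \<in> Sobolev_H1}"

definition X_space :: "(real \<Rightarrow> real) set" where
  "X_space = {u \<in> H_space. set_integrable lebesgue {0<..} (\<lambda>r. (u r)\<^sup>2 / r\<^sup>2 * r)}"

text \<open>The weak derivative on the half-line is unique up to null sets, so the norms below do not
  depend on the choice made here.\<close>

definition radial_deriv :: "(real \<Rightarrow> real) \<Rightarrow> real \<Rightarrow> real" where
  "radial_deriv u = (SOME w. weak_partial {0<..} 1 u w)"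

definition rdr_integral :: "(real \<Rightarrow> real) \<Rightarrow> real" where
  "rdr_integral u = (LINT r:{0<..}|lebesgue. u r * r)"

definition H_norm :: "(real \<Rightarrow> real) \<Rightarrow> real" where
  "H_norm u = sqrt (rdr_integral (\<lambda>r. (radial_deriv u r)\<^sup>2 + (u r)\<^sup>2))"

definition X_norm :: "(real \<Rightarrow> real) \<Rightarrow> real" where
  "X_norm u = sqrt (rdr_integral (\<lambda>r. (radial_deriv u r)\<^sup>2 + (u r)\<^sup>2 + (u r)\<^sup>2 / r\<^sup>2))"

section \<open>The Ginzburg--Landau system\<close>

definition twice_differentiable_pos :: "(real \<Rightarrow> real) \<Rightarrow> bool" where
  "twice_differentiable_pos u \<longleftrightarrow>
     (\<forall>r>0. u differentiable (at r) \<and> deriv u differentiable (at r))"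

definition GL_system ::
    "int \<Rightarrow> real \<Rightarrow> real \<Rightarrow> (real \<Rightarrow> real) \<Rightarrow> (real \<Rightarrow> real) \<Rightarrow> (real \<Rightarrow> real) \<Rightarrow> bool" where
  "GL_system d \<kappa> g f S m \<longleftrightarrow>
     twice_differentiable_pos f \<and> twice_differentiable_pos S \<and> twice_differentiable_pos m \<and>
     (\<forall>r>0.
        - deriv (deriv f) r - 1 / r * deriv f r + (of_int d - S r)\<^sup>2 / r\<^sup>2 * f r
          = \<kappa>\<^sup>2 * (1 - (f r)\<^sup>2 - (m r)\<^sup>2) * f r \<and>
        - deriv (deriv S) r + 1 / r * deriv S r = (of_int d - S r) * (f r)\<^sup>2 \<and>
        - deriv (deriv m) r - 1 / r * deriv m r + \<kappa>\<^sup>2 * g * m r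
          = \<kappa>\<^sup>2 * (1 - (f r)\<^sup>2 - (m r)\<^sup>2) * m r)"

definition GL_energy_density ::
    "int \<Rightarrow> real \<Rightarrow> real \<Rightarrow> (real \<Rightarrow> real) \<Rightarrow> (real \<Rightarrow> real) \<Rightarrow> (real \<Rightarrow> real) \<Rightarrow> real \<Rightarrow> real" where
  "GL_energy_density d \<kappa> g f S m r =
     (deriv f r)\<^sup>2 + (deriv S r / r)\<^sup>2 + (deriv m r)\<^sup>2 + \<kappa>\<^sup>2 * g * (m r)\<^sup>2
       + (of_int d - S r)\<^sup>2 * (f r)\<^sup>2 / r\<^sup>2 + \<kappa>\<^sup>2 / 2 * (1 - (f r)\<^sup>2 - (m r)\<^sup>2)\<^sup>2"

text \<open>The density is nonnegative for \<open>g \<ge> 0\<close> (or \<open>m = 0\<close>), which is where the energy is used;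
  \<open>ennreal\<close> would cut off negative values.\<close>

definition GL_energy ::
    "int \<Rightarrow> real \<Rightarrow> real \<Rightarrow> (real \<Rightarrow> real) \<Rightarrow> (real \<Rightarrow> real) \<Rightarrow> (real \<Rightarrow> real) \<Rightarrow> ennreal" where
  "GL_energy d \<kappa> g f S m =
     (\<integral>\<^sup>+ r\<in>{0<..}. ennreal (1 / 2 * GL_energy_density d \<kappa> g f S m r * r) \<partial>lebesgue)"

text \<open>The system only constrains the functions on \<open>{0<..}\<close>. Right continuity of \<open>S\<close> at \<open>0\<close> is what
  gives the boundary condition \<open>S 0 = 0\<close> content; \<open>m'(0)\<close> is a one-sided derivative.\<close>

definition admissible ::
    "int \<Rightarrow> real \<Rightarrow> real \<Rightarrow> (real \<Rightarrow> real) \<Rightarrow> (real \<Rightarrow> real) \<Rightarrow> (real \<Rightarrow> real) \<Rightarrow> bool" where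
  "admissible d \<kappa> g f S m \<longleftrightarrow>
     GL_system d \<kappa> g f S m \<and>
     GL_energy d \<kappa> g f S m < \<infinity> \<and>
     (\<forall>r\<ge>0. f r \<ge> 0 \<and> m r \<ge> 0) \<and>
     S 0 = 0 \<and> continuous (at 0 within {0..}) S \<and>
     (m has_real_derivative 0) (at 0 within {0..})"

lemma admissible_zero_indep:
  "admissible d \<kappa> g f S (\<lambda>_. 0) \<longleftrightarrow> admissible d \<kappa> g' f S (\<lambda>_. 0)"
  by (simp add: admissible_def GL_system_def GL_energy_def GL_energy_density_def)

definition normal_core :: "int \<Rightarrow> real \<Rightarrow> (real \<Rightarrow> real) \<Rightarrow> (real \<Rightarrow> real) \<Rightarrow> bool" where
  "normal_core d \<kappa> f S \<longleftrightarrow> (\<exists>g>0. admissible d \<kappa> g f S (\<lambda>_. 0))"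

lemma normal_core_iff: "normal_core d \<kappa> f S \<longleftrightarrow> admissible d \<kappa> g f S (\<lambda>_. 0)"
  unfolding normal_core_def using admissible_zero_indep zero_less_one by blast

section \<open>The affine space \<open>Y\<close>\<close>

definition Y_space ::
    "(real \<Rightarrow> real) \<Rightarrow> (real \<Rightarrow> real) \<Rightarrow> ((real \<Rightarrow> real) \<times> (real \<Rightarrow> real) \<times> (real \<Rightarrow> real)) set" where
  "Y_space ft St =
     {(f, S, m). \<exists>u\<in>X_space. \<exists>v\<in>X_space. m \<in> H_space \<and>
        (\<forall>r>0. f r = ft r + u r \<and> S r = St r + r * v r)}"

text \<open>On \<open>{0<..}\<close> the functions \<open>u\<close> and \<open>v\<close> above are \<open>f - ft\<close> and \<open>(S - St) / r\<close>.\<close>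

definition Y_norm ::
    "(real \<Rightarrow> real) \<Rightarrow> (real \<Rightarrow> real) \<Rightarrow> (real \<Rightarrow> real) \<times> (real \<Rightarrow> real) \<times> (real \<Rightarrow> real) \<Rightarrow> real" where
  "Y_norm ft St = (\<lambda>(f, S, m).
     sqrt ((X_norm (\<lambda>r. f r - ft r))\<^sup>2 + (X_norm (\<lambda>r. (S r - St r) / r))\<^sup>2 + (H_norm m)\<^sup>2))"

end

theory Submission
  imports Defs
begin

text \<open>Write $a = \pm(d - S)$ with the sign of $d$, $b = \pm S'/r$ and $h = f^2 + m^2$. The finite
  energy is only used qualitatively: it gives $h \le 1$ (maximum principle), the monotonicity
  $0 \le a \le |d|$, $b \ge 0$ decreasing (since $(ab)' \le 0$), and the vanishing of the boundary
  terms in Pohozaev's identity $\int b^2 r = \int (\kappa^2 g m^2 + \frac{\kappa^2}{2}(1 - h)^2) r$.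
  Quantitatively, the equation for $f$ bounds $\int_0^1 a^2 f^2/r$, and feeding this into
  $b' = - a f^2/r$ and $a' = - r b$ yields a bound for the central magnetic field $b(0)$ in terms of
  itself with a factor less than one. Then $\int (r b^2 + a^2 f^2/r) \le |d|\, b(0)$, Pohozaev's
  identity bounds the potential energy, and testing the equations with $m$ and $1 - f$
  bounds the remaining gradient terms.\<close>

section \<open>Integrals over the half-line\<close>

text \<open>The energy of an admissible solution is finite but carries no a priori bound, so a
  uniform constant can only come from the equations. Finiteness merely supplies good radii: the
  integral of 1/r diverges at both ends of the half-line, so there are radii near 0 and near
  infinity where r^2 e(r) is as small as desired. The equations hold on the open half-line only;
  estimates are therefore made on compact intervals, with boundary terms controlled at such radii,
  by monotonicity, or by averaging over adjacent dyadic intervals.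

  The weight f^2 in the magnetic terms degenerates where f is small. There h + (1 - h)^2 >= 3/4
  forces m^2 or (1 - h)^2 to be large, and Pohozaev's identity controls both.

  The differences u and v are estimated through reference values, 1 and d far out and 0 at the
  origin, from which the solution and the core have distances obeying the same bounds. All constants
  are built from d, \<kappa> and a lower bound g0 of g. Membership in Y moreover demands H^1
  regularity across the origin of the plane.\<close>

lemma nn_integral_Icc_inverse:
  fixes a b \<epsilon> :: real
  assumes "0 < a" "a \<le> b" "0 \<le> \<epsilon>"
  shows "(\<integral>\<^sup>+ r. ennreal (\<epsilon> / r) * indicator {a..b} r \<partial>lborel) = ennreal (\<epsilon> * ln b - \<epsilon> * ln a)"
  using assms by (intro nn_integral_FTC_Icc[where F = "\<lambda>r. \<epsilon> * ln r"])
    (auto intro!: derivative_eq_intros)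

text \<open>Integrating \<epsilon>/r over \<open>{a..b}\<close> gives \<epsilon> times its
  logarithmic length, which is unbounded over the subintervals of \<open>I\<close>, so a
  \<open>q\<close> of finite integral cannot stay above \<epsilon>/r. With
  \<open>q r = e r * r\<close> this yields radii where r^2 e(r) < \<epsilon>, a substitute for
  pointwise decay of the energy density.\<close>

lemma not_dominates_inverse:
  fixes q :: "real \<Rightarrow> real" and \<epsilon> :: real
  assumes fin: "(\<integral>\<^sup>+ r\<in>{0<..}. ennreal (q r) \<partial>lebesgue) < \<infinity>" and "0 < \<epsilon>"
    and I: "\<And>C. \<exists>a b. 0 < a \<and> a \<le> b \<and> {a..b} \<subseteq> I \<and> C \<le> ln b - ln a"
  shows "\<exists>r\<in>I. q r < \<epsilon> / r"
proof (rule ccontr)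
  assume "\<not> ?thesis"
  then have q: "\<epsilon> / r \<le> q r" if "r \<in> I" for r using that by force
  obtain B where B: "(\<integral>\<^sup>+ r\<in>{0<..}. ennreal (q r) \<partial>lebesgue) = ennreal B" "0 \<le> B"
    using fin by (metis ennreal_cases infinity_ennreal_def top.not_eq_extremum)
  obtain a b where ab: "0 < a" "a \<le> b" "{a..b} \<subseteq> I" "(B + 1) / \<epsilon> \<le> ln b - ln a"
    using I by blast
  have "ennreal (\<epsilon> * ln b - \<epsilon> * ln a) = (\<integral>\<^sup>+ r. ennreal (\<epsilon> / r) * indicator {a..b} r \<partial>lborel)"
    using ab \<open>0 < \<epsilon>\<close> by (subst nn_integral_Icc_inverse) auto
  also have "\<dots> = (\<integral>\<^sup>+ r. ennreal (\<epsilon> / r) * indicator {a..b} r \<partial>lebesgue)"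
    by (rule nn_integral_completion[symmetric])
  also have "\<dots> \<le> ennreal B"
    unfolding B(1)[symmetric]
  proof (rule nn_integral_mono)
    fix r :: real
    show "ennreal (\<epsilon> / r) * indicator {a..b} r \<le> ennreal (q r) * indicator {0<..} r"
      using ab q[of r] by (auto simp: indicator_def intro!: ennreal_leI)
  qed
  finally have "\<epsilon> * ln b - \<epsilon> * ln a \<le> B"
    using B(2) by (subst (asm) ennreal_le_iff) auto
  with ab(4) \<open>0 < \<epsilon>\<close> show False by (simp add: field_simps)
qed

lemma not_dominates_inverse_at_top:
  fixes q :: "real \<Rightarrow> real" and \<epsilon> R :: real
  assumes "(\<integral>\<^sup>+ r\<in>{0<..}. ennreal (q r) \<partial>lebesgue) < \<infinity>" "0 < \<epsilon>" "0 < R"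
  shows "\<exists>r\<ge>R. q r < \<epsilon> / r"
proof -
  have "\<exists>r\<in>{R..}. q r < \<epsilon> / r"
  proof (rule not_dominates_inverse[OF assms(1,2)])
    fix C :: real
    show "\<exists>a b. 0 < a \<and> a \<le> b \<and> {a..b} \<subseteq> {R..} \<and> C \<le> ln b - ln a"
      using \<open>0 < R\<close> by (intro exI[of _ R] exI[of _ "R * exp \<bar>C\<bar>"]) (auto simp: ln_mult)
  qed
  then show ?thesis by auto
qed

lemma not_dominates_inverse_at_0:
  fixes q :: "real \<Rightarrow> real" and \<epsilon> R :: real
  assumes "(\<integral>\<^sup>+ r\<in>{0<..}. ennreal (q r) \<partial>lebesgue) < \<infinity>" "0 < \<epsilon>" "0 < R"
  shows "\<exists>r>0. r \<le> R \<and> q r < \<epsilon> / r"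
proof -
  have "\<exists>r\<in>{0<..R}. q r < \<epsilon> / r"
  proof (rule not_dominates_inverse[OF assms(1,2)])
    fix C :: real
    show "\<exists>a b. 0 < a \<and> a \<le> b \<and> {a..b} \<subseteq> {0<..R} \<and> C \<le> ln b - ln a"
      using \<open>0 < R\<close> by (intro exI[of _ "R * exp (-\<bar>C\<bar>)"] exI[of _ R])
        (auto simp: ln_mult subset_eq intro: order.strict_trans2[of 0 "R * exp (-\<bar>C\<bar>)"])
  qed
  then show ?thesis by auto
qed

text \<open>Bounds over compact subintervals avoid improper integrals until the norms are evaluated.
  Continuity and sign are demanded on the whole half-line so that bounds over different
  \<open>I\<close> can be added, compared and glued.\<close>

definition bounded_integrals :: "real set \<Rightarrow> (real \<Rightarrow> real) \<Rightarrow> real \<Rightarrow> bool" where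
  "bounded_integrals I p C \<longleftrightarrow> continuous_on {0<..} p \<and> (\<forall>r>0. 0 \<le> p r) \<and>
     (\<forall>a b. 0 < a \<longrightarrow> a \<le> b \<longrightarrow> {a..b} \<subseteq> I \<longrightarrow> integral {a..b} p \<le> C)"

lemma bounded_integralsI:
  assumes "continuous_on {0<..} p" "\<And>r. 0 < r \<Longrightarrow> 0 \<le> p r"
    "\<And>a b. 0 < a \<Longrightarrow> a \<le> b \<Longrightarrow> {a..b} \<subseteq> I \<Longrightarrow> integral {a..b} p \<le> C"
  shows "bounded_integrals I p C"
  using assms by (auto simp: bounded_integrals_def)

lemma bounded_integralsD:
  assumes "bounded_integrals I p C" "0 < a" "a \<le> b" "{a..b} \<subseteq> I"
  shows "integral {a..b} p \<le> C"
  using assms by (simp add: bounded_integrals_def)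

lemma integrable_Icc_pos:
  fixes p :: "real \<Rightarrow> real"
  assumes "continuous_on {0<..} p" "0 < a"
  shows "p integrable_on {a..b}"
  using assms by (intro integrable_continuous_real) (auto elim: continuous_on_subset)

lemma bounded_integrals_mono:
  assumes "bounded_integrals I q C" "continuous_on {0<..} p"
    "\<And>r. 0 < r \<Longrightarrow> 0 \<le> p r" "\<And>r. 0 < r \<Longrightarrow> r \<in> J \<Longrightarrow> p r \<le> q r" "J \<subseteq> I" "C \<le> C'"
  shows "bounded_integrals J p C'"
proof (rule bounded_integralsI)
  fix a b :: real assume ab: "0 < a" "a \<le> b" "{a..b} \<subseteq> J"
  then have "integral {a..b} p \<le> integral {a..b} q"
    using assms by (intro integral_le integrable_Icc_pos) (auto simp: bounded_integrals_def)
  also have "\<dots> \<le> C'" using assms ab unfolding bounded_integrals_def by (metis order.trans)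
  finally show "integral {a..b} p \<le> C'" .
qed (use assms in auto)

lemma bounded_integrals_add:
  assumes "bounded_integrals I p A" "bounded_integrals I q B"
  shows "bounded_integrals I (\<lambda>r. p r + q r) (A + B)"
proof (rule bounded_integralsI)
  fix a b :: real assume ab: "0 < a" "a \<le> b" "{a..b} \<subseteq> I"
  then show "integral {a..b} (\<lambda>r. p r + q r) \<le> A + B"
    using assms by (subst integral_add) (auto simp: bounded_integrals_def intro!: integrable_Icc_pos add_mono)
qed (use assms in \<open>auto simp: bounded_integrals_def intro!: continuous_intros\<close>)

lemma bounded_integrals_cmult:
  assumes "bounded_integrals I p A" "0 \<le> c"
  shows "bounded_integrals I (\<lambda>r. c * p r) (c * A)"
  using assms by (auto simp: bounded_integrals_def intro!: continuous_intros mult_left_mono)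

lemma bounded_integrals_split:
  assumes "bounded_integrals {0<..1} p A" "bounded_integrals {1..} p B"
  shows "bounded_integrals {0<..} p (A + B)"
proof -
  \<comment> \<open>The degenerate interval \<open>{1..1}\<close> has integral 0. Non-negativity of
    \<open>A\<close> and \<open>B\<close> covers the intervals \<open>{a..b}\<close> lying on one
    side of 1.\<close>
  have "0 \<le> A" using assms(1)[unfolded bounded_integrals_def, THEN conjunct2, THEN conjunct2, rule_format, of 1 1] by simp
  moreover have "0 \<le> B" using assms(2)[unfolded bounded_integrals_def, THEN conjunct2, THEN conjunct2, rule_format, of 1 1] by simp
  moreover have A: "integral {a..b} p \<le> A" if "0 < a" "a \<le> b" "b \<le> 1" for a b
    using that assms(1) by (auto simp: bounded_integrals_def subset_eq)
  moreover have B: "integral {a..b} p \<le> B" if "a \<le> b" "1 \<le> a" for a b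
    using that assms(2) by (auto simp: bounded_integrals_def subset_eq)
  moreover have "integral {a..b} p = integral {a..1} p + integral {1..b} p" if "0 < a" "a \<le> 1" "1 \<le> b" for a b
    using that assms(1) by (intro Henstock_Kurzweil_Integration.integral_combine[symmetric] integrable_Icc_pos) (auto simp: bounded_integrals_def)
  ultimately have "integral {a..b} p \<le> A + B" if "0 < a" "a \<le> b" for a b
    using that by (smt (verit))
  then show ?thesis using assms(1) by (auto simp: bounded_integrals_def)
qed

lemma bounded_integrals_linear:
  assumes "0 \<le> c"
  shows "bounded_integrals {0<..1} (\<lambda>r. c * r) c"
proof (rule bounded_integralsI)
  fix a b :: real assume ab: "0 < a" "a \<le> b" "{a..b} \<subseteq> {0<..1}"
  have "((\<lambda>r. c * r) has_integral c * b\<^sup>2 / 2 - c * a\<^sup>2 / 2) {a..b}"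
    using ab by (intro fundamental_theorem_of_calculus)
      (auto simp: has_real_derivative_iff_has_vector_derivative[symmetric] intro!: derivative_eq_intros)
  moreover have "c * b\<^sup>2 \<le> c * 1" using ab assms by (intro mult_left_mono) (auto simp: power_le_one_iff subset_eq)
  moreover have "0 \<le> c * a\<^sup>2" using assms by auto
  ultimately show "integral {a..b} (\<lambda>r. c * r) \<le> c"
    using assms by (simp only: integral_unique)
qed (use assms in \<open>auto intro!: continuous_intros\<close>)

lemma bounded_integrals_const_bound_nonneg:
  assumes "bounded_integrals {0<..} p C" shows "0 \<le> C"
  using assms[unfolded bounded_integrals_def, THEN conjunct2, THEN conjunct2, rule_format, of 1 1] by simp

lemma integral_pos_FTC:
  fixes F p :: "real \<Rightarrow> real"
  assumes "\<And>r. 0 < r \<Longrightarrow> (F has_real_derivative p r) (at r)" "0 < a" "a \<le> b"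
  shows "integral {a..b} p = F b - F a"
  using assms by (intro integral_unique fundamental_theorem_of_calculus)
      (auto simp: has_real_derivative_iff_has_vector_derivative[symmetric] intro: has_field_derivative_at_within)

lemma integral_mono_interval:
  fixes q :: "real \<Rightarrow> real"
  assumes "continuous_on {0<..} q" "\<And>r. 0 < r \<Longrightarrow> 0 \<le> q r" "0 < a" "a \<le> a'" "b' \<le> b"
  shows "integral {a'..b'} q \<le> integral {a..b} q"
  using assms by (intro integral_subset_le integrable_Icc_pos) auto

text \<open>If $\int p$ were large, then $|r W'|$ would be large on one of $[a/2,a]$ and $[b,2b]$, and
  $W$ could not stay in the unit interval there.\<close>

lemma log_average_bound:
  fixes W K p q :: "real \<Rightarrow> real"
  assumes W: "\<And>r. 0 < r \<Longrightarrow> (W has_real_derivative K r / r) (at r)"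
    and K: "\<And>r. 0 < r \<Longrightarrow> (K has_real_derivative p r - q r) (at r)"
    and W01: "\<And>r. 0 < r \<Longrightarrow> 0 \<le> W r \<and> W r \<le> 1"
    and p: "continuous_on {0<..} p" "\<And>r. 0 < r \<Longrightarrow> 0 \<le> p r"
    and q: "continuous_on {0<..} q" "\<And>r. 0 < r \<Longrightarrow> 0 \<le> q r"
    and ab: "0 < a" "a \<le> b"
  shows "integral {a..b} p \<le> 2 / ln 2 + integral {a / 2..2 * b} q"
proof -
  \<comment> \<open>As \<open>p\<close> is non-negative, only \<open>q\<close> can make
    \<open>K\<close> drop. The value of \<open>K\<close> at an end of \<open>{a..b}\<close>
    therefore propagates outwards through the adjacent dyadic interval, up to an integral of
    \<open>q\<close>.\<close>
  have incr: "K s - K r \<ge> - integral {r..s} q" if "0 < r" "r \<le> s" for r s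
  proof -
    have "integral {r..s} (\<lambda>x. p x - q x) = K s - K r" using that K by (intro integral_pos_FTC)
    also have "integral {r..s} (\<lambda>x. p x - q x) = integral {r..s} p - integral {r..s} q"
      using that p q by (intro integral_diff integrable_Icc_pos) auto
    finally have "K s - K r = integral {r..s} p - integral {r..s} q" by simp
    moreover have "0 \<le> integral {r..s} p"
      using that p by (intro integral_nonneg integrable_Icc_pos) auto
    ultimately show ?thesis by linarith
  qed
  \<comment> \<open>The derivative of \<open>W\<close> is \<open>K r / r\<close>, and
    \<open>{t..2 * t}\<close> has logarithmic length ln 2 whatever \<open>t\<close> is. This keeps
    the final bound independent of \<open>a\<close> and \<open>b\<close>.\<close>
  have log: "c * ln 2 \<le> W (2 * t) - W t" if "0 < t" "\<And>r. t \<le> r \<Longrightarrow> r \<le> 2 * t \<Longrightarrow> c \<le> K r" for c t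
  proof -
    have "W t - c * ln t \<le> W (2 * t) - c * ln (2 * t)"
    proof (rule DERIV_nonneg_imp_nondecreasing[of t "2 * t"])
      show "\<exists>y. ((\<lambda>r. W r - c * ln r) has_real_derivative y) (at x) \<and> 0 \<le> y" if "t \<le> x" "x \<le> 2 * t" for x
        using that \<open>0 < t\<close> \<open>\<And>r. t \<le> r \<Longrightarrow> r \<le> 2 * t \<Longrightarrow> c \<le> K r\<close>[OF that]
        by (intro exI[of _ "K x / x - c * (1 / x)"])
          (auto intro!: derivative_eq_intros W simp: divide_right_mono field_simps)
    qed (use that in auto)
    then show ?thesis using that(1) by (simp add: ln_mult algebra_simps)
  qed
  have log': "W (2 * t) - W t \<le> c * ln 2" if "0 < t" "\<And>r. t \<le> r \<Longrightarrow> r \<le> 2 * t \<Longrightarrow> K r \<le> c" for c t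
  proof -
    have "W (2 * t) - c * ln (2 * t) \<le> W t - c * ln t"
    proof (rule DERIV_nonpos_imp_nonincreasing[of t "2 * t"])
      show "\<exists>y. ((\<lambda>r. W r - c * ln r) has_real_derivative y) (at x) \<and> y \<le> 0" if "t \<le> x" "x \<le> 2 * t" for x
        using that \<open>0 < t\<close> \<open>\<And>r. t \<le> r \<Longrightarrow> r \<le> 2 * t \<Longrightarrow> K r \<le> c\<close>[OF that]
        by (intro exI[of _ "K x / x - c * (1 / x)"])
          (auto intro!: derivative_eq_intros W simp: divide_right_mono field_simps)
    qed (use that in auto)
    then show ?thesis using that(1) by (simp add: ln_mult algebra_simps)
  qed
  have qm: "integral {r..s} q \<le> integral {r'..s'} q" if "0 < r'" "r' \<le> r" "s \<le> s'" for r s r' s'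
    using that q by (intro integral_mono_interval) auto
  have "(K b - integral {b..2 * b} q) * ln 2 \<le> W (2 * b) - W b"
  proof (rule log)
    fix r assume r: "b \<le> r" "r \<le> 2 * b"
    then show "K b - integral {b..2 * b} q \<le> K r"
      using incr[of b r] qm[of b b r "2 * b"] ab by auto
  qed (use ab in auto)
  also have "\<dots> \<le> 1" using W01[of "2 * b"] W01[of b] ab by auto
  finally have 1: "K b - integral {b..2 * b} q \<le> 1 / ln 2" by (simp add: field_simps)
  \<comment> \<open>At the left end a very negative \<open>K a\<close> would force \<open>W\<close>
    to fall by more than 1 across \<open>{a / 2..a}\<close>. The unevaluated
    \<open>2 * (a / 2)\<close> lets \<open>log'\<close> apply with \<open>t = a / 2\<close>.\<close>
  have "W (2 * (a / 2)) - W (a / 2) \<le> (K a + integral {a / 2..a} q) * ln 2"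
  proof (rule log')
    fix r assume r: "a / 2 \<le> r" "r \<le> 2 * (a / 2)"
    then show "K r \<le> K a + integral {a / 2..a} q"
      using incr[of r a] qm[of "a / 2" r a a] ab by auto
  qed (use ab in auto)
  moreover have "-1 \<le> W (2 * (a / 2)) - W (a / 2)" using W01[of a] W01[of "a / 2"] ab by auto
  ultimately have "-1 \<le> (K a + integral {a / 2..a} q) * ln 2" by linarith
  then have 2: "- (1 / ln 2) \<le> K a + integral {a / 2..a} q" by (simp add: field_simps)
  have "integral {a..b} (\<lambda>x. p x - q x) = K b - K a" using ab K by (intro integral_pos_FTC)
  also have "integral {a..b} (\<lambda>x. p x - q x) = integral {a..b} p - integral {a..b} q"
    using ab p q by (intro integral_diff integrable_Icc_pos) auto
  finally have "integral {a..b} p = K b - K a + integral {a..b} q" by simp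
  moreover have "integral {a / 2..a} q + integral {a..b} q = integral {a / 2..b} q"
    using ab q by (intro Henstock_Kurzweil_Integration.integral_combine integrable_Icc_pos) auto
  moreover have "integral {a / 2..b} q + integral {b..2 * b} q = integral {a / 2..2 * b} q"
    using ab q by (intro Henstock_Kurzweil_Integration.integral_combine integrable_Icc_pos) auto
  moreover have "1 / ln 2 + 1 / ln 2 = 2 / ln (2::real)" by simp
  ultimately show ?thesis using 1 2 by linarith
qed

section \<open>Weak derivatives on the half-line\<close>

lemma borel_measurable_lebesgue_continuous:
  fixes f :: "'a::euclidean_space \<Rightarrow> real"
  shows "continuous_on UNIV f \<Longrightarrow> f \<in> borel_measurable lebesgue"
  by (intro measurable_completion) (simp add: borel_measurable_continuous_onI)

section \<open>Smooth functions of one real variable\<close>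

lemma frechet_derivative_real_eq:
  "(\<phi> has_real_derivative c) (at x) \<Longrightarrow> frechet_derivative \<phi> (at x) = (\<lambda>h. c * h)"
  by (metis frechet_derivative_at has_field_derivative_def)

text \<open>In dimension one the basis is {1}, and the Frechet derivative evaluated at 1 is the
  ordinary one. With an existentially chosen \<phi>' in its place, inductions over \<open>k\<close>
  run on derivative rules alone.\<close>

lemma C_k_Suc_real:
  fixes \<phi> :: "real \<Rightarrow> real"
  shows "C_k (Suc k) \<phi> \<longleftrightarrow> (\<exists>\<phi>'. (\<forall>x. (\<phi> has_real_derivative \<phi>' x) (at x)) \<and> C_k k \<phi>')"
proof
  assume *: "C_k (Suc k) \<phi>"
  then have "\<forall>x. \<exists>c. (\<phi> has_real_derivative c) (at x)" by (simp add: real_differentiable_def)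
  then obtain \<phi>' where \<phi>': "\<And>x. (\<phi> has_real_derivative \<phi>' x) (at x)" by metis
  with * show "\<exists>\<phi>'. (\<forall>x. (\<phi> has_real_derivative \<phi>' x) (at x)) \<and> C_k k \<phi>'"
    by (intro exI[of _ \<phi>']) (simp add: frechet_derivative_real_eq[OF \<phi>'])
next
  assume "\<exists>\<phi>'. (\<forall>x. (\<phi> has_real_derivative \<phi>' x) (at x)) \<and> C_k k \<phi>'"
  then obtain \<phi>' where \<phi>': "\<And>x. (\<phi> has_real_derivative \<phi>' x) (at x)" "C_k k \<phi>'" by blast
  then show "C_k (Suc k) \<phi>"
    by (simp add: frechet_derivative_real_eq[OF \<phi>'(1)] real_differentiable_def) blast
qed

lemma C_k_Suc_realI:
  fixes \<phi> \<phi>' :: "real \<Rightarrow> real"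
  assumes "\<And>x. (\<phi> has_real_derivative \<phi>' x) (at x)" "C_k k \<phi>'"
  shows "C_k (Suc k) \<phi>"
  unfolding C_k_Suc_real using assms by blast

lemma C_k_Suc_imp:
  fixes \<phi> :: "real \<Rightarrow> real"
  shows "C_k (Suc k) \<phi> \<Longrightarrow> C_k k \<phi>"
proof (induction k arbitrary: \<phi>)
  case 0
  then obtain \<phi>' where "\<And>x. (\<phi> has_real_derivative \<phi>' x) (at x)"
    unfolding C_k_Suc_real by blast
  then have "continuous_on UNIV \<phi>"
    by (intro continuous_at_imp_continuous_on ballI DERIV_isCont)
  then show ?case by simp
next
  case (Suc k)
  obtain \<phi>' where \<phi>': "\<And>x. (\<phi> has_real_derivative \<phi>' x) (at x)" "C_k (Suc k) \<phi>'"
    using iffD1[OF C_k_Suc_real Suc.prems] by blast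
  show ?case by (rule C_k_Suc_realI[OF \<phi>'(1) Suc.IH[OF \<phi>'(2)]])
qed

lemma C_k_add:
  fixes \<phi> \<psi> :: "real \<Rightarrow> real"
  shows "C_k k \<phi> \<Longrightarrow> C_k k \<psi> \<Longrightarrow> C_k k (\<lambda>x. \<phi> x + \<psi> x)"
proof (induction k arbitrary: \<phi> \<psi>)
  case 0
  then show ?case by (simp add: continuous_on_add)
next
  case (Suc k)
  obtain \<phi>' where \<phi>': "\<And>x. (\<phi> has_real_derivative \<phi>' x) (at x)" "C_k k \<phi>'"
    using Suc.prems(1) unfolding C_k_Suc_real by blast
  obtain \<psi>' where \<psi>': "\<And>x. (\<psi> has_real_derivative \<psi>' x) (at x)" "C_k k \<psi>'"
    using Suc.prems(2) unfolding C_k_Suc_real by blast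
  show ?case
    by (rule C_k_Suc_realI[OF DERIV_add[OF \<phi>'(1) \<psi>'(1)] Suc.IH[OF \<phi>'(2) \<psi>'(2)]])
qed

lemma C_k_mult:
  fixes \<phi> \<psi> :: "real \<Rightarrow> real"
  shows "C_k k \<phi> \<Longrightarrow> C_k k \<psi> \<Longrightarrow> C_k k (\<lambda>x. \<phi> x * \<psi> x)"
proof (induction k arbitrary: \<phi> \<psi>)
  case 0
  then show ?case by (simp add: continuous_on_mult)
next
  case (Suc k)
  obtain \<phi>' where \<phi>': "\<And>x. (\<phi> has_real_derivative \<phi>' x) (at x)" "C_k k \<phi>'"
    using Suc.prems(1) unfolding C_k_Suc_real by blast
  obtain \<psi>' where \<psi>': "\<And>x. (\<psi> has_real_derivative \<psi>' x) (at x)" "C_k k \<psi>'"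
    using Suc.prems(2) unfolding C_k_Suc_real by blast
  show ?case
    by (rule C_k_Suc_realI[OF DERIV_mult[OF \<phi>'(1) \<psi>'(1)]
          C_k_add[OF Suc.IH[OF \<phi>'(2) C_k_Suc_imp[OF Suc.prems(2)]] Suc.IH[OF \<psi>'(2) C_k_Suc_imp[OF Suc.prems(1)]]]])
qed

text \<open>Each differentiation produces a further factor \<alpha>, so the induction carries an
  arbitrary constant \<open>c\<close> in front.\<close>

lemma C_k_affine:
  fixes \<phi> :: "real \<Rightarrow> real"
  shows "C_k k \<phi> \<Longrightarrow> C_k k (\<lambda>x. c * \<phi> (\<alpha> * x + \<beta>))"
proof (induction k arbitrary: \<phi> c)
  case 0
  then have "continuous_on UNIV (\<lambda>x. \<phi> (\<alpha> * x + \<beta>))"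
    by (intro continuous_on_compose2[of UNIV \<phi> UNIV "\<lambda>x. \<alpha> * x + \<beta>"] continuous_intros) auto
  then show ?case by (simp add: continuous_on_mult_left)
next
  case (Suc k)
  obtain \<phi>' where \<phi>': "\<And>x. (\<phi> has_real_derivative \<phi>' x) (at x)" "C_k k \<phi>'"
    using Suc.prems unfolding C_k_Suc_real by blast
  have affine: "((\<lambda>x. \<alpha> * x + \<beta>) has_real_derivative \<alpha>) (at x)" for x
    by (auto intro!: derivative_eq_intros)
  have "((\<lambda>x. c * \<phi> (\<alpha> * x + \<beta>)) has_real_derivative (c * \<alpha>) * \<phi>' (\<alpha> * x + \<beta>)) (at x)" for x
    using DERIV_cmult[OF DERIV_chain2[where f = \<phi> and g = "\<lambda>x. \<alpha> * x + \<beta>", OF \<phi>'(1) affine], of c x]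
    by (simp add: mult_ac)
  then show ?case by (rule C_k_Suc_realI) (rule Suc.IH[OF \<phi>'(2)])
qed

section \<open>Flat exponentials and bump functions\<close>

definition flat_exp :: "real poly \<Rightarrow> real \<Rightarrow> real" where
  "flat_exp p x = (if 0 < x then poly p (1 / x) * exp (- (1 / x)) else 0)"

lemma poly_exp_tendsto_0: "((\<lambda>y. poly p y * exp (- y)) \<longlongrightarrow> (0::real)) at_top"
proof -
  have "((\<lambda>y. \<Sum>i\<le>degree p. coeff p i * (y ^ i / exp y)) \<longlongrightarrow> (\<Sum>i\<le>degree p. coeff p i * 0)) at_top"
    by (intro tendsto_intros tendsto_power_div_exp_0)
  then show ?thesis by (simp add: poly_altdef exp_minus sum_divide_distrib field_simps)
qed

text \<open>With y = 1/x the derivative of p(y) exp(-y) is y^2 (p(y) - p'(y)) exp(-y), and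
  \<open>[:0, 0, 1:]\<close> is the polynomial y^2. The family is thus closed under differentiation,
  so smoothness follows by induction with \<open>p\<close> arbitrary.\<close>

lemma flat_exp_deriv:
  "(flat_exp p has_real_derivative flat_exp ([:0, 0, 1:] * (p - pderiv p)) x) (at x)"
proof -
  consider "x > 0" | "x < 0" | "x = 0" by linarith
  then show ?thesis
  proof cases
    case 1
    have "((\<lambda>x. poly p (1 / x) * exp (- (1 / x))) has_real_derivative
      flat_exp ([:0, 0, 1:] * (p - pderiv p)) x) (at x)"
      using 1 by (auto intro!: derivative_eq_intros DERIV_chain2[of "poly p"] poly_DERIV simp: flat_exp_def field_simps power2_eq_square)
    moreover have "\<forall>\<^sub>F y in nhds x. poly p (1 / y) * exp (- (1 / y)) = flat_exp p y"
      using eventually_nhds_in_open[of "{0<..}" x] 1 by (auto elim!: eventually_mono simp: flat_exp_def)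
    ultimately show ?thesis by (subst (asm) DERIV_cong_ev[OF refl _ refl]) auto
  next
    case 2
    have "((\<lambda>x. 0::real) has_real_derivative flat_exp ([:0, 0, 1:] * (p - pderiv p)) x) (at x)"
      using 2 by (simp add: flat_exp_def)
    moreover have "\<forall>\<^sub>F y in nhds x. 0 = flat_exp p y"
      using eventually_nhds_in_open[of "{..<0}" x] 2 by (auto elim!: eventually_mono simp: flat_exp_def)
    ultimately show ?thesis by (subst (asm) DERIV_cong_ev[OF refl _ refl]) auto
  next
    case 3
    \<comment> \<open>Only the right-hand difference quotient is nontrivial. With y = 1/h it is y
      p(y) exp(-y), hence the polynomial \<open>pCons 0 p\<close> below.\<close>
    have "((\<lambda>h. flat_exp p h / h) \<longlongrightarrow> 0) (at 0)"
    proof (rule filterlim_split_at)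
      have "((\<lambda>y. poly (pCons 0 p) y * exp (- y)) \<longlongrightarrow> 0) at_top" by (rule poly_exp_tendsto_0)
      moreover have "\<forall>\<^sub>F y in at_top. poly (pCons 0 p) y * exp (- y) = flat_exp p (inverse y) / inverse y"
        by (rule eventually_mono[OF eventually_gt_at_top[of 0]]) (simp add: flat_exp_def field_simps)
      ultimately show "((\<lambda>h. flat_exp p h / h) \<longlongrightarrow> 0) (at_right 0)"
        unfolding filterlim_at_right_to_top by (rule Lim_transform_eventually)
      have "\<forall>\<^sub>F h in at_left 0. 0 = flat_exp p h / h"
        by (auto simp: flat_exp_def eventually_at_filter)
      then show "((\<lambda>h. flat_exp p h / h) \<longlongrightarrow> 0) (at_left 0)"
        by (rule Lim_transform_eventually[OF tendsto_const])
    qed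
    then show ?thesis using 3 by (simp add: DERIV_def flat_exp_def)
  qed
qed

lemma C_k_flat_exp: "C_k k (flat_exp p)"
proof (induction k arbitrary: p)
  case 0
  show ?case using flat_exp_deriv by (auto simp: continuous_on_eq_continuous_at intro: DERIV_isCont)
next
  case (Suc k)
  show ?case by (rule C_k_Suc_realI[OF flat_exp_deriv Suc.IH])
qed

text \<open>The factor \<open>real (Suc n)\<close> drives both arguments to infinity inside the
  interval, where exp(-1/x) tends to 1. The bumps converge pointwise to the indicator of the open
  interval and stay below it, which is what dominated convergence asks for.\<close>

definition bump :: "real \<Rightarrow> real \<Rightarrow> nat \<Rightarrow> real \<Rightarrow> real" where
  "bump a b n x = flat_exp 1 (real (Suc n) * (x - a)) * flat_exp 1 (real (Suc n) * (b - x))"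

lemma flat_exp_1: "0 \<le> flat_exp 1 x" "flat_exp 1 x \<le> 1" "x \<le> 0 \<Longrightarrow> flat_exp 1 x = 0"
  by (auto simp: flat_exp_def)

lemma bump_range: "0 \<le> bump a b n x" "bump a b n x \<le> indicator {a<..<b} x"
proof -
  show "0 \<le> bump a b n x" unfolding bump_def by (intro mult_nonneg_nonneg flat_exp_1)
  show "bump a b n x \<le> indicator {a<..<b} x"
  proof (cases "x \<in> {a<..<b}")
    case True
    then show ?thesis unfolding bump_def by (simp add: mult_le_one flat_exp_1)
  next
    case False
    then have "x - a \<le> 0 \<or> b - x \<le> 0" by auto
    then have "real (Suc n) * (x - a) \<le> 0 \<or> real (Suc n) * (b - x) \<le> 0"
      by (metis mult_nonneg_nonpos of_nat_0_le_iff)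
    then have "bump a b n x = 0" unfolding bump_def by (auto simp only: flat_exp_1 mult_zero_left mult_zero_right)
    with False show ?thesis by simp
  qed
qed

lemma bump_test_function:
  assumes "0 < a" shows "bump a b n \<in> test_functions {0<..}"
proof -
  have "C_k k (bump a b n)" for k
  proof -
    have "C_k k (\<lambda>x. 1 * flat_exp 1 (real (Suc n) * x + (- real (Suc n) * a)))"
      "C_k k (\<lambda>x. 1 * flat_exp 1 ((- real (Suc n)) * x + real (Suc n) * b))"
      by (intro C_k_affine C_k_flat_exp)+
    from C_k_mult[OF this] show ?thesis by (simp add: bump_def[abs_def] algebra_simps)
  qed
  moreover have "bump a b n x = 0" if "x \<notin> {a..b}" for x
  proof -
    have "x \<notin> {a<..<b}" using that by auto
    then show ?thesis using bump_range[of a b n x] by simp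
  qed
  ultimately show ?thesis using assms by (auto simp: test_functions_def intro!: exI[of _ "{a..b}"])
qed

lemma bump_tendsto: "(\<lambda>n. bump a b n x) \<longlonglongrightarrow> indicator {a<..<b} x"
proof (cases "x \<in> {a<..<b}")
  case True
  have lim: "(\<lambda>n. flat_exp 1 (real (Suc n) * c)) \<longlonglongrightarrow> 1" if "0 < c" for c
  proof -
    have "(\<lambda>n. exp (- (inverse (real (Suc n)) * (1 / c)))) \<longlonglongrightarrow> exp (- (0 * (1 / c)))"
      by (intro tendsto_intros LIMSEQ_inverse_real_of_nat)
    moreover have "exp (- (inverse (real (Suc n)) * (1 / c))) = flat_exp 1 (real (Suc n) * c)" for n
      using that by (simp add: flat_exp_def divide_inverse del: of_nat_Suc)
    ultimately show ?thesis by simp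
  qed
  have "(\<lambda>n. bump a b n x) \<longlonglongrightarrow> 1 * 1"
    unfolding bump_def using True by (intro tendsto_mult lim) auto
  with True show ?thesis by simp
next
  case False
  have "bump a b n x = 0" for n
    using False bump_range(1)[of a b n x] bump_range(2)[of a b n x] by simp
  with False show ?thesis by simp
qed

text \<open>The measures with the positive and the negative part of \<open>f\<close> as densities
  agree on the rays \<open>{x<..}\<close>, which generate the Borel sets, hence everywhere. So
  \<open>f\<close> integrates to 0 over every Borel set.\<close>

lemma AE_eq_0_if_Ioi_integrals_eq_0:
  fixes f :: "real \<Rightarrow> real"
  assumes f: "integrable lborel f" and 0: "\<And>x. (LINT t:{x<..}|lborel. f t) = 0"
  shows "AE x in lborel. f x = 0"
proof -
  note [measurable] = borel_measurable_integrable[OF f]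
  have int: "integrable lborel (\<lambda>t. indicator A t * f t)" if "A \<in> sets borel" for A :: "real set"
    using integrable_mult_indicator[OF _ f, of A] that by simp
  have nn: "(\<integral>\<^sup>+ t. ennreal (indicator A t * f t) \<partial>lborel) < \<infinity>" "(\<integral>\<^sup>+ t. ennreal (- (indicator A t * f t)) \<partial>lborel) < \<infinity>"
    if "A \<in> sets borel" for A :: "real set"
    using int[OF that] by (auto simp: real_integrable_def top.not_eq_extremum)
  have eq: "ennreal (indicator A t * f t) = ennreal (f t) * indicator A t"
    "ennreal (- (indicator A t * f t)) = ennreal (- f t) * indicator A t" for A t
    by (auto simp: indicator_def)
  have dens: "emeasure (density lborel (\<lambda>t. ennreal (f t))) A = (\<integral>\<^sup>+ t. ennreal (indicator A t * f t) \<partial>lborel)"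
    "emeasure (density lborel (\<lambda>t. ennreal (- f t))) A = (\<integral>\<^sup>+ t. ennreal (- (indicator A t * f t)) \<partial>lborel)"
    if "A \<in> sets borel" for A
    using that unfolding eq by (auto simp: emeasure_density)
  have "density lborel (\<lambda>t. ennreal (f t)) = density lborel (\<lambda>t. ennreal (- f t))"
  proof (rule measure_eqI_lessThan)
    fix x :: real
    show "emeasure (density lborel (\<lambda>t. ennreal (f t))) {x<..} < \<infinity>"
      using nn(1)[of "{x<..}"] by (simp add: dens)
    have "(\<integral> t. indicator {x<..} t * f t \<partial>lborel) = 0" using 0[of x] by (simp add: set_lebesgue_integral_def)
    then have "enn2real (\<integral>\<^sup>+ t. ennreal (indicator {x<..} t * f t) \<partial>lborel) = enn2real (\<integral>\<^sup>+ t. ennreal (- (indicator {x<..} t * f t)) \<partial>lborel)"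
      by (subst (asm) real_lebesgue_integral_def[OF int]) auto
    then show "emeasure (density lborel (\<lambda>t. ennreal (f t))) {x<..} = emeasure (density lborel (\<lambda>t. ennreal (- f t))) {x<..}"
      using nn[of "{x<..}"] by (simp add: dens) (metis ennreal_enn2real)
  qed auto
  then have "(\<integral> t. indicator A t * f t \<partial>lborel) = 0" if "A \<in> sets borel" for A
    using dens[OF that] by (subst real_lebesgue_integral_def[OF int[OF that]]) simp
  then have "(LINT t:A|lborel. f t) = (LINT t:A|lborel. 0)" if "A \<in> sets lborel" for A
    using that by (simp add: set_lebesgue_integral_def)
  then show ?thesis by (intro density_unique_real f) auto
qed

text \<open>The fundamental lemma of the calculus of variations: bumps transfer the hypothesis to
  the indicators of all bounded intervals away from 0, and countably many of these exhaust the
  half-line.\<close>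

lemma AE_eq_0_if_test_integrals_eq_0:
  fixes w :: "real \<Rightarrow> real"
  assumes w: "loc_integrable_on w {0<..}"
    and 0: "\<And>\<phi>. \<phi> \<in> test_functions {0<..} \<Longrightarrow> (LINT x:{0<..}|lebesgue. w x * \<phi> x) = 0"
  shows "AE x in lebesgue. 0 < x \<longrightarrow> w x = 0"
proof -
  have int: "integrable lebesgue (\<lambda>x. indicator {a<..<b} x * w x)" if "0 < a" for a b
  proof -
    have "{a..b} \<subseteq> {0<..}" using that by auto
    then have "set_integrable lebesgue {a..b} w" using w compact_Icc unfolding loc_integrable_on_def by blast
    then have "set_integrable lebesgue {a<..<b} w" by (rule set_integrable_subset) auto
    then show ?thesis by (simp add: set_integrable_def)
  qed
  have zero: "(\<integral>x. indicator {a<..<b} x * w x \<partial>lebesgue) = 0" if a: "0 < a" for a b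
  proof -
    have eq: "indicator {0<..} x * (w x * bump a b n x) = (indicator {a<..<b} x * w x) * bump a b n x" for x n
      using bump_range[of a b n x] a by (auto simp: indicator_def split: if_splits)
    have bump_meas: "bump a b n \<in> borel_measurable lebesgue" for n
    proof -
      have "C_k 0 (bump a b n)" using bump_test_function[OF a] by (auto simp: test_functions_def simp del: C_k.simps)
      then show ?thesis by (intro borel_measurable_lebesgue_continuous) auto
    qed
    have "(\<lambda>n. \<integral>x. (indicator {a<..<b} x * w x) * bump a b n x \<partial>lebesgue) \<longlonglongrightarrow> (\<integral>x. (indicator {a<..<b} x * w x) * indicator {a<..<b} x \<partial>lebesgue)"
    proof (rule integral_dominated_convergence[where w = "\<lambda>x. norm (indicator {a<..<b} x * w x)"])
      show "AE x in lebesgue. norm ((indicator {a<..<b} x * w x) * bump a b n x) \<le> norm (indicator {a<..<b} x * w x)" for n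
      proof (rule AE_I2)
        fix x
        have "bump a b n x \<le> 1" by (rule order_trans[OF bump_range(2) indicator_le_1])
        then show "norm ((indicator {a<..<b} x * w x) * bump a b n x) \<le> norm (indicator {a<..<b} x * w x)"
          using bump_range(1)[of a b n x] by (simp add: abs_mult mult_left_le)
      qed
      show "AE x in lebesgue. (\<lambda>n. (indicator {a<..<b} x * w x) * bump a b n x) \<longlonglongrightarrow> (indicator {a<..<b} x * w x) * indicator {a<..<b} x"
        by (intro AE_I2 tendsto_intros bump_tendsto)
      note wm = borel_measurable_integrable[OF int[OF a, of b]]
      show "(\<lambda>x. indicator {a<..<b} x * w x * indicator {a<..<b} x) \<in> borel_measurable lebesgue"
        by (intro borel_measurable_times[OF wm] borel_measurable_indicator) auto
      show "(\<lambda>x. indicator {a<..<b} x * w x * bump a b n x) \<in> borel_measurable lebesgue" for n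
        by (rule borel_measurable_times[OF wm bump_meas])
      show "integrable lebesgue (\<lambda>x. norm (indicator {a<..<b} x * w x))" using int[OF a, of b] by (rule integrable_norm)
    qed
    moreover have "(\<integral>x. (indicator {a<..<b} x * w x) * bump a b n x \<partial>lebesgue) = 0" for n
      using 0[OF bump_test_function[OF a, of b n]] unfolding set_lebesgue_integral_def eq[symmetric] by simp
    moreover have "(indicator {a<..<b} x * w x) * indicator {a<..<b} x = indicator {a<..<b} x * w x" for x :: real
      by (simp add: indicator_def)
    ultimately have "(\<lambda>n::nat. 0) \<longlonglongrightarrow> (\<integral>x. indicator {a<..<b} x * w x \<partial>lebesgue)" by (simp only:)
    then show ?thesis by (simp add: LIMSEQ_const_iff)
  qed
  have AE_n: "AE x in lebesgue. x \<in> {1 / real (Suc n)<..<real (Suc n)} \<longrightarrow> w x = 0" for n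
  proof -
    define a where "a = 1 / real (Suc n)"
    define b where "b = real (Suc n)"
    have a: "0 < a" by (simp add: a_def)
    let ?f = "\<lambda>x. indicator {a<..<b} x * w x"
    \<comment> \<open>The criterion by ray integrals is stated for \<open>lborel\<close>, so the
      Lebesgue measurable function is replaced by an almost everywhere equal Borel one.\<close>
    obtain f where f: "f \<in> borel_measurable lborel" "AE x in lborel. ?f x = f x"
      using completion_ex_borel_measurable_real[OF borel_measurable_integrable[OF int[OF a, of b]]] by auto
    have f': "f \<in> borel_measurable lebesgue" using f(1) by (rule measurable_completion)
    have AEf: "AE x in lebesgue. ?f x = f x" using f(2) by (rule AE_completion)
    have "integrable lebesgue f"
      using int[OF a, of b] f' AEf by (subst integrable_cong_AE[where g = ?f]) (auto dest: borel_measurable_integrable)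
    then have "integrable lborel f" using integrable_completion[OF f(1)] by simp
    moreover have "(LINT t:{x<..}|lborel. f t) = 0" for x
    proof -
      have "(LINT t:{x<..}|lborel. f t) = (\<integral>t. indicator {x<..} t * f t \<partial>lebesgue)"
        using f(1) by (simp add: set_lebesgue_integral_def integral_completion)
      also have "\<dots> = (\<integral>t. indicator {x<..} t * ?f t \<partial>lebesgue)"
        using f' AEf borel_measurable_integrable[OF int[OF a, of b]]
        by (intro integral_cong_AE) (auto intro!: borel_measurable_times borel_measurable_indicator)
      also have "\<dots> = (\<integral>t. indicator {max x a<..<b} t * w t \<partial>lebesgue)"
        by (intro Bochner_Integration.integral_cong) (auto simp: indicator_def)
      also have "\<dots> = 0" using a by (intro zero) auto
      finally show ?thesis .
    qed
    ultimately have "AE x in lborel. f x = 0" by (rule AE_eq_0_if_Ioi_integrals_eq_0)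
    then have "AE x in lebesgue. f x = 0" by (rule AE_completion)
    with AEf show ?thesis by eventually_elim (auto simp: indicator_def a_def b_def split: if_splits)
  qed
  have "AE x in lebesgue. \<forall>n. x \<in> {1 / real (Suc n)<..<real (Suc n)} \<longrightarrow> w x = 0"
    unfolding AE_all_countable using AE_n by blast
  then show ?thesis
  proof eventually_elim
    case (elim x)
    show ?case
    proof
      assume x: "0 < x"
      obtain n where n: "max x (1 / x) < real n" using reals_Archimedean2 by blast
      then have "1 / x < real (Suc n)" "x < real (Suc n)" by auto
      moreover from this have "1 / real (Suc n) < x" using x by (simp add: field_simps)
      ultimately show "w x = 0" using elim by auto
    qed
  qed
qed

lemma loc_integrable_on_diff:
  assumes "loc_integrable_on v \<Omega>" "loc_integrable_on w \<Omega>"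
  shows "loc_integrable_on (\<lambda>x. v x - w x) \<Omega>"
  using assms by (auto simp: loc_integrable_on_def intro!: set_integral_diff)

lemma set_integrable_loc_times_test:
  fixes w :: "'a::euclidean_space \<Rightarrow> real"
  assumes w: "loc_integrable_on w \<Omega>" and \<phi>: "continuous_on UNIV \<phi>"
    and K: "compact K" "K \<subseteq> \<Omega>" "\<And>x. x \<notin> K \<Longrightarrow> \<phi> x = 0"
  shows "set_integrable lebesgue \<Omega> (\<lambda>x. w x * \<phi> x)"
proof -
  have "compact (\<phi> ` K)" using \<phi> K by (intro compact_continuous_image) (auto elim: continuous_on_subset)
  then obtain B where B: "\<And>x. x \<in> K \<Longrightarrow> \<bar>\<phi> x\<bar> \<le> B" using compact_imp_bounded[of "\<phi> ` K"] by (metis bounded_iff image_eqI real_norm_def)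
  have int: "integrable lebesgue (\<lambda>x. indicator K x * w x)"
    using w K by (auto simp: loc_integrable_on_def set_integrable_def)
  have meas: "\<phi> \<in> borel_measurable lebesgue"
    using \<phi> by (intro borel_measurable_lebesgue_continuous) auto
  have eq: "indicator \<Omega> x * (w x * \<phi> x) = indicator K x * w x * \<phi> x" for x
    using K by (cases "x \<in> K") (auto simp: indicator_def)
  have "integrable lebesgue (\<lambda>x. indicator K x * w x * \<phi> x)"
  proof (rule Bochner_Integration.integrable_bound)
    show "integrable lebesgue (\<lambda>x. B * (indicator K x * w x))" using int by simp
    show "AE x in lebesgue. norm (indicator K x * w x * \<phi> x) \<le> norm (B * (indicator K x * w x))"
    proof (rule AE_I2)
      fix x show "norm (indicator K x * w x * \<phi> x) \<le> norm (B * (indicator K x * w x))"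
      proof (cases "x \<in> K")
        case True
        then have "\<bar>w x\<bar> * \<bar>\<phi> x\<bar> \<le> \<bar>w x\<bar> * \<bar>B\<bar>" using B[OF True] by (intro mult_left_mono) auto
        then show ?thesis using True by (simp add: abs_mult mult.commute)
      qed simp
    qed
  qed (use borel_measurable_integrable[OF int] meas in \<open>auto intro!: borel_measurable_times\<close>)
  then show ?thesis unfolding set_integrable_def by (simp add: eq)
qed

text \<open>Both integrate to the same value against every test function, so the fundamental lemma
  applies to the difference. This identifies the function selected by \<open>SOME\<close> in
  \<open>radial_deriv\<close> with a continuous classical derivative, up to a null set.\<close>

lemma weak_derivative_unique:
  assumes "weak_partial {0<..} 1 u v" "weak_partial {0<..} (1::real) u w"
  shows "AE x in lebesgue. 0 < x \<longrightarrow> v x = w x"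
proof -
  have "AE x in lebesgue. 0 < x \<longrightarrow> v x - w x = 0"
  proof (rule AE_eq_0_if_test_integrals_eq_0)
    show "loc_integrable_on (\<lambda>x. v x - w x) {0<..}"
      using assms by (auto simp: weak_partial_def intro: loc_integrable_on_diff)
    fix \<phi> :: "real \<Rightarrow> real" assume \<phi>: "\<phi> \<in> test_functions {0<..}"
    then obtain K where K: "compact K" "K \<subseteq> {0<..}" "\<And>x. x \<notin> K \<Longrightarrow> \<phi> x = 0" and cont: "C_k 0 \<phi>"
      by (auto simp: test_functions_def simp del: C_k.simps)
    have "set_integrable lebesgue {0<..} (\<lambda>x. v x * \<phi> x)" "set_integrable lebesgue {0<..} (\<lambda>x. w x * \<phi> x)"
      using assms K cont by (auto simp: weak_partial_def intro!: set_integrable_loc_times_test)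
    then have "(LINT x:{0<..}|lebesgue. (v x - w x) * \<phi> x) = (LINT x:{0<..}|lebesgue. v x * \<phi> x) - (LINT x:{0<..}|lebesgue. w x * \<phi> x)"
      by (simp add: left_diff_distrib set_integral_diff)
    moreover have "- (LINT x:{0<..}|lebesgue. v x * \<phi> x) = - (LINT x:{0<..}|lebesgue. w x * \<phi> x)"
      using assms \<phi> unfolding weak_partial_def by metis
    ultimately show "(LINT x:{0<..}|lebesgue. (v x - w x) * \<phi> x) = 0" by simp
  qed
  then show ?thesis by simp
qed

section \<open>Integration by parts for classically differentiable functions\<close>

lemma test_function_props:
  fixes \<phi> :: "'a::euclidean_space \<Rightarrow> real"
  assumes "\<phi> \<in> test_functions \<Omega>"
  shows "\<And>x. (\<phi> has_derivative frechet_derivative \<phi> (at x)) (at x)"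
    and "continuous_on UNIV \<phi>"
    and "\<And>b. b \<in> Basis \<Longrightarrow> continuous_on UNIV (\<lambda>x. frechet_derivative \<phi> (at x) b)"
    and "\<exists>K. compact K \<and> K \<subseteq> \<Omega> \<and> (\<forall>x. x \<notin> K \<longrightarrow> \<phi> x = 0 \<and> frechet_derivative \<phi> (at x) = (\<lambda>_. 0))"
proof -
  have "C_k (Suc 0) \<phi>" using assms unfolding test_functions_def by blast
  then have "\<And>x. \<phi> differentiable (at x)" and c: "\<And>b. b \<in> Basis \<Longrightarrow> continuous_on UNIV (\<lambda>x. frechet_derivative \<phi> (at x) b)"
    by auto
  then show der: "(\<phi> has_derivative frechet_derivative \<phi> (at x)) (at x)" for x by (simp add: frechet_derivative_works)
  show "continuous_on UNIV (\<lambda>x. frechet_derivative \<phi> (at x) b)" if "b \<in> Basis" for b by (rule c[OF that])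
  show "continuous_on UNIV \<phi>"
    by (intro continuous_at_imp_continuous_on ballI has_derivative_continuous[OF der])
  obtain K where K: "compact K" "K \<subseteq> \<Omega>" "\<And>x. x \<notin> K \<Longrightarrow> \<phi> x = 0"
    using assms unfolding test_functions_def by blast
  have "frechet_derivative \<phi> (at x) = (\<lambda>_. 0)" if "x \<notin> K" for x
  proof -
    have "(\<phi> has_derivative (\<lambda>_. 0)) (at x)"
      by (rule has_derivative_transform_within_open[of "\<lambda>_. 0" _ _ _ "- K"])
        (use K that in \<open>auto simp: compact_imp_closed open_Compl\<close>)
    then show ?thesis by (rule frechet_derivative_at[symmetric])
  qed
  with K show "\<exists>K. compact K \<and> K \<subseteq> \<Omega> \<and> (\<forall>x. x \<notin> K \<longrightarrow> \<phi> x = 0 \<and> frechet_derivative \<phi> (at x) = (\<lambda>_. 0))"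
    by blast
qed

text \<open>By translation invariance of Lebesgue measure every difference quotient of
  \<open>w\<close> in direction \<open>b\<close> integrates to 0. Compact support and the
  boundedness of the derivative allow passing to the limit.\<close>

lemma integral_directional_derivative_eq_0:
  fixes w :: "'a::euclidean_space \<Rightarrow> real"
  assumes der: "\<And>x. (w has_derivative w' x) (at x)" and cont: "continuous_on UNIV (\<lambda>x. w' x b)"
    and K: "compact K" "\<And>x. x \<notin> K \<Longrightarrow> w x = 0"
  shows "(\<integral>x. w' x b \<partial>lborel) = 0"
proof -
  have w'0: "w' x b = 0" if "x \<notin> K" for x
  proof -
    have "(w has_derivative (\<lambda>_. 0)) (at x)"
      by (rule has_derivative_transform_within_open[of "\<lambda>_. 0" _ _ _ "- K"])
        (use K that in \<open>auto simp: compact_imp_closed open_Compl\<close>)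
    from has_derivative_unique[OF der this] show ?thesis by simp
  qed
  have "compact ((\<lambda>x. w' x b) ` K)" using cont K by (intro compact_continuous_image) (auto elim: continuous_on_subset)
  then obtain M0 where M0: "\<And>x. x \<in> K \<Longrightarrow> \<bar>w' x b\<bar> \<le> M0"
    using compact_imp_bounded by (metis bounded_iff image_eqI real_norm_def)
  define M where "M = \<bar>M0\<bar>"
  have M: "0 \<le> M" "\<And>x. \<bar>w' x b\<bar> \<le> M"
    using M0 w'0 by (auto simp: M_def) (metis abs_ge_zero abs_of_nonneg abs_zero order_trans)
  obtain R where R: "0 \<le> R" "\<And>x. x \<in> K \<Longrightarrow> norm x \<le> R"
    using compact_imp_bounded[OF K(1)] by (metis bounded_iff norm_ge_zero order_trans linear)
  have cont_w: "continuous_on UNIV w"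
    by (intro continuous_at_imp_continuous_on ballI has_derivative_continuous[OF der])
  have w_eq: "indicator K x *\<^sub>R w x = w x" for x using K(2) by (cases "x \<in> K") simp_all
  have "integrable lborel (\<lambda>x. indicator K x *\<^sub>R w x)"
    using K cont_w by (intro borel_integrable_compact) (auto elim: continuous_on_subset)
  then have int_w: "integrable lborel w" by (simp only: w_eq)
  define h where "h n = 1 / real (Suc n)" for n
  have h: "0 < h n" "h n \<le> 1" for n by (auto simp: h_def)
  have h_lim: "h \<longlonglongrightarrow> 0" unfolding h_def[abs_def] using LIMSEQ_inverse_real_of_nat by (simp add: divide_inverse)
  define s where "s n x = (w (x + h n *\<^sub>R b) - w x) / h n" for n x
  \<comment> \<open>The steps \<open>h n\<close> are at most 1, so outside the ball of radius
    \<open>R + norm b\<close> neither x nor its translate lies in \<open>K\<close> and the quotient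
    is 0. Inside, the mean value theorem bounds it by \<open>M\<close>.\<close>
  have "(\<lambda>n. \<integral>x. s n x \<partial>lborel) \<longlonglongrightarrow> (\<integral>x. w' x b \<partial>lborel)"
  proof (rule integral_dominated_convergence[where w = "\<lambda>x. indicator (cball 0 (R + norm b)) x *\<^sub>R M"])
    show "(\<lambda>x. w' x b) \<in> borel_measurable lborel" using cont by (simp add: borel_measurable_continuous_onI)
    have "continuous_on UNIV (s n)" for n
      unfolding s_def[abs_def] using h(1)[of n]
      by (intro continuous_intros continuous_on_compose2[OF cont_w]) auto
    then show "s n \<in> borel_measurable lborel" for n by (simp add: borel_measurable_continuous_onI)
    show "integrable lborel (\<lambda>x. indicator (cball 0 (R + norm b)) x *\<^sub>R M)"
      by (intro borel_integrable_compact) auto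
    show "AE x in lborel. norm (s n x) \<le> indicator (cball 0 (R + norm b)) x *\<^sub>R M" for n
    proof (rule AE_I2)
      fix x :: 'a
      show "norm (s n x) \<le> indicator (cball 0 (R + norm b)) x *\<^sub>R M"
      proof (cases "x \<in> cball 0 (R + norm b)")
        case True
        have "\<exists>t\<in>{0<..<h n}. w (x + h n *\<^sub>R b) - w (x + 0 *\<^sub>R b) = (\<lambda>y. w' (x + t *\<^sub>R b) (y *\<^sub>R b)) (h n - 0)"
          by (rule mvt_simple[OF h(1)])
            (rule has_derivative_at_withinI, rule has_derivative_compose[OF _ der], auto intro!: derivative_eq_intros)
        then obtain t where "w (x + h n *\<^sub>R b) - w x = w' (x + t *\<^sub>R b) (h n *\<^sub>R b)" by auto
        also have "\<dots> = h n * w' (x + t *\<^sub>R b) b"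
          using linear_scale[OF has_derivative_linear[OF der]] by simp
        finally show ?thesis using True M h(1)[of n] by (simp add: s_def)
      next
        case False
        have "norm x \<le> norm (x + h n *\<^sub>R b) + norm (h n *\<^sub>R b)"
          by (metis add_diff_cancel_right' norm_triangle_ineq4)
        also have "norm (h n *\<^sub>R b) \<le> norm b" using h[of n] by (simp add: mult_left_le_one_le)
        finally have "x \<notin> K" "x + h n *\<^sub>R b \<notin> K" using False R(2)[of x] R(2)[of "x + h n *\<^sub>R b"] norm_ge_zero[of b] by auto
        then show ?thesis using False K by (simp add: s_def)
      qed
    qed
    show "AE x in lborel. (\<lambda>n. s n x) \<longlonglongrightarrow> w' x b"
    proof (rule AE_I2)
      fix x
      have "((\<lambda>t. w (x + t *\<^sub>R b)) has_derivative (\<lambda>y. w' (x + 0 *\<^sub>R b) (y *\<^sub>R b))) (at 0)"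
        by (rule has_derivative_compose[OF _ der]) (auto intro!: derivative_eq_intros)
      then have "((\<lambda>t. w (x + t *\<^sub>R b)) has_real_derivative w' x b) (at 0)"
        by (rule has_derivative_imp_has_field_derivative)
          (use linear_scale[OF has_derivative_linear[OF der]] in simp)
      then have lim: "((\<lambda>t. (w (x + t *\<^sub>R b) - w x) / t) \<longlongrightarrow> w' x b) (at 0)"
        by (simp add: DERIV_def)
      have "filterlim h (at 0) sequentially"
        using h_lim h(1) by (auto simp: filterlim_at intro!: always_eventually) (metis less_irrefl)
      from filterlim_compose[OF lim this] show "(\<lambda>n. s n x) \<longlonglongrightarrow> w' x b" by (simp add: s_def)
    qed
  qed
  moreover have "(\<integral>x. s n x \<partial>lborel) = 0" for n
  proof -
    have trans: "integrable lborel (\<lambda>x. w (x + h n *\<^sub>R b))" "(\<integral>x. w (x + h n *\<^sub>R b) \<partial>lborel) = (\<integral>x. w x \<partial>lborel)"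
    proof -
      have "integrable (distr lborel borel ((+) (h n *\<^sub>R b))) w" using int_w by (simp add: lborel_distr_plus)
      then show "integrable lborel (\<lambda>x. w (x + h n *\<^sub>R b))"
        using cont_w by (subst (asm) integrable_distr_eq) (auto simp: borel_measurable_continuous_onI add.commute)
      have "(\<integral>x. w x \<partial>lborel) = (\<integral>x. w x \<partial>(distr lborel borel ((+) (h n *\<^sub>R b))))" by (simp add: lborel_distr_plus)
      also have "\<dots> = (\<integral>x. w (h n *\<^sub>R b + x) \<partial>lborel)"
        using cont_w by (subst integral_distr) (auto simp: borel_measurable_continuous_onI)
      finally show "(\<integral>x. w (x + h n *\<^sub>R b) \<partial>lborel) = (\<integral>x. w x \<partial>lborel)" by (simp add: add.commute)
    qed
    then show ?thesis using int_w by (simp add: s_def)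
  qed
  ultimately have "(\<lambda>n::nat. 0) \<longlonglongrightarrow> (\<integral>x. w' x b \<partial>lborel)" by (simp only:)
  then show ?thesis by (simp add: LIMSEQ_const_iff)
qed

lemma loc_integrable_on_continuous:
  fixes u :: "'a::euclidean_space \<Rightarrow> real"
  assumes "continuous_on \<Omega> u" shows "loc_integrable_on u \<Omega>"
  unfolding loc_integrable_on_def
proof (intro allI impI)
  fix K :: "'a set" assume K: "compact K \<and> K \<subseteq> \<Omega>"
  then have "integrable lborel (\<lambda>x. indicator K x *\<^sub>R u x)"
    using assms by (intro borel_integrable_compact) (auto elim: continuous_on_subset)
  then show "set_integrable lebesgue K u"
    unfolding set_integrable_def by (subst integrable_completion) auto
qed

text \<open>The product of \<open>v\<close> and \<phi> vanishes outside a compact subset of \<Omega>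
  and has a continuous directional derivative on the whole space, so that derivative integrates to
  0. The first conclusion keeps the sum under one integral, the form suited to passing to a
  limit.\<close>

lemma classical_integration_by_parts:
  fixes v :: "'a::euclidean_space \<Rightarrow> real"
  assumes \<Omega>: "open \<Omega>" and b: "b \<in> Basis"
    and der: "\<And>x. x \<in> \<Omega> \<Longrightarrow> (v has_derivative v' x) (at x)"
    and cont: "continuous_on \<Omega> (\<lambda>x. v' x b)"
    and \<phi>: "\<phi> \<in> test_functions \<Omega>"
  shows "(LINT x:\<Omega>|lebesgue. v' x b * \<phi> x + v x * frechet_derivative \<phi> (at x) b) = 0"
    and "(LINT x:\<Omega>|lebesgue. v x * frechet_derivative \<phi> (at x) b) = - (LINT x:\<Omega>|lebesgue. v' x b * \<phi> x)"
proof -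
  note \<phi>_props = test_function_props[OF \<phi>]
  obtain K where K: "compact K" "K \<subseteq> \<Omega>" "\<And>x. x \<notin> K \<Longrightarrow> \<phi> x = 0" "\<And>x. x \<notin> K \<Longrightarrow> frechet_derivative \<phi> (at x) = (\<lambda>_. 0)"
    using \<phi>_props(4) by blast
  have cont_v: "continuous_on \<Omega> v"
    by (intro continuous_at_imp_continuous_on ballI has_derivative_continuous[OF der])
  define w where "w x = v x * \<phi> x" for x
  define w' where "w' x = (\<lambda>y. if x \<in> K then v x * frechet_derivative \<phi> (at x) y + v' x y * \<phi> x else 0)" for x
  have K_open: "open (- K)" using K by (simp add: compact_imp_closed open_Compl)
  have w'_eq: "w' x b = v x * frechet_derivative \<phi> (at x) b + v' x b * \<phi> x" for x
    using K by (simp add: w'_def)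
  have "(w has_derivative w' x) (at x)" for x
  proof (cases "x \<in> K")
    case True
    then have "(w has_derivative (\<lambda>y. v x * frechet_derivative \<phi> (at x) y + v' x y * \<phi> x)) (at x)"
      unfolding w_def[abs_def] using K by (intro has_derivative_mult der \<phi>_props(1)) auto
    then show ?thesis using True by (simp add: w'_def)
  next
    case False
    have "(w has_derivative (\<lambda>_. 0)) (at x)"
      by (rule has_derivative_transform_within_open[of "\<lambda>_. 0" _ _ _ "- K"])
        (use K K_open False in \<open>auto simp: w_def\<close>)
    then show ?thesis using False by (simp add: w'_def)
  qed
  moreover have "continuous_on UNIV (\<lambda>x. w' x b)"
  proof -
    have "continuous_on \<Omega> (\<lambda>x. w' x b)"
      unfolding w'_eq using \<phi>_props(2) \<phi>_props(3)[OF b]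
      by (intro continuous_intros cont cont_v) (auto elim: continuous_on_subset)
    moreover have "continuous_on (- K) (\<lambda>x. w' x b)"
      by (rule continuous_on_eq[of _ "\<lambda>_. 0"]) (auto simp: w'_def)
    ultimately have "continuous_on (\<Omega> \<union> - K) (\<lambda>x. w' x b)" using \<Omega> K_open by (intro continuous_on_open_Un)
    also have "\<Omega> \<union> - K = UNIV" using K by auto
    finally show ?thesis .
  qed
  ultimately have "(\<integral>x. w' x b \<partial>lborel) = 0" and meas: "(\<lambda>x. w' x b) \<in> borel_measurable lborel"
    using K by (auto intro!: integral_directional_derivative_eq_0[of w w' b K] simp: w_def borel_measurable_continuous_onI)
  then have "(\<integral>x. w' x b \<partial>lebesgue) = 0" by (simp add: integral_completion)
  also have "(\<integral>x. w' x b \<partial>lebesgue) = (LINT x:\<Omega>|lebesgue. v' x b * \<phi> x + v x * frechet_derivative \<phi> (at x) b)"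
    unfolding set_lebesgue_integral_def
  proof (intro Bochner_Integration.integral_cong refl)
    fix x
    show "w' x b = indicator \<Omega> x *\<^sub>R (v' x b * \<phi> x + v x * frechet_derivative \<phi> (at x) b)"
    proof (cases "x \<in> K")
      case True
      then show ?thesis using K(2) by (auto simp: w'_eq)
    next
      case False
      then show ?thesis using K(3)[OF False] K(4)[OF False] by (simp add: w'_eq)
    qed
  qed
  finally show 1: "(LINT x:\<Omega>|lebesgue. v' x b * \<phi> x + v x * frechet_derivative \<phi> (at x) b) = 0" .
  have "set_integrable lebesgue \<Omega> (\<lambda>x. v' x b * \<phi> x)"
    by (rule set_integrable_loc_times_test[OF loc_integrable_on_continuous[OF cont] \<phi>_props(2) K(1-3)])
  moreover have "set_integrable lebesgue \<Omega> (\<lambda>x. v x * frechet_derivative \<phi> (at x) b)"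
    by (rule set_integrable_loc_times_test[OF loc_integrable_on_continuous[OF cont_v] \<phi>_props(3)[OF b] K(1,2)])
      (simp add: K(4))
  ultimately have "(LINT x:\<Omega>|lebesgue. v' x b * \<phi> x) + (LINT x:\<Omega>|lebesgue. v x * frechet_derivative \<phi> (at x) b) = 0"
    using 1 by (simp only: set_integral_add(2))
  then show "(LINT x:\<Omega>|lebesgue. v x * frechet_derivative \<phi> (at x) b) = - (LINT x:\<Omega>|lebesgue. v' x b * \<phi> x)"
    by linarith
qed

lemma weak_derivative_classical:
  fixes u u' :: "real \<Rightarrow> real"
  assumes "\<And>r. 0 < r \<Longrightarrow> (u has_real_derivative u' r) (at r)" "continuous_on {0<..} u'"
  shows "weak_partial {0<..} 1 u u'"
proof -
  have "isCont u r" if "0 < r" for r using assms(1)[OF that] by (rule DERIV_isCont)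
  then have "continuous_on {0<..} u" by (simp add: continuous_at_imp_continuous_on)
  moreover have "(LINT x:{0<..}|lebesgue. u x * frechet_derivative \<phi> (at x) 1) = - (LINT x:{0<..}|lebesgue. u' x * \<phi> x)"
    if "\<phi> \<in> test_functions {0<..}" for \<phi>
  proof -
    have "(u has_derivative (\<lambda>h. u' r * h)) (at r)" if "r \<in> {0<..}" for r
      using assms(1)[of r] that by (simp add: has_field_derivative_def)
    from classical_integration_by_parts(2)[OF _ _ this _ that] assms(2) show ?thesis by simp
  qed
  ultimately show ?thesis
    unfolding weak_partial_def using assms(2) by (blast intro: loc_integrable_on_continuous)
qed

lemma radial_deriv_eq:
  fixes u u' :: "real \<Rightarrow> real"
  assumes "\<And>r. 0 < r \<Longrightarrow> (u has_real_derivative u' r) (at r)" "continuous_on {0<..} u'"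
  shows "AE r in lebesgue. 0 < r \<longrightarrow> radial_deriv u r = u' r"
proof -
  have u': "weak_partial {0<..} 1 u u'" by (rule weak_derivative_classical[OF assms])
  then have "weak_partial {0<..} 1 u (radial_deriv u)" unfolding radial_deriv_def by (rule someI[of "weak_partial {0<..} 1 u"])
  from weak_derivative_unique[OF this u'] show ?thesis .
qed

section \<open>Radial functions on the plane\<close>

text \<open>Polar coordinates without a change of variables: both measures give \<open>{..x}\<close>
  the area pi x^2 of a disc, and these half-lines form an intersection-stable generator.\<close>

lemma distr_norm_plane:
  "distr lborel borel (norm :: real^2 \<Rightarrow> real) = density lborel (\<lambda>r. ennreal (2 * pi * r) * indicator {0..} r)"
  (is "?M = ?N")
proof (rule measure_eqI_generator_eq[where E = "range (\<lambda>a::real. {..a})" and \<Omega> = UNIV and A = "\<lambda>i. {..real i}"])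
  have M: "emeasure ?M {..x} = ennreal (if 0 \<le> x then pi * x\<^sup>2 else 0)" for x :: real
  proof -
    have "emeasure ?M {..x} = emeasure lborel (norm -` {..x} \<inter> space (lborel :: (real^2) measure))"
      by (intro emeasure_distr) auto
    also have "norm -` {..x} \<inter> space lborel = (cball 0 x :: (real^2) set)" by (auto simp: cball_def)
    finally show ?thesis
      by (simp add: emeasure_cball unit_ball_vol_2)
  qed
  have N: "emeasure ?N {..x} = ennreal (if 0 \<le> x then pi * x\<^sup>2 else 0)" for x :: real
  proof -
    have "emeasure ?N {..x} = (\<integral>\<^sup>+ r. ennreal (2 * pi * r) * indicator {0..x} r \<partial>lborel)"
      by (subst emeasure_density) (auto intro!: nn_integral_cong simp: indicator_def)
    also have "\<dots> = ennreal (if 0 \<le> x then pi * x\<^sup>2 else 0)"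
    proof (cases "0 \<le> x")
      case True
      have "(\<integral>\<^sup>+ r. ennreal (2 * pi * r) * indicator {0..x} r \<partial>lborel) = ennreal (pi * x\<^sup>2 - pi * 0\<^sup>2)"
        by (rule nn_integral_FTC_Icc[where F = "\<lambda>r. pi * r\<^sup>2"])
          (use True in \<open>auto intro!: derivative_eq_intros\<close>)
      with True show ?thesis by simp
    qed simp
    finally show ?thesis .
  qed
  show "emeasure ?M X = emeasure ?N X" if "X \<in> range (\<lambda>a. {..a})" for X
    using that M N by auto
  show "emeasure ?M {..real i} \<noteq> \<infinity>" for i using M by simp
  show "Int_stable (range (\<lambda>a::real. {..a}))" by (auto simp: Int_stable_def)
  show "sets ?M = sigma_sets UNIV (range (\<lambda>a::real. {..a}))" "sets ?N = sigma_sets UNIV (range (\<lambda>a::real. {..a}))"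
    by (simp_all add: borel_eq_atMost)
  show "(\<Union>i. {..real i}) = UNIV" using real_arch_simple by auto
qed auto

lemma nn_integral_radial_plane:
  fixes p :: "real \<Rightarrow> ennreal"
  assumes [measurable]: "p \<in> borel_measurable borel"
  shows "(\<integral>\<^sup>+ x. p (norm (x :: real^2)) \<partial>lborel) = (\<integral>\<^sup>+ r. ennreal (2 * pi * r) * indicator {0..} r * p r \<partial>lborel)"
proof -
  have "(\<integral>\<^sup>+ x. p (norm (x :: real^2)) \<partial>lborel) = (\<integral>\<^sup>+ r. p r \<partial>distr lborel borel (norm :: real^2 \<Rightarrow> real))"
    by (subst nn_integral_distr) auto
  also have "\<dots> = (\<integral>\<^sup>+ r. ennreal (2 * pi * r) * indicator {0..} r * p r \<partial>lborel)"
    unfolding distr_norm_plane by (subst nn_integral_density) auto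
  finally show ?thesis .
qed

lemma borel_measurable_radial:
  fixes p :: "real \<Rightarrow> real"
  assumes p: "(\<lambda>r. indicator {0<..} r * p r) \<in> borel_measurable borel"
  shows "(\<lambda>x::real^2. p (norm x)) \<in> borel_measurable borel"
proof -
  have "(\<lambda>x::real^2. if x = 0 then p 0 else (\<lambda>r. indicator {0<..} r * p r) (norm x)) \<in> borel_measurable borel"
    by (intro measurable_If measurable_compose[OF borel_measurable_norm p] measurable_const) auto
  also have "(\<lambda>x::real^2. if x = 0 then p 0 else (\<lambda>r. indicator {0<..} r * p r) (norm x)) = (\<lambda>x. p (norm x))"
    by (auto simp: indicator_def)
  finally show ?thesis .
qed

lemma borel_measurable_pos_continuous:
  fixes p :: "real \<Rightarrow> real"
  shows "continuous_on {0<..} p \<Longrightarrow> (\<lambda>r. indicator {0<..} r * p r) \<in> borel_measurable borel"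
  using borel_measurable_continuous_on_indicator[of "{0<..}" p] by simp

lemma integrable_radial:
  fixes p :: "real \<Rightarrow> real"
  assumes p: "(\<lambda>r. indicator {0<..} r * p r) \<in> borel_measurable borel" and p0: "\<And>r. 0 < r \<Longrightarrow> 0 \<le> p r"
    and int: "set_integrable lebesgue {0<..} (\<lambda>r. p r * r)"
  shows "integrable lebesgue (\<lambda>x::real^2. p (norm x))"
proof -
  let ?q = "\<lambda>r. indicator {0<..} r * p r"
  have meas: "(\<lambda>x::real^2. p (norm x)) \<in> borel_measurable borel" by (rule borel_measurable_radial[OF p])
  have [measurable]: "?q \<in> borel_measurable borel" by (rule p)
  have meas2: "(\<lambda>r. indicator {0<..} r *\<^sub>R (p r * r)) \<in> borel_measurable lborel"
  proof -
    have "(\<lambda>r. ?q r * r) \<in> borel_measurable lborel" by simp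
    then show ?thesis by (simp add: mult.assoc)
  qed
  have "integrable lborel (\<lambda>r. indicator {0<..} r *\<^sub>R (p r * r))"
    using int integrable_completion[OF meas2] by (simp add: set_integrable_def)
  then have fin: "(\<integral>\<^sup>+ r. ennreal (norm (indicator {0<..} r *\<^sub>R (p r * r))) \<partial>lborel) < \<infinity>"
    by (simp add: integrable_iff_bounded)
  \<comment> \<open>The origin is a null set of the plane, which frees the estimate from the value
    \<open>p 0\<close>.\<close>
  have "AE x in lborel. x \<noteq> (0::real^2)" by (rule AE_lborel_singleton)
  then have "(\<integral>\<^sup>+ x. ennreal (norm (p (norm (x::real^2)))) \<partial>lborel) = (\<integral>\<^sup>+ x. ennreal (?q (norm (x::real^2))) \<partial>lborel)"
  proof (intro nn_integral_cong_AE, eventually_elim)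
    case (elim x)
    then have "0 < norm x" by simp
    with p0[OF this] show ?case by simp
  qed
  also have "\<dots> = (\<integral>\<^sup>+ r. ennreal (2 * pi * r) * indicator {0..} r * ennreal (?q r) \<partial>lborel)"
    by (rule nn_integral_radial_plane) simp
  also have "\<dots> = (\<integral>\<^sup>+ r. ennreal (2 * pi) * ennreal (norm (indicator {0<..} r *\<^sub>R (p r * r))) \<partial>lborel)"
  proof (intro nn_integral_cong)
    fix r :: real
    show "ennreal (2 * pi * r) * indicator {0..} r * ennreal (?q r)
      = ennreal (2 * pi) * ennreal (norm (indicator {0<..} r *\<^sub>R (p r * r)))"
      using p0[of r] by (cases "0 < r") (simp_all add: ennreal_mult'[symmetric] abs_mult mult_ac)
  qed
  also have "\<dots> = ennreal (2 * pi) * (\<integral>\<^sup>+ r. ennreal (norm (indicator {0<..} r *\<^sub>R (p r * r))) \<partial>lborel)"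
    using meas2 by (intro nn_integral_cmult) simp
  also have "\<dots> < \<infinity>" using fin by (simp add: ennreal_mult_less_top)
  finally have "integrable lborel (\<lambda>x::real^2. p (norm x))"
    using meas by (intro integrableI_bounded) auto
  then show ?thesis using meas by (subst integrable_completion) auto
qed

text \<open>A profile need not be differentiable at the origin, so integration by parts is applied to its
  product with a cutoff. The bound $r |\chi'| \<le> 2$, uniform in $\delta$, lets $\delta$ tend to $0$ by
  dominated convergence because $u(|x|)/|x|$ is locally integrable on the plane.\<close>

definition cutoff :: "real \<Rightarrow> real \<Rightarrow> real" where
  "cutoff \<delta> r = (max 0 (r - \<delta>))\<^sup>2 / (\<delta>\<^sup>2 + (max 0 (r - \<delta>))\<^sup>2)"

definition cutoff' :: "real \<Rightarrow> real \<Rightarrow> real" where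
  "cutoff' \<delta> r = 2 * max 0 (r - \<delta>) * \<delta>\<^sup>2 / (\<delta>\<^sup>2 + (max 0 (r - \<delta>))\<^sup>2)\<^sup>2"

lemma max_0_sq_deriv: "((\<lambda>t. (max 0 t)\<^sup>2) has_real_derivative 2 * max 0 t) (at t)"
proof -
  consider "t > 0" | "t < 0" | "t = 0" by linarith
  then show ?thesis
  proof cases
    case 1
    have "((\<lambda>t. t\<^sup>2) has_real_derivative 2 * max 0 t) (at t)"
      using 1 by (auto intro!: derivative_eq_intros)
    moreover have "\<forall>\<^sub>F y in nhds t. y\<^sup>2 = (max 0 y)\<^sup>2"
      using eventually_nhds_in_open[of "{0<..}" t] 1 by (auto elim!: eventually_mono)
    ultimately show ?thesis by (subst (asm) DERIV_cong_ev[OF refl _ refl]) auto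
  next
    case 2
    have "((\<lambda>t. 0::real) has_real_derivative 2 * max 0 t) (at t)" using 2 by simp
    moreover have "\<forall>\<^sub>F y in nhds t. 0 = (max 0 y)\<^sup>2"
      using eventually_nhds_in_open[of "{..<0}" t] 2 by (auto elim!: eventually_mono)
    ultimately show ?thesis by (subst (asm) DERIV_cong_ev[OF refl _ refl]) auto
  next
    case 3
    have "((\<lambda>h. (max 0 h)\<^sup>2 / h) \<longlongrightarrow> 0) (at (0::real))"
    proof (rule Lim_null_comparison)
      show "\<forall>\<^sub>F h in at (0::real). norm ((max 0 h)\<^sup>2 / h) \<le> \<bar>h\<bar>"
        by (intro always_eventually allI) (auto simp: power2_eq_square max_def)
      show "((\<lambda>h::real. \<bar>h\<bar>) \<longlongrightarrow> 0) (at 0)" using tendsto_rabs[OF tendsto_ident_at, of "0::real" UNIV] by simp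
    qed
    then show ?thesis using 3 by (simp add: DERIV_def)
  qed
qed

lemma cutoff_deriv:
  assumes "0 < \<delta>" shows "(cutoff \<delta> has_real_derivative cutoff' \<delta> r) (at r)"
proof -
  have k: "((\<lambda>r. (max 0 (r - \<delta>))\<^sup>2) has_real_derivative 2 * max 0 (r - \<delta>)) (at r)"
  proof -
    have "((\<lambda>r. r - \<delta>) has_real_derivative 1) (at r)" by (auto intro!: derivative_eq_intros)
    from DERIV_chain2[where f = "\<lambda>t. (max 0 t)\<^sup>2" and g = "\<lambda>r. r - \<delta>", OF max_0_sq_deriv this]
    show ?thesis by simp
  qed
  have pos: "0 < \<delta>\<^sup>2 + (max 0 (r - \<delta>))\<^sup>2" using assms by (intro add_pos_nonneg) auto
  show ?thesis
    unfolding cutoff_def[abs_def] cutoff'_def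
    by (rule derivative_eq_intros k refl)+ (use pos in \<open>auto simp: field_simps power2_eq_square\<close>)
qed

lemma cutoff_range: "0 \<le> cutoff \<delta> r" "cutoff \<delta> r \<le> 1"
proof -
  let ?a = "\<delta>\<^sup>2 + (max 0 (r - \<delta>))\<^sup>2"
  have a: "0 \<le> ?a" "(max 0 (r - \<delta>))\<^sup>2 \<le> ?a" by simp_all
  show "0 \<le> cutoff \<delta> r" unfolding cutoff_def using a(1) by (intro divide_nonneg_nonneg) auto
  have "0 < ?a \<or> ?a = 0" using a(1) by linarith
  then show "cutoff \<delta> r \<le> 1" unfolding cutoff_def divide_le_eq_1 using a(2) by blast
qed

lemma cutoff_eq_0: "r \<le> \<delta> \<Longrightarrow> cutoff \<delta> r = 0" and cutoff'_eq_0: "r \<le> \<delta> \<Longrightarrow> cutoff' \<delta> r = 0"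
  by (auto simp: cutoff_def cutoff'_def)

lemma continuous_cutoff':
  assumes "0 < \<delta>" shows "continuous_on A (cutoff' \<delta>)"
proof -
  have "\<delta>\<^sup>2 + (max 0 (r - \<delta>))\<^sup>2 \<noteq> 0" for r using assms by (simp add: add_nonneg_eq_0_iff)
  then show ?thesis unfolding cutoff'_def[abs_def] by (intro continuous_intros) auto
qed

lemma cutoff'_bound:
  assumes "0 < \<delta>" "0 < r" shows "\<bar>cutoff' \<delta> r\<bar> \<le> 2 / r"
proof (cases "r \<le> \<delta>")
  case False
  define k where "k = r - \<delta>"
  have k: "0 < k" "r = k + \<delta>" using False by (auto simp: k_def)
  \<comment> \<open>The left side of the inequality below expands to k^2 \<delta>^2 + k \<delta>^3,
    and this square bounds the mixed term k \<delta>^3 by half of k^2 \<delta>^2 +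
    \<delta>^4.\<close>
  have "0 \<le> (\<delta> * (k - \<delta>))\<^sup>2" by simp
  moreover have "0 \<le> (k * k)\<^sup>2" "0 \<le> (\<delta> * \<delta>)\<^sup>2" "0 \<le> (k * \<delta>)\<^sup>2" by auto
  ultimately have "k * \<delta>\<^sup>2 * (k + \<delta>) \<le> (\<delta>\<^sup>2 + k\<^sup>2)\<^sup>2"
    by (simp add: power2_eq_square algebra_simps)
  then have "2 * k * \<delta>\<^sup>2 * r \<le> 2 * (\<delta>\<^sup>2 + k\<^sup>2)\<^sup>2" unfolding k(2) by simp
  moreover have "0 < (\<delta>\<^sup>2 + k\<^sup>2)\<^sup>2" using k by (simp add: add_nonneg_pos)
  ultimately have "2 * k * \<delta>\<^sup>2 / (\<delta>\<^sup>2 + k\<^sup>2)\<^sup>2 \<le> 2 / r" using assms by (simp add: field_simps)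
  moreover have "cutoff' \<delta> r = 2 * k * \<delta>\<^sup>2 / (\<delta>\<^sup>2 + k\<^sup>2)\<^sup>2" using k by (simp add: cutoff'_def)
  moreover have "0 \<le> 2 * k * \<delta>\<^sup>2 / (\<delta>\<^sup>2 + k\<^sup>2)\<^sup>2" using k by auto
  ultimately show ?thesis by simp
qed (use assms in \<open>auto simp: cutoff'_eq_0\<close>)

lemma cutoff_tendsto:
  assumes "\<delta> \<longlonglongrightarrow> 0" "0 < r"
  shows "(\<lambda>n. cutoff (\<delta> n) r) \<longlonglongrightarrow> 1" "(\<lambda>n. cutoff' (\<delta> n) r) \<longlonglongrightarrow> 0"
proof -
  have k: "(\<lambda>n. max 0 (r - \<delta> n)) \<longlonglongrightarrow> max 0 (r - 0)" by (intro tendsto_intros assms)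
  have "(\<lambda>n. cutoff (\<delta> n) r) \<longlonglongrightarrow> (max 0 (r - 0))\<^sup>2 / (0\<^sup>2 + (max 0 (r - 0))\<^sup>2)"
    unfolding cutoff_def using assms(2) by (intro tendsto_intros k assms) auto
  then show "(\<lambda>n. cutoff (\<delta> n) r) \<longlonglongrightarrow> 1" using assms(2) by simp
  have "(\<lambda>n. cutoff' (\<delta> n) r) \<longlonglongrightarrow> 2 * max 0 (r - 0) * 0\<^sup>2 / (0\<^sup>2 + (max 0 (r - 0))\<^sup>2)\<^sup>2"
    unfolding cutoff'_def using assms(2) by (intro tendsto_intros k assms) auto
  then show "(\<lambda>n. cutoff' (\<delta> n) r) \<longlonglongrightarrow> 0" by simp
qed

text \<open>Monotone convergence along the exhaustion of the half-line by the intervals from 1/(n+1)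
  to n+1, on each of which the Henstock-Kurzweil and the Lebesgue integral agree.\<close>

lemma bounded_integrals_LINT:
  assumes "bounded_integrals {0<..} p C"
  shows "set_integrable lebesgue {0<..} p" "(LINT r:{0<..}|lebesgue. p r) \<le> C"
proof -
  have cont: "continuous_on {0<..} p" and p0: "\<And>r. 0 < r \<Longrightarrow> 0 \<le> p r"
    using assms by (auto simp: bounded_integrals_def)
  have C: "0 \<le> C" by (rule bounded_integrals_const_bound_nonneg[OF assms])
  define I where "I n = {1 / real (Suc n)..real (Suc n)}" for n
  have I_sub: "I n \<subseteq> {0<..}" for n by (auto simp: I_def intro: less_le_trans[rotated])
  have meas: "(\<lambda>r. indicator {0<..} r *\<^sub>R p r) \<in> borel_measurable lborel"
    using borel_measurable_pos_continuous[OF cont] by simp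
  have sup: "(SUP n. ennreal (p r) * indicator (I n) r) = ennreal (indicator {0<..} r *\<^sub>R p r)" for r
  proof (cases "0 < r")
    case True
    obtain N where N: "max r (1 / r) < real N" using reals_Archimedean2 by blast
    then have "1 / r < real (Suc N)" "r < real (Suc N)" by auto
    moreover from this have "1 / real (Suc N) < r" using True by (simp add: field_simps)
    ultimately have "r \<in> I N" by (simp add: I_def)
    then have "ennreal (p r) \<le> (SUP n. ennreal (p r) * indicator (I n) r)"
      by (intro SUP_upper2[of N]) auto
    moreover have "(SUP n. ennreal (p r) * indicator (I n) r) \<le> ennreal (p r)"
      by (intro SUP_least) (auto simp: indicator_def)
    ultimately show ?thesis using True by simp
  next
    case False
    then have "r \<notin> I n" for n using I_sub by auto
    with False show ?thesis by simp
  qed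
  have "(\<integral>\<^sup>+ r. ennreal (indicator {0<..} r *\<^sub>R p r) \<partial>lborel) = (SUP n. \<integral>\<^sup>+ r. ennreal (p r) * indicator (I n) r \<partial>lborel)"
    unfolding sup[symmetric]
  proof (rule nn_integral_monotone_convergence_SUP)
    show "incseq (\<lambda>n r. ennreal (p r) * indicator (I n) r)"
    proof (rule incseq_SucI, rule le_funI)
      fix n r
      have "I n \<subseteq> I (Suc n)" by (auto simp: I_def intro: order_trans[rotated] frac_le)
      then show "ennreal (p r) * indicator (I n) r \<le> ennreal (p r) * indicator (I (Suc n)) r"
        by (auto simp: indicator_def)
    qed
    show "(\<lambda>r. ennreal (p r) * indicator (I n) r) \<in> borel_measurable lborel" for n
    proof -
      have "(\<lambda>r. ennreal (p r) * indicator (I n) r) = (\<lambda>r. ennreal (indicator {0<..} r *\<^sub>R p r) * indicator (I n) r)"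
        using I_sub[of n] by (auto simp: indicator_def fun_eq_iff)
      then show ?thesis using meas by (simp add: I_def)
    qed
  qed
  also have "\<dots> \<le> ennreal C"
  proof (rule SUP_least)
    fix n
    have n: "(0::real) < 1 / real (Suc n)" "1 / real (Suc n) \<le> real (Suc n)"
      by (auto simp: divide_le_eq intro: order_trans[of 1 "real (Suc n)"])
    have "(\<integral>\<^sup>+ r. ennreal (p r) * indicator (I n) r \<partial>lborel) = ennreal (integral (I n) p)"
      using n I_sub[of n] p0 cont unfolding I_def
      by (intro nn_integral_has_integral_lebesgue' integrable_integral integrable_Icc_pos) auto
    also have "\<dots> \<le> ennreal C"
      using n I_sub[of n] unfolding I_def by (intro ennreal_leI bounded_integralsD[OF assms]) auto
    finally show "(\<integral>\<^sup>+ r. ennreal (p r) * indicator (I n) r \<partial>lborel) \<le> ennreal C" .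
  qed
  finally have le: "(\<integral>\<^sup>+ r. ennreal (indicator {0<..} r *\<^sub>R p r) \<partial>lborel) \<le> ennreal C" .
  have nonneg: "0 \<le> indicator {0<..} r *\<^sub>R p r" for r using p0 by (simp add: indicator_def)
  have int: "integrable lborel (\<lambda>r. indicator {0<..} r *\<^sub>R p r)"
  proof (rule integrableI_bounded[OF meas])
    have "(\<integral>\<^sup>+ r. ennreal (norm (indicator {0<..} r *\<^sub>R p r)) \<partial>lborel) = (\<integral>\<^sup>+ r. ennreal (indicator {0<..} r *\<^sub>R p r) \<partial>lborel)"
      by (simp only: real_norm_def abs_of_nonneg[OF nonneg])
    then show "(\<integral>\<^sup>+ r. ennreal (norm (indicator {0<..} r *\<^sub>R p r)) \<partial>lborel) < \<infinity>"
      using le by (simp add: order.strict_trans1[OF _ ennreal_less_top])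
  qed
  then show "set_integrable lebesgue {0<..} p"
    unfolding set_integrable_def using meas by (subst integrable_completion) auto
  have "ennreal (\<integral>r. indicator {0<..} r *\<^sub>R p r \<partial>lborel) \<le> ennreal C"
    using nn_integral_eq_integral[OF int] nonneg le by simp
  then have "(\<integral>r. indicator {0<..} r *\<^sub>R p r \<partial>lborel) \<le> C" using C by simp
  then show "(LINT r:{0<..}|lebesgue. p r) \<le> C"
    unfolding set_lebesgue_integral_def using meas by (subst integral_completion) auto
qed

lemma loc_integrable_on_L2:
  fixes u :: "'a::euclidean_space \<Rightarrow> real"
  assumes "u \<in> L2_functions" shows "loc_integrable_on u UNIV"
  unfolding loc_integrable_on_def set_integrable_def
proof (intro allI impI)
  fix K :: "'a set" assume K: "compact K \<and> K \<subseteq> UNIV"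
  then have K_sets: "K \<in> sets lebesgue" by (simp add: compact_imp_closed)
  have int1: "integrable lebesgue (indicat_real K)"
    using K lmeasurable_compact by (simp add: lmeasurable_iff_integrable)
  have u: "u \<in> borel_measurable lebesgue" "integrable lebesgue (\<lambda>x. (u x)\<^sup>2)"
    using assms by (auto simp: L2_functions_def)
  show "integrable lebesgue (\<lambda>x. indicator K x *\<^sub>R u x)"
  proof (rule Bochner_Integration.integrable_bound)
    show "integrable lebesgue (\<lambda>x. indicat_real K x + (u x)\<^sup>2)" using int1 u(2) by simp
    show "(\<lambda>x. indicator K x *\<^sub>R u x) \<in> borel_measurable lebesgue"
      using u(1) K_sets by (intro borel_measurable_scaleR borel_measurable_indicator)
    have "\<bar>u x\<bar> \<le> 1 + (u x)\<^sup>2" for x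
      using zero_le_power2[of "\<bar>u x\<bar> - 1 / 2"] by (simp add: power2_eq_square algebra_simps)
    then show "AE x in lebesgue. norm (indicator K x *\<^sub>R u x) \<le> norm (indicat_real K x + (u x)\<^sup>2)"
      by (intro AE_I2) (auto simp: indicator_def)
  qed
qed

text \<open>A C^1 profile on the open half-line for which the origin is removable in the weak sense:
  boundedness near 0 makes u/r integrable there with respect to r dr.\<close>

locale radial_profile =
  fixes u u' :: "real \<Rightarrow> real" and B :: real
  assumes deriv: "\<And>r. 0 < r \<Longrightarrow> (u has_real_derivative u' r) (at r)"
    and cont': "continuous_on {0<..} u'"
    and bounded: "\<And>r. 0 < r \<Longrightarrow> r \<le> 1 \<Longrightarrow> \<bar>u r\<bar> \<le> B"
    and int: "set_integrable lebesgue {0<..} (\<lambda>r. (u r)\<^sup>2 * r)"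
    and int': "set_integrable lebesgue {0<..} (\<lambda>r. (u' r)\<^sup>2 * r)"
begin

lemma cont: "continuous_on {0<..} u"
proof -
  have "isCont u r" if "0 < r" for r using deriv[OF that] by (rule DERIV_isCont)
  then show ?thesis by (simp add: continuous_at_imp_continuous_on)
qed

lemma u_measurable: "(\<lambda>x::real^2. u (norm x)) \<in> borel_measurable lebesgue"
  and u'_measurable: "(\<lambda>x::real^2. u' (norm x)) \<in> borel_measurable lebesgue"
  by (intro measurable_completion;
      simp add: borel_measurable_radial borel_measurable_pos_continuous cont cont' del: real_scaleR_def)+

lemma sgn_inner_measurable: "(\<lambda>x. sgn x \<bullet> b) \<in> borel_measurable (lebesgue :: (real^2) measure)"
proof -
  have "(\<lambda>x::real^2. (x \<bullet> b) / norm x) \<in> borel_measurable borel" by measurable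
  moreover have "sgn x \<bullet> b = (x \<bullet> b) / norm x" for x :: "real^2" by (simp add: sgn_div_norm divide_inverse mult.commute)
  ultimately show ?thesis by (intro measurable_completion) simp
qed

lemma u_L2: "(\<lambda>x::real^2. u (norm x)) \<in> L2_functions"
proof -
  have "(\<lambda>r. indicator {0<..} r * (u r)\<^sup>2) \<in> borel_measurable borel"
    by (intro borel_measurable_pos_continuous continuous_intros cont)
  from integrable_radial[OF this _ int] show ?thesis by (simp add: L2_functions_def u_measurable)
qed

lemma u'_L2:
  assumes "b \<in> Basis" shows "(\<lambda>x::real^2. u' (norm x) * (sgn x \<bullet> b)) \<in> L2_functions"
proof -
  have meas: "(\<lambda>x::real^2. u' (norm x) * (sgn x \<bullet> b)) \<in> borel_measurable lebesgue"
    by (intro borel_measurable_times u'_measurable sgn_inner_measurable)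
  have "(\<lambda>r. indicator {0<..} r * (u' r)\<^sup>2) \<in> borel_measurable borel"
    by (intro borel_measurable_pos_continuous continuous_intros cont')
  from integrable_radial[OF this _ int'] have int2: "integrable lebesgue (\<lambda>x::real^2. (u' (norm x))\<^sup>2)" by simp
  have "integrable lebesgue (\<lambda>x::real^2. (u' (norm x) * (sgn x \<bullet> b))\<^sup>2)"
  proof (rule Bochner_Integration.integrable_bound[OF int2])
    show "(\<lambda>x::real^2. (u' (norm x) * (sgn x \<bullet> b))\<^sup>2) \<in> borel_measurable lebesgue"
      using meas by (intro borel_measurable_power)
    show "AE x in lebesgue. norm ((u' (norm x) * (sgn x \<bullet> b))\<^sup>2) \<le> norm ((u' (norm x))\<^sup>2)"
    proof (rule AE_I2)
      fix x :: "real^2"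
      have "\<bar>sgn x \<bullet> b\<bar> \<le> norm (sgn x) * norm b" by (rule Cauchy_Schwarz_ineq2)
      also have "\<dots> \<le> 1" using assms by (simp add: norm_sgn)
      finally have "(sgn x \<bullet> b)\<^sup>2 \<le> 1" by (simp add: abs_square_le_1)
      then have "(u' (norm x))\<^sup>2 * (sgn x \<bullet> b)\<^sup>2 \<le> (u' (norm x))\<^sup>2 * 1" by (intro mult_left_mono) auto
      then show "norm ((u' (norm x) * (sgn x \<bullet> b))\<^sup>2) \<le> norm ((u' (norm x))\<^sup>2)"
        by (simp add: power_mult_distrib)
    qed
  qed
  with meas show ?thesis by (simp add: L2_functions_def)
qed

text \<open>The dominating function of the cutoff argument. The terms in \<open>u'\<close> and in
  u/r come from the derivative of the cut-off profile, the last one from the derivative of the test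
  function.\<close>

lemma majorant_integrable:
  "integrable lebesgue (\<lambda>x::real^2. indicator {..R} (norm x) * (\<bar>u' (norm x)\<bar> + 2 * \<bar>u (norm x)\<bar> / norm x + \<bar>u (norm x)\<bar>))"
proof (rule integrable_radial)
  let ?p = "\<lambda>r. \<bar>u' r\<bar> + 2 * \<bar>u r\<bar> / r + \<bar>u r\<bar>"
  have "(\<lambda>r. indicator {..R} r * (indicator {0<..} r * ?p r)) \<in> borel_measurable borel"
    by (intro borel_measurable_times[OF _ borel_measurable_pos_continuous] continuous_intros cont cont') auto
  then show meas: "(\<lambda>r. indicator {0<..} r * (indicator {..R} r * ?p r)) \<in> borel_measurable borel"
    by (simp add: mult.left_commute)
  show "0 \<le> indicator {..R} r * ?p r" if "0 < r" for r using that by auto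
  \<comment> \<open>By |t| <= 1 + t^2 the terms |u'| r and |u| r each cost one r. By the bound near
    0 or r > 1, |u| <= |B| + (1 + u^2) r, taken twice. This gives 4 r, 2 |B| and three copies of u^2
    r.\<close>
  let ?q = "\<lambda>r. indicator {0<..R} r * (4 * \<bar>R\<bar> + 2 * \<bar>B\<bar>) + indicator {0<..} r * ((u' r)\<^sup>2 * r) + 3 * (indicator {0<..} r * ((u r)\<^sup>2 * r))"
  have sq: "\<bar>t\<bar> \<le> 1 + t\<^sup>2" for t :: real
    using zero_le_power2[of "\<bar>t\<bar> - 1 / 2"] by (simp add: power2_eq_square algebra_simps)
  show "set_integrable lebesgue {0<..} (\<lambda>r. indicator {..R} r * ?p r * r)"
    unfolding set_integrable_def
  proof (rule Bochner_Integration.integrable_bound)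
    have "integrable lebesgue (indicat_real {0<..R})"
      unfolding lmeasurable_iff_integrable[symmetric] by (intro bounded_set_imp_lmeasurable) auto
    then show "integrable lebesgue ?q"
      using int int' by (intro Bochner_Integration.integrable_add integrable_mult_right integrable_mult_left) (auto simp: set_integrable_def)
    have "(\<lambda>r. (indicator {0<..} r * (indicator {..R} r * ?p r)) * r) \<in> borel_measurable borel"
      by (rule borel_measurable_times[OF meas]) simp
    then show "(\<lambda>r. indicator {0<..} r *\<^sub>R (indicator {..R} r * ?p r * r)) \<in> borel_measurable lebesgue"
      by (intro measurable_completion) (simp add: mult.assoc)
    show "AE r in lebesgue. norm (indicator {0<..} r *\<^sub>R (indicator {..R} r * ?p r * r)) \<le> norm (?q r)"
    proof (rule AE_I2)
      fix r :: real
      show "norm (indicator {0<..} r *\<^sub>R (indicator {..R} r * ?p r * r)) \<le> norm (?q r)"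
      proof (cases "0 < r \<and> r \<le> R")
        case True
        have "\<bar>u' r\<bar> * r \<le> (1 + (u' r)\<^sup>2) * r" "\<bar>u r\<bar> * r \<le> (1 + (u r)\<^sup>2) * r"
          using True sq by (intro mult_right_mono; auto)+
        moreover have "\<bar>u r\<bar> \<le> \<bar>B\<bar> + (1 + (u r)\<^sup>2) * r"
        proof (cases "r \<le> 1")
          case 1: True
          have "0 \<le> (1 + (u r)\<^sup>2) * r" using True by (intro mult_nonneg_nonneg) auto
          moreover have "\<bar>u r\<bar> \<le> \<bar>B\<bar>" using bounded[of r] True 1 by linarith
          ultimately show ?thesis by linarith
        next
          case False
          then have "(1 + (u r)\<^sup>2) * 1 \<le> (1 + (u r)\<^sup>2) * r" by (intro mult_left_mono) auto
          with sq[of "u r"] have "\<bar>u r\<bar> \<le> (1 + (u r)\<^sup>2) * r" by (simp only: mult_1_right order_trans)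
          then show ?thesis by (simp add: add_increasing)
        qed
        moreover have "?p r * r = \<bar>u' r\<bar> * r + 2 * \<bar>u r\<bar> + \<bar>u r\<bar> * r" using True by (simp add: distrib_right)
        ultimately have "?p r * r \<le> 4 * R + 2 * \<bar>B\<bar> + (u' r)\<^sup>2 * r + 3 * ((u r)\<^sup>2 * r)"
          unfolding distrib_right using True by linarith
        moreover have "0 \<le> ?p r * r" using True by (intro mult_nonneg_nonneg) auto
        ultimately show ?thesis using True by simp
      next
        case False
        then show ?thesis by (auto simp: indicator_def)
      qed
    qed
  qed
qed

text \<open>The candidate is the classical gradient off the origin, u'(|x|) x/|x|; the factor
  \<open>sgn x\<close> is x/|x| with value 0 at the origin.\<close>

lemma weak_partial_radial:
  fixes b :: "real^2"
  assumes b: "b \<in> Basis"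
  shows "weak_partial UNIV b (\<lambda>x. u (norm x)) (\<lambda>x. u' (norm x) * (sgn x \<bullet> b))"
  unfolding weak_partial_def
proof (intro conjI ballI)
  show loc_u: "loc_integrable_on (\<lambda>x::real^2. u (norm x)) UNIV" by (intro loc_integrable_on_L2 u_L2)
  show loc_u': "loc_integrable_on (\<lambda>x. u' (norm x) * (sgn x \<bullet> b)) UNIV" by (intro loc_integrable_on_L2 u'_L2 b)
  fix \<phi> :: "real^2 \<Rightarrow> real" assume \<phi>: "\<phi> \<in> test_functions UNIV"
  note \<phi>_props = test_function_props[OF \<phi>]
  define \<phi>b where "\<phi>b x = frechet_derivative \<phi> (at x) b" for x
  have cont_\<phi>b: "continuous_on UNIV \<phi>b" unfolding \<phi>b_def[abs_def] by (rule \<phi>_props(3)[OF b])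
  obtain K where K: "compact K" "\<And>x. x \<notin> K \<Longrightarrow> \<phi> x = 0" "\<And>x. x \<notin> K \<Longrightarrow> \<phi>b x = 0"
    using \<phi>_props(4) unfolding \<phi>b_def by metis
  obtain R where R: "\<And>x. x \<in> K \<Longrightarrow> norm x \<le> R" using compact_imp_bounded[OF K(1)] by (auto simp: bounded_iff)
  obtain M1 where M1: "\<And>x. x \<in> K \<Longrightarrow> \<bar>\<phi> x\<bar> \<le> M1"
    using compact_imp_bounded[OF compact_continuous_image[OF continuous_on_subset[OF \<phi>_props(2)] K(1)]]
    by (metis bounded_iff image_eqI real_norm_def subset_UNIV)
  obtain M2 where M2: "\<And>x. x \<in> K \<Longrightarrow> \<bar>\<phi>b x\<bar> \<le> M2"
    using compact_imp_bounded[OF compact_continuous_image[OF continuous_on_subset[OF cont_\<phi>b] K(1)]]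
    by (metis bounded_iff image_eqI real_norm_def subset_UNIV)
  define M where "M = max \<bar>M1\<bar> \<bar>M2\<bar>"
  define \<delta> where "\<delta> n = 1 / real (Suc n)" for n
  have \<delta>: "0 < \<delta> n" for n by (simp add: \<delta>_def)
  have \<delta>_lim: "\<delta> \<longlonglongrightarrow> 0" unfolding \<delta>_def[abs_def] using LIMSEQ_inverse_real_of_nat by (simp add: divide_inverse)
  define v where "v n r = cutoff (\<delta> n) r * u r" for n r
  define v' where "v' n r = cutoff' (\<delta> n) r * u r + cutoff (\<delta> n) r * u' r" for n r
  define F where "F n x = v' n (norm x) * (sgn x \<bullet> b) * \<phi> x + v n (norm x) * \<phi>b x" for n and x :: "real^2"
  define G where "G x = u' (norm x) * (sgn x \<bullet> b) * \<phi> x + u (norm x) * \<phi>b x" for x :: "real^2"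
  have F_cont: "continuous_on UNIV (\<lambda>x::real^2. v' n (norm x) * (sgn x \<bullet> b))"
    and F_der: "((\<lambda>x::real^2. v n (norm x)) has_derivative (\<lambda>y. v' n (norm x) * (sgn x \<bullet> y))) (at x)" for n x
  proof -
    \<comment> \<open>Since the cut-off profile vanishes near 0, the plane is covered by the two
      open sets \<open>- {0}\<close> and \<open>ball 0 (\<delta> n)\<close>, on each of which
      regularity is clear.\<close>
    have zero: "v n (norm x) = 0" "v' n (norm x) = 0" if "x \<in> ball 0 (\<delta> n)" for x :: "real^2"
      using that by (auto simp: v_def v'_def cutoff_eq_0 cutoff'_eq_0)
    have "isCont (cutoff (\<delta> n)) r" for r using cutoff_deriv[OF \<delta>[of n]] by (rule DERIV_isCont)
    then have "continuous_on {0<..} (cutoff (\<delta> n))" by (simp add: continuous_at_imp_continuous_on)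
    then have "continuous_on {0<..} (v' n)"
      unfolding v'_def[abs_def]
      by (intro continuous_on_add continuous_on_mult continuous_cutoff'[OF \<delta>] cont cont')
    then have "continuous_on (- {0}) (\<lambda>x::real^2. v' n (norm x) * (sgn x \<bullet> b))"
      by (intro continuous_intros continuous_on_compose2[of "{0<..}" "v' n" _ norm]) auto
    moreover have "continuous_on (ball 0 (\<delta> n)) (\<lambda>x::real^2. v' n (norm x) * (sgn x \<bullet> b))"
      by (rule continuous_on_eq[of _ "\<lambda>_. 0"]) (auto simp: zero)
    ultimately have "continuous_on (- {0} \<union> ball 0 (\<delta> n)) (\<lambda>x::real^2. v' n (norm x) * (sgn x \<bullet> b))"
      by (intro continuous_on_open_Un) auto
    moreover have "- {0} \<union> ball 0 (\<delta> n) = (UNIV :: (real^2) set)" using \<delta>[of n] by auto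
    ultimately show "continuous_on UNIV (\<lambda>x::real^2. v' n (norm x) * (sgn x \<bullet> b))" by simp
    show "((\<lambda>x::real^2. v n (norm x)) has_derivative (\<lambda>y. v' n (norm x) * (sgn x \<bullet> y))) (at x)"
    proof (cases "x = 0")
      case True
      have "((\<lambda>x::real^2. v n (norm x)) has_derivative (\<lambda>y. 0)) (at x)"
        by (rule has_derivative_transform_within_open[of "\<lambda>_. 0" _ _ _ "ball 0 (\<delta> n)"])
          (use \<delta>[of n] True in \<open>auto simp: zero\<close>)
      with True show ?thesis by simp
    next
      case False
      then have "(v n has_real_derivative v' n (norm x)) (at (norm x))"
        unfolding v_def[abs_def] v'_def
        by (intro DERIV_cong[OF DERIV_mult[OF cutoff_deriv[OF \<delta>] deriv]]) simp_all
      then have "(v n has_derivative (\<lambda>h. v' n (norm x) * h)) (at (norm x))"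
        by (simp add: has_field_derivative_def)
      from has_derivative_compose[OF has_derivative_norm[OF False] this]
      show ?thesis by (simp add: inner_commute)
    qed
  qed
  have int_F: "(\<integral>x. F n x \<partial>lebesgue) = 0" for n
    using classical_integration_by_parts(1)[OF open_UNIV b F_der F_cont \<phi>, of n]
    by (simp add: set_lebesgue_integral_def F_def \<phi>b_def)
  have \<phi>_meas: "\<phi> \<in> borel_measurable lebesgue" "\<phi>b \<in> borel_measurable lebesgue"
    by (intro borel_measurable_lebesgue_continuous \<phi>_props(2) cont_\<phi>b)+
  have "(\<lambda>n. \<integral>x. F n x \<partial>lebesgue) \<longlonglongrightarrow> (\<integral>x. G x \<partial>lebesgue)"
  proof (rule integral_dominated_convergence)
    show "integrable lebesgue (\<lambda>x::real^2. M * (indicator {..R} (norm x) * (\<bar>u' (norm x)\<bar> + 2 * \<bar>u (norm x)\<bar> / norm x + \<bar>u (norm x)\<bar>)))"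
      using majorant_integrable by simp
    show "G \<in> borel_measurable lebesgue"
      unfolding G_def[abs_def]
      by (intro borel_measurable_add borel_measurable_times u_measurable u'_measurable sgn_inner_measurable \<phi>_meas)
    show "F n \<in> borel_measurable lebesgue" for n
    proof -
      have "continuous_on UNIV (\<lambda>x::real^2. v n (norm x))"
        by (intro continuous_at_imp_continuous_on ballI has_derivative_continuous[OF F_der])
      then show ?thesis
        unfolding F_def[abs_def]
        by (intro borel_measurable_lebesgue_continuous continuous_on_add continuous_on_mult F_cont \<phi>_props(2) cont_\<phi>b)
    qed
    show "AE x in lebesgue. (\<lambda>n. F n x) \<longlonglongrightarrow> G x"
    proof -
      have "AE x in lebesgue. x \<noteq> (0::real^2)" by (intro AE_completion AE_lborel_singleton)
      then show ?thesis
      proof eventually_elim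
        case (elim x)
        then have x: "0 < norm x" by simp
        have "(\<lambda>n. F n x) \<longlonglongrightarrow> (0 * u (norm x) + 1 * u' (norm x)) * (sgn x \<bullet> b) * \<phi> x + (1 * u (norm x)) * \<phi>b x"
          unfolding F_def v_def v'_def by (intro tendsto_intros cutoff_tendsto[OF \<delta>_lim x])
        then show ?case by (simp add: G_def)
      qed
    qed
    show "AE x in lebesgue. norm (F n x) \<le> M * (indicator {..R} (norm x) * (\<bar>u' (norm x)\<bar> + 2 * \<bar>u (norm x)\<bar> / norm x + \<bar>u (norm x)\<bar>))" for n
    proof (rule AE_I2)
      fix x :: "real^2"
      let ?p = "\<bar>u' (norm x)\<bar> + 2 * \<bar>u (norm x)\<bar> / norm x + \<bar>u (norm x)\<bar>"
      show "norm (F n x) \<le> M * (indicator {..R} (norm x) * ?p)"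
      proof (cases "x \<in> K \<and> x \<noteq> 0")
        case True
        have MM: "\<bar>\<phi> x\<bar> \<le> M" "\<bar>\<phi>b x\<bar> \<le> M" using M1[of x] M2[of x] True by (auto simp: M_def)
        have "\<bar>sgn x \<bullet> b\<bar> \<le> norm (sgn x) * norm b" by (rule Cauchy_Schwarz_ineq2)
        also have "\<dots> \<le> 1" using b by (simp add: norm_sgn)
        finally have s: "\<bar>sgn x \<bullet> b\<bar> \<le> 1" .
        have v_le: "\<bar>v n (norm x)\<bar> \<le> \<bar>u (norm x)\<bar>"
          unfolding v_def abs_mult using cutoff_range[of "\<delta> n" "norm x"] by (simp add: mult_left_le_one_le)
        have "\<bar>v' n (norm x)\<bar> \<le> \<bar>cutoff' (\<delta> n) (norm x)\<bar> * \<bar>u (norm x)\<bar> + \<bar>cutoff (\<delta> n) (norm x)\<bar> * \<bar>u' (norm x)\<bar>"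
          unfolding v'_def abs_mult[symmetric] by (rule abs_triangle_ineq)
        also have "\<dots> \<le> 2 / norm x * \<bar>u (norm x)\<bar> + 1 * \<bar>u' (norm x)\<bar>"
          using cutoff_range[of "\<delta> n" "norm x"] cutoff'_bound[OF \<delta>[of n], of "norm x"] True
          by (intro add_mono mult_right_mono) auto
        finally have v'_le: "\<bar>v' n (norm x)\<bar> \<le> 2 * \<bar>u (norm x)\<bar> / norm x + \<bar>u' (norm x)\<bar>" by simp
        have "\<bar>F n x\<bar> \<le> \<bar>v' n (norm x)\<bar> * \<bar>sgn x \<bullet> b\<bar> * \<bar>\<phi> x\<bar> + \<bar>v n (norm x)\<bar> * \<bar>\<phi>b x\<bar>"
          unfolding F_def abs_mult[symmetric] by (rule abs_triangle_ineq)
        also have "\<dots> \<le> (2 * \<bar>u (norm x)\<bar> / norm x + \<bar>u' (norm x)\<bar>) * 1 * M + \<bar>u (norm x)\<bar> * M"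
          using v_le v'_le s MM by (intro add_mono mult_mono) auto
        also have "\<dots> = M * ?p" by (simp add: algebra_simps)
        finally show ?thesis using True R by simp
      next
        case False
        \<comment> \<open>At x = 0 both \<open>sgn x\<close> and the cutoff vanish, so the arbitrary
          value \<open>u 0\<close> does not enter.\<close>
        have "F n x = 0"
          using False K by (cases "x = 0") (auto simp: F_def v_def cutoff_eq_0 \<delta> less_imp_le)
        then show ?thesis by (simp add: M_def)
      qed
    qed
  qed
  then have "(\<integral>x. G x \<partial>lebesgue) = 0" by (simp add: int_F LIMSEQ_const_iff)
  moreover have "(\<integral>x. G x \<partial>lebesgue) = (LINT x:UNIV|lebesgue. u' (norm x) * (sgn x \<bullet> b) * \<phi> x + u (norm x) * \<phi>b x)"
    by (simp add: set_lebesgue_integral_def G_def)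
  moreover have "\<dots> = (LINT x:UNIV|lebesgue. u' (norm x) * (sgn x \<bullet> b) * \<phi> x) + (LINT x:UNIV|lebesgue. u (norm x) * \<phi>b x)"
    using K by (intro set_integral_add(2) set_integrable_loc_times_test[of _ _ _ K] loc_u loc_u' \<phi>_props(2) cont_\<phi>b) auto
  ultimately show "(LINT x:UNIV|lebesgue. u (norm x) * frechet_derivative \<phi> (at x) b) = - (LINT x:UNIV|lebesgue. u' (norm x) * (sgn x \<bullet> b) * \<phi> x)"
    unfolding \<phi>b_def by linarith
qed

lemma in_H_space: "u \<in> H_space"
  unfolding H_space_def Sobolev_H1_def using u_L2 u'_L2 weak_partial_radial by blast

end

section \<open>A priori bounds\<close>

text \<open>\<open>g0\<close> is kept apart from \<open>g\<close> so that the constants of the final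
  bound can refer to the former: exported from the locale, \<open>CY\<close> is a function of
  \<open>d\<close>, \<kappa> and \<open>g0\<close> and hence uniform over all solutions with
  \<open>g0 \<le> g\<close>.\<close>

locale GL_solution =
  fixes d :: int and \<kappa> g0 g :: real and f S m :: "real \<Rightarrow> real"
  assumes d_nonzero: "d \<noteq> 0" and \<kappa>_pos: "0 < \<kappa>" and g0_pos: "0 < g0" and g_ge: "g0 \<le> g"
    and adm: "admissible d \<kappa> g f S m"
begin

definition D :: real where "D = \<bar>of_int d\<bar>"
definition a :: "real \<Rightarrow> real" where "a r = sgn (of_int d) * (of_int d - S r)"
definition b :: "real \<Rightarrow> real" where "b r = sgn (of_int d) * deriv S r / r"
definition h :: "real \<Rightarrow> real" where "h r = (f r)\<^sup>2 + (m r)\<^sup>2"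
definition e :: "real \<Rightarrow> real" where
  "e r = ((deriv f r)\<^sup>2 + (b r)\<^sup>2 + (deriv m r)\<^sup>2 + \<kappa>\<^sup>2 * g * (m r)\<^sup>2
     + (a r)\<^sup>2 * (f r)\<^sup>2 / r\<^sup>2 + \<kappa>\<^sup>2 / 2 * (1 - h r)\<^sup>2) / 2"

lemma D_pos: "0 < D" using d_nonzero by (simp add: D_def)
lemma g_pos: "0 < g" using g0_pos g_ge by simp

lemma sgn_sq: "(sgn (of_int d :: real))\<^sup>2 = 1"
  using d_nonzero by (simp add: sgn_if)

lemma a_sq: "(of_int d - S r)\<^sup>2 = (a r)\<^sup>2" by (simp add: a_def power_mult_distrib sgn_sq)

lemma S_eq: "S r = sgn (of_int d) * (D - a r)"
  using d_nonzero by (auto simp: a_def D_def sgn_if)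

lemma S'_eq: "0 < r \<Longrightarrow> deriv S r = sgn (of_int d) * r * b r"
  using d_nonzero by (auto simp: b_def sgn_if)

lemma e_ge:
  "(a r)\<^sup>2 * (f r)\<^sup>2 / r\<^sup>2 \<le> 2 * e r"
  "\<kappa>\<^sup>2 / 2 * (1 - h r)\<^sup>2 \<le> 2 * e r"
proof -
  have "0 \<le> \<kappa>\<^sup>2 * g * (m r)\<^sup>2" "0 \<le> \<kappa>\<^sup>2 / 2 * (1 - h r)\<^sup>2" "0 \<le> (a r)\<^sup>2 * (f r)\<^sup>2 / r\<^sup>2"
    "0 \<le> (deriv f r)\<^sup>2" "0 \<le> (deriv m r)\<^sup>2" "0 \<le> (b r)\<^sup>2" using g_pos by auto
  moreover have "2 * e r = (deriv f r)\<^sup>2 + (b r)\<^sup>2 + (deriv m r)\<^sup>2 + \<kappa>\<^sup>2 * g * (m r)\<^sup>2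
     + (a r)\<^sup>2 * (f r)\<^sup>2 / r\<^sup>2 + \<kappa>\<^sup>2 / 2 * (1 - h r)\<^sup>2" by (simp add: e_def)
  ultimately show "(a r)\<^sup>2 * (f r)\<^sup>2 / r\<^sup>2 \<le> 2 * e r" "\<kappa>\<^sup>2 / 2 * (1 - h r)\<^sup>2 \<le> 2 * e r"
    by - linarith+
qed

lemma energy_density_eq:
  assumes "0 < r" shows "1 / 2 * GL_energy_density d \<kappa> g f S m r * r = e r * r"
proof -
  have "(deriv S r / r)\<^sup>2 = (b r)\<^sup>2"
    using S'_eq[OF assms] assms by (simp add: power_mult_distrib sgn_sq)
  then show ?thesis unfolding GL_energy_density_def e_def h_def a_sq
    by (simp add: algebra_simps)
qed

lemma energy_finite: "(\<integral>\<^sup>+ r\<in>{0<..}. ennreal (e r * r) \<partial>lebesgue) < \<infinity>"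
proof -
  have "GL_energy d \<kappa> g f S m = (\<integral>\<^sup>+ r\<in>{0<..}. ennreal (e r * r) \<partial>lebesgue)"
    unfolding GL_energy_def
    by (intro nn_integral_cong) (auto simp: indicator_def simp del: times_divide_eq_left simp flip: energy_density_eq)
  then show ?thesis using adm by (simp add: admissible_def)
qed

lemma GL_sys: "GL_system d \<kappa> g f S m" using adm by (simp add: admissible_def)

lemma f_nonneg: "0 \<le> r \<Longrightarrow> 0 \<le> f r" and m_nonneg: "0 \<le> r \<Longrightarrow> 0 \<le> m r"
  using adm by (auto simp: admissible_def)

lemma has_deriv:
  assumes "0 < r"
  shows "(f has_real_derivative deriv f r) (at r)" "(S has_real_derivative deriv S r) (at r)"
    "(m has_real_derivative deriv m r) (at r)"
    "(deriv f has_real_derivative deriv (deriv f) r) (at r)"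
    "(deriv S has_real_derivative deriv (deriv S) r) (at r)"
    "(deriv m has_real_derivative deriv (deriv m) r) (at r)"
  using GL_sys assms
  unfolding GL_system_def twice_differentiable_pos_def
  by (simp_all add: DERIV_deriv_iff_real_differentiable)

lemma deriv_a: "0 < r \<Longrightarrow> (a has_real_derivative - (r * b r)) (at r)"
  unfolding a_def[abs_def] b_def by (auto intro!: derivative_eq_intros has_deriv)

lemma deriv_b:
  assumes "0 < r" shows "(b has_real_derivative - (a r * (f r)\<^sup>2 / r)) (at r)"
proof -
  have *: "deriv (deriv S) r = deriv S r / r - (of_int d - S r) * (f r)\<^sup>2"
    using GL_sys assms by (auto simp: GL_system_def)
  show ?thesis
    unfolding b_def[abs_def] a_def
    by (rule derivative_eq_intros has_deriv refl assms)+
      (use assms in \<open>auto simp: * field_simps power2_eq_square\<close>)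
qed

lemma deriv_rf':
  assumes "0 < r"
  shows "((\<lambda>r. r * deriv f r) has_real_derivative ((a r)\<^sup>2 * f r / r - \<kappa>\<^sup>2 * r * (1 - h r) * f r)) (at r)"
proof -
  have "- deriv (deriv f) r - 1 / r * deriv f r + (a r)\<^sup>2 / r\<^sup>2 * f r = \<kappa>\<^sup>2 * (1 - (f r)\<^sup>2 - (m r)\<^sup>2) * f r"
    using GL_sys assms a_sq by (auto simp: GL_system_def)
  then have *: "deriv (deriv f) r = - (1 / r * deriv f r) + (a r)\<^sup>2 / r\<^sup>2 * f r - \<kappa>\<^sup>2 * (1 - h r) * f r"
    unfolding h_def diff_diff_eq[symmetric] by linarith
  show ?thesis
    by (rule derivative_eq_intros has_deriv refl assms)+ (use assms * in \<open>auto simp: field_simps power2_eq_square\<close>)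
qed

lemma deriv_rm':
  assumes "0 < r"
  shows "((\<lambda>r. r * deriv m r) has_real_derivative (\<kappa>\<^sup>2 * g * r * m r - \<kappa>\<^sup>2 * r * (1 - h r) * m r)) (at r)"
proof -
  have "- deriv (deriv m) r - 1 / r * deriv m r + \<kappa>\<^sup>2 * g * m r = \<kappa>\<^sup>2 * (1 - (f r)\<^sup>2 - (m r)\<^sup>2) * m r"
    using GL_sys assms by (auto simp: GL_system_def)
  then have *: "deriv (deriv m) r = - (1 / r * deriv m r) + \<kappa>\<^sup>2 * g * m r - \<kappa>\<^sup>2 * (1 - h r) * m r"
    unfolding h_def diff_diff_eq[symmetric] by linarith
  show ?thesis
    by (rule derivative_eq_intros has_deriv refl assms)+ (use assms * in \<open>auto simp: field_simps power2_eq_square\<close>)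
qed

lemma continuous:
  shows "continuous_on {0<..} f" "continuous_on {0<..} m" "continuous_on {0<..} a" "continuous_on {0<..} b"
    "continuous_on {0<..} (deriv f)" "continuous_on {0<..} (deriv m)" "continuous_on {0<..} h"
proof -
  show *: "continuous_on {0<..} f" "continuous_on {0<..} m" "continuous_on {0<..} a" "continuous_on {0<..} b"
    "continuous_on {0<..} (deriv f)" "continuous_on {0<..} (deriv m)"
    by (intro DERIV_atLeastAtMost_imp_continuous_on continuous_at_imp_continuous_on ballI;
        use has_deriv deriv_a deriv_b in \<open>force intro: DERIV_isCont\<close>)+
  show "continuous_on {0<..} h" unfolding h_def[abs_def] by (intro continuous_intros *)
qed

subsection \<open>The pointwise bound \<open>h \<le> 1\<close>\<close>

text \<open>This is r h', so that its derivative divided by r is the planar Laplacian of h(|x|).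
  Positivity of that derivative where h > 1 makes \<open>h\<close> subharmonic there and drives the
  maximum principle.\<close>

definition N :: "real \<Rightarrow> real" where "N r = 2 * (f r * (r * deriv f r) + m r * (r * deriv m r))"

lemma deriv_h: "0 < r \<Longrightarrow> (h has_real_derivative N r / r) (at r)"
  unfolding h_def[abs_def] N_def by (auto intro!: derivative_eq_intros has_deriv simp: field_simps)

definition N' :: "real \<Rightarrow> real" where
  "N' r = 2 * r * ((deriv f r)\<^sup>2 + (deriv m r)\<^sup>2 + (a r)\<^sup>2 * (f r)\<^sup>2 / r\<^sup>2 + \<kappa>\<^sup>2 * g * (m r)\<^sup>2 + \<kappa>\<^sup>2 * (h r - 1) * h r)"

lemma deriv_N:
  assumes "0 < r"
  shows "(N has_real_derivative N' r) (at r)"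
  unfolding N_def N'_def h_def[of r]
  by (rule derivative_eq_intros deriv_rf'[unfolded h_def] deriv_rm'[unfolded h_def] has_deriv refl assms)+
    (use assms in \<open>auto simp: field_simps power2_eq_square\<close>)

lemma N'_pos:
  assumes "0 < r" "1 < h r"
  shows "0 < N' r"
proof -
  have "0 < \<kappa>\<^sup>2 * (h r - 1) * h r" using assms \<kappa>_pos by auto
  then show ?thesis unfolding N'_def using assms(1) g_pos by (intro mult_pos_pos[of "2 * r"] add_nonneg_pos) auto
qed

text \<open>As the derivative of \<open>N\<close> is positive at \<open>r\<close>, \<open>N\<close>
  and hence h' are positive immediately to the right, even if \<open>N r = 0\<close>.\<close>

lemma h_increasing_at_critical:
  assumes "0 < r" "1 < h r" "0 \<le> N r"
  shows "\<exists>\<delta>>0. \<forall>s. r < s \<and> s < r + \<delta> \<longrightarrow> h r < h s"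
proof -
  from DERIV_pos_inc_right[OF deriv_N[OF assms(1)] N'_pos[OF assms(1,2)]]
  obtain \<delta> where \<delta>: "0 < \<delta>" "\<And>x. 0 < x \<Longrightarrow> x < \<delta> \<Longrightarrow> N r < N (r + x)" by auto
  have "h r < h s" if s: "r < s" "s < r + \<delta>" for s
  proof -
    obtain z where z: "r < z" "z < s" "h s - h r = (s - r) * (N z / z)"
      using MVT2[of r s h "\<lambda>z. N z / z"] deriv_h s assms(1) by auto
    have "N r < N z" using \<delta>(2)[of "z - r"] z s by auto
    then have "0 < (s - r) * (N z / z)" using assms z s by auto
    with z(3) show ?thesis by simp
  qed
  with \<delta>(1) show ?thesis by auto
qed

text \<open>At a maximum point other than \<open>r2\<close> one has \<open>N \<ge> 0\<close>: in the
  interior because h' vanishes, at \<open>r1\<close> by the last hypothesis. But then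
  \<open>h\<close> increases further to the right.\<close>

lemma no_interior_max:
  assumes "0 < r1" "r1 < r2" "1 < h r1" "0 \<le> N r1 \<or> (\<exists>s\<in>{r1<..r2}. h r1 < h s)"
  shows "\<forall>r\<in>{r1..r2}. h r \<le> h r2"
proof -
  have "continuous_on {r1..r2} h" using continuous(7) assms(1) by (auto elim: continuous_on_subset)
  then obtain t where t: "t \<in> {r1..r2}" "\<And>s. s \<in> {r1..r2} \<Longrightarrow> h s \<le> h t"
    using continuous_attains_sup[of "{r1..r2}" h] assms(2) by auto
  show ?thesis
  proof (cases "t = r2")
    case False
    have t1: "1 < h t" using t(2)[of r1] assms by auto
    have "0 \<le> N t"
    proof (cases "t = r1")
      case True
      have "\<not> h r1 < h s" if "s \<in> {r1<..r2}" for s using t(2)[of s] that True by auto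
      with True assms(4) show ?thesis by blast
    next
      case False
      with \<open>t \<noteq> r2\<close> t have "N t / t = 0"
        using assms(1)
        by (intro DERIV_local_max[OF deriv_h[of t], of "min (t - r1) (r2 - t)"]) (auto simp: abs_if split: if_splits)
      then show ?thesis using t assms(1) by auto
    qed
    then obtain \<delta> where \<delta>: "0 < \<delta>" "\<forall>s. t < s \<and> s < t + \<delta> \<longrightarrow> h t < h s"
      using h_increasing_at_critical[of t] t1 t assms(1) by auto
    define s where "s = t + min (\<delta> / 2) (r2 - t)"
    have "t < s" "s < t + \<delta>" "s \<in> {r1..r2}" using \<delta>(1) t(1) False by (auto simp: s_def min_def)
    then have False using \<delta>(2) t(2)[of s] by force
    then show ?thesis ..
  qed (use t in auto)
qed

text \<open>Otherwise \<open>h\<close> would stay above \<open>h r0 > 1\<close> on the whole ray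
  from \<open>r0\<close>, the potential term would stay above a positive constant, and the energy
  would be infinite.\<close>

lemma N_neg_if_h_gt_1:
  assumes "0 < r0" "1 < h r0" shows "N r0 < 0"
proof (rule ccontr)
  assume "\<not> N r0 < 0"
  then have N: "0 \<le> N r0" by simp
  have h: "h r0 \<le> h r" if "r0 \<le> r" for r
    using no_interior_max[OF assms(1) _ assms(2), of r] N that by (cases "r = r0") auto
  define c where "c = \<kappa>\<^sup>2 / 4 * (h r0 - 1)\<^sup>2"
  have c: "0 < c" using \<kappa>_pos assms by (auto simp: c_def)
  have "c \<le> e r" if "r0 \<le> r" for r
  proof -
    have "(h r0 - 1)\<^sup>2 \<le> (h r - 1)\<^sup>2" using h[OF that] assms by (intro power_mono) auto
    then have "\<kappa>\<^sup>2 / 2 * (h r0 - 1)\<^sup>2 \<le> \<kappa>\<^sup>2 / 2 * (1 - h r)\<^sup>2"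
      unfolding power2_commute[of 1] by (intro mult_left_mono) auto
    then show ?thesis using e_ge(2)[of r] unfolding c_def by linarith
  qed
  moreover obtain r where r: "r \<ge> max 1 r0" "e r * r < c / r"
    using not_dominates_inverse_at_top[OF energy_finite c, of "max 1 r0"] by fastforce
  ultimately have "c * r \<le> e r * r" by (intro mult_right_mono) auto
  with r have "c * r < c / r" by linarith
  moreover have "c / r \<le> c / 1" using r c by (intro divide_left_mono) auto
  moreover have "c * 1 \<le> c * r" using r c by (intro mult_left_mono) auto
  ultimately show False by simp
qed

text \<open>Only the case h > 1 with N < 0 is left, and there the contradiction arises at the
  origin: towards 0, \<open>h\<close> grows at least logarithmically. As \<open>m\<close> is bounded
  near 0 and \<open>a\<close> is close to \<open>D\<close>, f^2 becomes large, and a^2 f^2/r^2 is at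
  least of order 1/r^2, which is not integrable against r dr.\<close>

lemma h_le_1:
  assumes r0: "0 < r0" shows "h r0 \<le> 1"
proof (rule ccontr)
  assume "\<not> h r0 \<le> 1"
  then have h0: "1 < h r0" by simp
  have left: "h r0 \<le> h r" if r: "0 < r" "r \<le> r0" for r
  proof (rule ccontr)
    assume "\<not> h r0 \<le> h r"
    then have r_lt: "r < r0" "h r < h r0" using r by (cases "r = r0"; auto)+
    have "continuous_on {r..r0} h" using continuous(7) r by (auto elim: continuous_on_subset)
    then obtain t where t: "t \<in> {r..r0}" "\<And>s. s \<in> {r..r0} \<Longrightarrow> h s \<le> h t"
      using continuous_attains_sup[of "{r..r0}" h] r by auto
    have ht: "1 < h t" "t \<noteq> r" using t(2)[of r0] h0 r_lt by auto
    have Nt: "N t < 0" using N_neg_if_h_gt_1[of t] ht t r by auto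
    then have "N t / t < 0" using t r by (auto simp: divide_neg_pos)
    from DERIV_neg_dec_left[OF deriv_h[of t] this] obtain \<delta> where
      \<delta>: "0 < \<delta>" "\<And>x. 0 < x \<Longrightarrow> x < \<delta> \<Longrightarrow> h t < h (t - x)" using t r by auto
    define x where "x = min (\<delta> / 2) (t - r)"
    have "0 < x" "x < \<delta>" "t - x \<in> {r..r0}" using \<delta>(1) t(1) ht by (auto simp: x_def min_def)
    then show False using \<delta>(2)[of x] t(2)[of "t - x"] by force
  qed
  define c where "c = - N r0"
  have c: "0 < c" using N_neg_if_h_gt_1[OF r0 h0] by (simp add: c_def)
  have Nle: "N r \<le> - c" if r: "0 < r" "r \<le> r0" for r
  proof -
    have "N r \<le> N r0"
    proof (rule DERIV_nonneg_imp_nondecreasing[OF r(2)])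
      show "\<exists>y. (N has_real_derivative y) (at x) \<and> 0 \<le> y" if "r \<le> x" "x \<le> r0" for x
        using deriv_N[of x] N'_pos[of x] left[of x] h0 that r by (auto intro!: exI[of _ "N' x"] less_imp_le)
    qed
    then show ?thesis by (simp add: c_def)
  qed
  have hlog: "h r0 + c * ln r0 \<le> h r + c * ln r" if r: "0 < r" "r \<le> r0" for r
  proof -
    have "h r0 + c * ln r0 \<le> h r + c * ln r"
    proof (rule DERIV_nonpos_imp_nonincreasing[OF r(2)])
      show "\<exists>y. ((\<lambda>r. h r + c * ln r) has_real_derivative y) (at x) \<and> y \<le> 0" if "r \<le> x" "x \<le> r0" for x
        using Nle[of x] that r
        by (intro exI[of _ "N x / x + c * (1 / x)"]) (auto intro!: derivative_eq_intros deriv_h simp: field_simps)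
    qed
    then show ?thesis .
  qed
  have S0: "S 0 = 0" "continuous (at 0 within {0..}) S" and m0: "(m has_real_derivative 0) (at 0 within {0..})"
    using adm by (auto simp: admissible_def)
  have "(m \<longlongrightarrow> m 0) (at 0 within {0..})"
    using m0 has_field_derivative_imp_has_derivative has_derivative_continuous continuous_within by blast
  then have "\<forall>\<^sub>F r in at 0 within {0..}. m r < m 0 + 1" by (rule order_tendstoD) auto
  then obtain r1 where r1: "0 < r1" "\<And>r. 0 < r \<Longrightarrow> r < r1 \<Longrightarrow> m r < m 0 + 1"
    by (auto simp: eventually_at dist_real_def)
  have "(S \<longlongrightarrow> 0) (at 0 within {0..})" using S0 by (auto simp: continuous_within)
  then have "((\<lambda>r. \<bar>S r\<bar>) \<longlongrightarrow> \<bar>0\<bar>) (at 0 within {0..})" by (rule tendsto_rabs)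
  then have "\<forall>\<^sub>F r in at 0 within {0..}. \<bar>S r\<bar> < D / 2" by (rule order_tendstoD) (use D_pos in auto)
  then obtain r2 where r2: "0 < r2" "\<And>r. 0 < r \<Longrightarrow> r < r2 \<Longrightarrow> \<bar>S r\<bar> < D / 2"
    by (auto simp: eventually_at dist_real_def)
  \<comment> \<open>\<open>A \<le> h r\<close> together with \<open>m r < m 0 + 1\<close> leaves f^2
    >= 1. The entries of \<open>R\<close> secure the bound on \<open>m\<close>, the bound |S| < D/2,
    the validity of \<open>hlog\<close>, and that \<open>hlog\<close> exceeds
    \<open>A\<close>.\<close>
  define A where "A = (m 0 + 1)\<^sup>2 + 1"
  define R where "R = min (min (r1 / 2) (r2 / 2)) (min r0 (exp (ln r0 - A / c)))"
  have R: "0 < R" using r0 r1 r2 by (auto simp: R_def)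
  obtain r where r: "0 < r" "r \<le> R" "e r * r < D\<^sup>2 / 8 / r"
    using not_dominates_inverse_at_0[OF energy_finite _ R, of "D\<^sup>2 / 8"] D_pos by auto
  have "ln r \<le> ln r0 - A / c"
    using r R r0 by (subst ln_le_cancel_iff[of _ "exp (ln r0 - A / c)", unfolded ln_exp]) (auto simp: R_def)
  then have "A \<le> h r" using hlog[of r] r h0 c by (auto simp: R_def field_simps)
  moreover have "(m r)\<^sup>2 \<le> (m 0 + 1)\<^sup>2"
    using r1(2)[of r] r m_nonneg[of r] by (intro power_mono) (auto simp: R_def)
  ultimately have f1: "1 \<le> (f r)\<^sup>2" by (simp add: h_def A_def)
  have "D / 2 \<le> a r"
  proof -
    have "\<bar>S r\<bar> < D / 2" using r r1 r2 by (intro r2(2)) (auto simp: R_def)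
    then show ?thesis using d_nonzero by (auto simp: a_def D_def sgn_if split: if_splits)
  qed
  then have "(D / 2)\<^sup>2 * 1 \<le> (a r)\<^sup>2 * (f r)\<^sup>2" using D_pos f1 by (intro mult_mono power_mono) auto
  then have "(D\<^sup>2 / 4) / r\<^sup>2 \<le> (a r)\<^sup>2 * (f r)\<^sup>2 / r\<^sup>2"
    by (intro divide_right_mono) (auto simp: power_divide)
  also have "\<dots> \<le> 2 * e r" by (rule e_ge(1))
  finally have "(D\<^sup>2 / 4) / r\<^sup>2 * r \<le> 2 * e r * r" using r by (intro mult_right_mono) auto
  with r show False by (simp add: power2_eq_square field_simps)
qed

section \<open>Signs and monotonicity of a and b\<close>

lemma h_nonneg: "0 \<le> h r" by (simp add: h_def)

lemma f_sq_le_1: "0 < r \<Longrightarrow> (f r)\<^sup>2 \<le> 1" and m_sq_le_1: "0 < r \<Longrightarrow> (m r)\<^sup>2 \<le> 1"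
  using h_le_1[of r] zero_le_power2[of "f r"] zero_le_power2[of "m r"] unfolding h_def by linarith+

lemma f_le_1: "0 < r \<Longrightarrow> f r \<le> 1" and m_le_1: "0 < r \<Longrightarrow> m r \<le> 1"
  using f_sq_le_1[of r] m_sq_le_1[of r] power2_le_imp_le[of "f r" 1] power2_le_imp_le[of "m r" 1] by auto

text \<open>Equivalent to (h - 1/2)^2 >= 0. Since \<open>f\<close>, \<open>m\<close> and 1 - h
  cannot be small together, the potential energy takes over where f^2 is too small as a
  weight.\<close>

lemma mass_bound: "3 / 4 \<le> (f r)\<^sup>2 + (m r)\<^sup>2 + (1 - h r)\<^sup>2"
proof -
  have "0 \<le> (h r - 1 / 2)\<^sup>2" by simp
  then show ?thesis unfolding h_def[of r, symmetric] by (simp add: power2_eq_square algebra_simps)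
qed

lemma e_not_bounded_below:
  assumes "0 < c" obtains r where "R \<le> r" "1 \<le> r" "e r < c"
proof -
  obtain r where r: "r \<ge> max 1 R" "e r * r < c / r"
    using not_dominates_inverse_at_top[OF energy_finite assms, of "max 1 R"] by fastforce
  have "1 * 1 \<le> r * r" using r by (intro mult_mono) auto
  then have "c * 1 \<le> c * (r * r)" using assms by (intro mult_left_mono) auto
  then have "c / r \<le> c * r" using r by (simp add: field_simps)
  then have "e r * r < c * r" using r by linarith
  then have "e r < c" using r by simp
  with r that show thesis by auto
qed

lemma deriv_ab: "0 < r \<Longrightarrow> ((\<lambda>r. a r * b r) has_real_derivative - (r * (b r)\<^sup>2 + (a r)\<^sup>2 * (f r)\<^sup>2 / r)) (at r)"
  by (auto intro!: derivative_eq_intros deriv_a deriv_b simp: power2_eq_square)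

lemma ab_antimono:
  assumes "0 < r" "r \<le> s" shows "a s * b s \<le> a r * b r"
proof (rule DERIV_nonpos_imp_nonincreasing[OF assms(2)])
  fix x assume x: "r \<le> x" "x \<le> s"
  have "0 \<le> x * (b x)\<^sup>2 + (a x)\<^sup>2 * (f x)\<^sup>2 / x" using x assms by (intro add_nonneg_nonneg) auto
  then have "- (x * (b x)\<^sup>2 + (a x)\<^sup>2 * (f x)\<^sup>2 / x) \<le> 0" by linarith
  then show "\<exists>y. ((\<lambda>r. a r * b r) has_real_derivative y) (at x) \<and> y \<le> 0"
    using deriv_ab[of x] x assms by fastforce
qed

lemma deriv_a_sq: "0 < r \<Longrightarrow> ((\<lambda>r. (a r)\<^sup>2) has_real_derivative - 2 * r * (a r * b r)) (at r)"
  by (auto intro!: derivative_eq_intros deriv_a simp: power2_eq_square)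

text \<open>If a b = -c < 0 somewhere, monotonicity keeps a b <= -c beyond, and (a^2)' = -2 r a b
  makes a^2 grow quadratically. Then a^2/r^2 is bounded below far out, and \<open>mass_bound\<close>
  keeps the energy density away from 0, against finite energy.\<close>

lemma ab_nonneg:
  assumes r0: "0 < r0" shows "0 \<le> a r0 * b r0"
proof (rule ccontr)
  assume "\<not> 0 \<le> a r0 * b r0"
  moreover define c where "c = - (a r0 * b r0)"
  ultimately have c: "0 < c" "a r0 * b r0 = - c" by linarith+
  have a_large: "c * (r\<^sup>2 - r0\<^sup>2) \<le> (a r)\<^sup>2" if r: "r0 \<le> r" for r
  proof -
    have "(a r0)\<^sup>2 - c * r0\<^sup>2 \<le> (a r)\<^sup>2 - c * r\<^sup>2"
    proof (rule DERIV_nonneg_imp_nondecreasing[OF r])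
      fix x assume x: "r0 \<le> x" "x \<le> r"
      have "x * (a x * b x) \<le> x * (- c)" using ab_antimono[OF r0 x(1)] c x r0 by (intro mult_left_mono) auto
      moreover have "((\<lambda>r. (a r)\<^sup>2 - c * r\<^sup>2) has_real_derivative - 2 * x * (a x * b x) - c * (2 * x)) (at x)"
        using x r0 by (intro DERIV_diff deriv_a_sq) (auto intro!: derivative_eq_intros)
      moreover have "0 \<le> - 2 * x * (a x * b x) - c * (2 * x)" using calculation by (simp add: algebra_simps)
      ultimately show "\<exists>y. ((\<lambda>r. (a r)\<^sup>2 - c * r\<^sup>2) has_real_derivative y) (at x) \<and> 0 \<le> y"
        by blast
    qed
    moreover have "0 \<le> (a r0)\<^sup>2" by simp
    ultimately show ?thesis unfolding right_diff_distrib by linarith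
  qed
  \<comment> \<open>A common lower bound for the weights of f^2, m^2 and (1 - h)^2 in 2 e. For r >=
    2 r0 one has r^2 - r0^2 >= 3/4 r^2, whence \<open>3 / 4 * c\<close>.\<close>
  define k where "k = min (3 / 4 * c) (min (\<kappa>\<^sup>2 * g) (\<kappa>\<^sup>2 / 2))"
  have k: "0 < k" "k \<le> 3 / 4 * c" "k \<le> \<kappa>\<^sup>2 * g" "k \<le> \<kappa>\<^sup>2 / 2"
    unfolding k_def using c g_pos \<kappa>_pos by (simp_all add: min_le_iff_disj)
  obtain r where r: "2 * r0 \<le> r" "1 \<le> r" "e r < k * (3 / 8)"
    using e_not_bounded_below[of "k * (3 / 8)" "2 * r0"] k(1) by auto
  have "(2 * r0)\<^sup>2 \<le> r\<^sup>2" using r r0 by (intro power_mono) auto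
  then have "c * (3 / 4 * r\<^sup>2) \<le> c * (r\<^sup>2 - r0\<^sup>2)" using c by (intro mult_left_mono) (auto simp: power2_eq_square)
  also have "\<dots> \<le> (a r)\<^sup>2" using a_large r r0 by auto
  finally have "(3 / 4 * c) * r\<^sup>2 \<le> (a r)\<^sup>2" by simp
  then have "(3 / 4 * c) * r\<^sup>2 / r\<^sup>2 \<le> (a r)\<^sup>2 / r\<^sup>2" by (intro divide_right_mono) auto
  moreover have "(3 / 4 * c) * r\<^sup>2 / r\<^sup>2 = 3 / 4 * c" using r by simp
  ultimately have "k \<le> (a r)\<^sup>2 / r\<^sup>2" using k by linarith
  then have "k * (f r)\<^sup>2 \<le> (a r)\<^sup>2 / r\<^sup>2 * (f r)\<^sup>2" by (intro mult_right_mono) auto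
  moreover have "k * (m r)\<^sup>2 \<le> \<kappa>\<^sup>2 * g * (m r)\<^sup>2" "k * (1 - h r)\<^sup>2 \<le> \<kappa>\<^sup>2 / 2 * (1 - h r)\<^sup>2"
    using k by (intro mult_right_mono; auto)+
  moreover have "k * (3 / 4) \<le> k * (f r)\<^sup>2 + k * (m r)\<^sup>2 + k * (1 - h r)\<^sup>2"
    using mult_left_mono[OF mass_bound[of r], of k] k(1) by (simp add: distrib_left)
  moreover have "2 * e r = (deriv f r)\<^sup>2 + (b r)\<^sup>2 + (deriv m r)\<^sup>2 + \<kappa>\<^sup>2 * g * (m r)\<^sup>2
     + (a r)\<^sup>2 / r\<^sup>2 * (f r)\<^sup>2 + \<kappa>\<^sup>2 / 2 * (1 - h r)\<^sup>2" by (simp add: e_def)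
  moreover have "0 \<le> (deriv f r)\<^sup>2" "0 \<le> (b r)\<^sup>2" "0 \<le> (deriv m r)\<^sup>2" by auto
  ultimately have "k * (3 / 4) \<le> 2 * e r" by linarith
  with r(3) show False by linarith
qed

lemma a_near_0:
  assumes "0 < \<epsilon>" shows "\<exists>\<delta>>0. \<forall>r. 0 < r \<longrightarrow> r < \<delta> \<longrightarrow> \<bar>a r - D\<bar> < \<epsilon>"
proof -
  have "S 0 = 0" "continuous (at 0 within {0..}) S" using adm by (auto simp: admissible_def)
  then have "(S \<longlongrightarrow> 0) (at 0 within {0..})" by (auto simp: continuous_within)
  then have "((\<lambda>r. \<bar>S r\<bar>) \<longlongrightarrow> \<bar>0\<bar>) (at 0 within {0..})" by (rule tendsto_rabs)
  then have "\<forall>\<^sub>F r in at 0 within {0..}. \<bar>S r\<bar> < \<epsilon>" by (rule order_tendstoD) (use assms in auto)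
  then obtain \<delta> where \<delta>: "0 < \<delta>" "\<And>r. 0 < r \<Longrightarrow> r < \<delta> \<Longrightarrow> \<bar>S r\<bar> < \<epsilon>"
    by (auto simp: eventually_at dist_real_def)
  have "\<bar>S r\<bar> = \<bar>D - a r\<bar>" for r
    using d_nonzero by (subst S_eq) (simp add: abs_mult)
  with \<delta> show ?thesis by (intro exI[of _ \<delta>]) (simp add: abs_minus_commute)
qed

lemma a_sq_antimono:
  assumes "0 < r" "r \<le> s" shows "(a s)\<^sup>2 \<le> (a r)\<^sup>2"
proof (rule DERIV_nonpos_imp_nonincreasing[OF assms(2)])
  fix x assume "r \<le> x" "x \<le> s"
  then have "((\<lambda>r. (a r)\<^sup>2) has_real_derivative - 2 * x * (a x * b x)) (at x)" "0 \<le> x * (a x * b x)"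
    using ab_nonneg[of x] deriv_a_sq[of x] assms by auto
  then show "\<exists>y. ((\<lambda>r. (a r)\<^sup>2) has_real_derivative y) (at x) \<and> y \<le> 0"
    by (intro exI conjI) auto
qed

text \<open>\<open>a\<close> is positive near 0, so a negative value is preceded by a zero, where
  a^2 is 0 and, being decreasing, stays 0.\<close>

lemma a_nonneg:
  assumes "0 < r" shows "0 \<le> a r"
proof (rule ccontr)
  assume neg: "\<not> 0 \<le> a r"
  obtain \<delta> where \<delta>: "0 < \<delta>" "\<And>r. 0 < r \<Longrightarrow> r < \<delta> \<Longrightarrow> \<bar>a r - D\<bar> < D" using a_near_0[OF D_pos] by blast
  define s where "s = min (\<delta> / 2) r"
  have s: "0 < s" "s \<le> r" "s < \<delta>" using \<delta>(1) assms by (auto simp: s_def)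
  then have "0 \<le> a s" using \<delta>(2)[of s] by auto
  moreover have "continuous_on {s..r} a" using continuous(3) s by (auto elim: continuous_on_subset)
  ultimately have "\<exists>z\<ge>s. z \<le> r \<and> a z = 0" using neg s by (intro IVT2') linarith+
  then obtain z where z: "s \<le> z" "z \<le> r" "a z = 0" by blast
  have "(a r)\<^sup>2 \<le> (a z)\<^sup>2" using z s by (intro a_sq_antimono) linarith+
  then show False using neg z(3) by simp
qed

lemma a_antimono:
  assumes "0 < r" "r \<le> s" shows "a s \<le> a r"
  by (rule power2_le_imp_le[OF a_sq_antimono[OF assms] a_nonneg[OF assms(1)]])

lemma a_le_D:
  assumes "0 < r" shows "a r \<le> D"
proof (rule ccontr)
  assume "\<not> a r \<le> D"
  then have "0 < a r - D" by simp
  then obtain \<delta> where \<delta>: "0 < \<delta>" "\<And>s. 0 < s \<Longrightarrow> s < \<delta> \<Longrightarrow> \<bar>a s - D\<bar> < a r - D" using a_near_0 by blast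
  define s where "s = min (\<delta> / 2) r"
  have s: "0 < s" "s \<le> r" "s < \<delta>" using \<delta>(1) assms by (auto simp: s_def)
  show False using \<delta>(2)[OF s(1,3)] a_antimono[OF s(1,2)] by linarith
qed

lemma b_nonneg:
  assumes "0 < r" shows "0 \<le> b r"
proof (rule ccontr)
  assume "\<not> 0 \<le> b r"
  then have "0 < - (r * b r)" using assms by (auto simp: mult_pos_neg)
  from DERIV_pos_inc_right[OF deriv_a[OF assms] this]
  obtain \<delta> where \<delta>: "0 < \<delta>" "\<And>x. 0 < x \<Longrightarrow> x < \<delta> \<Longrightarrow> a r < a (r + x)" by auto
  have "a r < a (r + \<delta> / 2)" using \<delta>(1) by (intro \<delta>(2)) auto
  moreover have "a (r + \<delta> / 2) \<le> a r" using assms \<open>0 < \<delta>\<close> by (intro a_antimono) linarith+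
  ultimately show False by linarith
qed

lemma b_antimono:
  assumes "0 < r" "r \<le> s" shows "b s \<le> b r"
proof (rule DERIV_nonpos_imp_nonincreasing[OF assms(2)])
  fix x assume x: "r \<le> x" "x \<le> s"
  then have "0 \<le> a x * (f x)\<^sup>2 / x" using a_nonneg[of x] assms by auto
  then show "\<exists>y. (b has_real_derivative y) (at x) \<and> y \<le> 0"
    using deriv_b[of x] x assms by (intro exI conjI) auto
qed

lemma a_decrease_le:
  assumes "0 < r" "r \<le> s" "b r \<le> t" shows "a r - a s \<le> t * (s\<^sup>2 - r\<^sup>2) / 2"
proof -
  have "a r + t / 2 * r\<^sup>2 \<le> a s + t / 2 * s\<^sup>2"
  proof (rule DERIV_nonneg_imp_nondecreasing[OF assms(2)])
    fix x assume x: "r \<le> x" "x \<le> s"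
    have "((\<lambda>r. a r + t / 2 * r\<^sup>2) has_real_derivative - (b x * x) + t * x) (at x)"
      using assms x by (auto intro!: derivative_eq_intros deriv_a simp: mult.commute)
    moreover have "b x * x \<le> t * x" using b_antimono[of r x] x assms by (intro mult_right_mono) auto
    ultimately show "\<exists>y. ((\<lambda>r. a r + t / 2 * r\<^sup>2) has_real_derivative y) (at x) \<and> 0 \<le> y"
      by (intro exI conjI) auto
  qed
  then show ?thesis by (simp add: algebra_simps)
qed

text \<open>As \<open>b\<close> decreases, a' = -r b makes \<open>a\<close> lose at least 3/8 b(1)
  between 1/2 and 1, while \<open>a\<close> takes values in \<open>{0..D}\<close>. The resulting 8/3
  D is rounded up.\<close>

lemma b_1_le: "b 1 \<le> 3 * D"
proof -
  have "a 1 + b 1 / 2 * 1\<^sup>2 \<le> a (1/2) + b 1 / 2 * (1/2)\<^sup>2"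
  proof (rule DERIV_nonpos_imp_nonincreasing[of "1/2" 1])
    fix x :: real assume x: "1/2 \<le> x" "x \<le> 1"
    have "((\<lambda>r. a r + b 1 / 2 * r\<^sup>2) has_real_derivative - (b x * x) + b 1 * x) (at x)"
      using x by (auto intro!: derivative_eq_intros deriv_a simp: mult.commute)
    moreover have "b 1 * x \<le> b x * x" using b_antimono[of x 1] x by (intro mult_right_mono) auto
    ultimately show "\<exists>y. ((\<lambda>r. a r + b 1 / 2 * r\<^sup>2) has_real_derivative y) (at x) \<and> y \<le> 0"
      by (intro exI conjI) auto
  qed auto
  then show ?thesis using a_le_D[of "1/2"] a_nonneg[of 1] D_pos by (auto simp: power2_eq_square)
qed

subsection \<open>Bounds near the origin\<close>

definition C1 :: real where "C1 = 1 / ln 2 + 2 * \<kappa>\<^sup>2"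

text \<open>The equation for \<open>f\<close> tested with \<open>f\<close>, where dyadic averaging
  with W = f^2 replaces boundary values at 0 and 1. The potential contributes q <= 2 \<kappa>^2 r,
  whose integral up to 2 t <= 2 is at most 4 \<kappa>^2. \<open>C1\<close> is half of 2/ln 2 + 4
  \<kappa>^2.\<close>

lemma f_energy_near_0: "bounded_integrals {0<..1} (\<lambda>r. r * (deriv f r)\<^sup>2 + (a r)\<^sup>2 * (f r)\<^sup>2 / r) C1"
proof (rule bounded_integralsI)
  let ?p = "\<lambda>r. 2 * (r * (deriv f r)\<^sup>2 + (a r)\<^sup>2 * (f r)\<^sup>2 / r)"
  let ?q = "\<lambda>r. 2 * \<kappa>\<^sup>2 * r * (1 - h r) * (f r)\<^sup>2"
  fix s t :: real assume st: "0 < s" "s \<le> t" "{s..t} \<subseteq> {0<..1}"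
  have q0: "0 \<le> ?q r" if "0 < r" for r
    using that h_le_1[of r] by auto
  have cont: "continuous_on {0<..} ?p" "continuous_on {0<..} ?q"
    by (intro continuous_intros continuous; simp)+
  have "integral {s..t} ?p \<le> 2 / ln 2 + integral {s / 2..2 * t} ?q"
  proof (rule log_average_bound[where W = "\<lambda>r. (f r)\<^sup>2" and K = "\<lambda>r. 2 * f r * (r * deriv f r)"])
    fix r :: real assume r: "0 < r"
    show "((\<lambda>r. (f r)\<^sup>2) has_real_derivative 2 * f r * (r * deriv f r) / r) (at r)"
      using r by (auto intro!: derivative_eq_intros has_deriv)
    show "((\<lambda>r. 2 * f r * (r * deriv f r)) has_real_derivative ?p r - ?q r) (at r)"
      by (rule derivative_eq_intros has_deriv deriv_rf' refl r)+
        (use r in \<open>auto simp: field_simps power2_eq_square\<close>)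
    show "0 \<le> (f r)\<^sup>2 \<and> (f r)\<^sup>2 \<le> 1" using f_sq_le_1[OF r] by simp
    show "0 \<le> ?p r" using r by auto
  qed (use q0 cont st in auto)
  also have "integral {s / 2..2 * t} ?q \<le> integral {s / 2..2 * t} (\<lambda>r. 2 * \<kappa>\<^sup>2 * r)"
  proof (rule integral_le)
    fix r assume r: "r \<in> {s / 2..2 * t}"
    then have "0 < r" using st by auto
    then have "2 * \<kappa>\<^sup>2 * r * ((1 - h r) * (f r)\<^sup>2) \<le> 2 * \<kappa>\<^sup>2 * r * 1"
      using h_le_1[of r] h_nonneg[of r] f_sq_le_1[of r] by (intro mult_left_mono mult_le_one) auto
    then show "?q r \<le> 2 * \<kappa>\<^sup>2 * r" by (simp add: mult.assoc)
  qed (use st cont in \<open>auto intro!: integrable_Icc_pos continuous_intros\<close>)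
  also have "integral {s / 2..2 * t} (\<lambda>r. 2 * \<kappa>\<^sup>2 * r) = \<kappa>\<^sup>2 * (2 * t)\<^sup>2 - \<kappa>\<^sup>2 * (s / 2)\<^sup>2"
    using st by (intro integral_pos_FTC) (auto intro!: derivative_eq_intros)
  also have "\<dots> \<le> 4 * \<kappa>\<^sup>2"
  proof -
    have "\<kappa>\<^sup>2 * (2 * t)\<^sup>2 \<le> \<kappa>\<^sup>2 * 2\<^sup>2" using st by (intro mult_left_mono power_mono) auto
    moreover have "0 \<le> \<kappa>\<^sup>2 * (s / 2)\<^sup>2" by auto
    moreover have "\<kappa>\<^sup>2 * 2\<^sup>2 = 4 * \<kappa>\<^sup>2" by simp
    ultimately show ?thesis by linarith
  qed
  finally show "integral {s..t} (\<lambda>r. r * (deriv f r)\<^sup>2 + (a r)\<^sup>2 * (f r)\<^sup>2 / r) \<le> C1"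
    unfolding C1_def integral_mult_right by simp
qed (auto intro!: continuous_intros continuous)

definition T :: real where "T = 5 * D + 2 * C1 / D"

text \<open>By b' = -a f^2/r, the integral of a f^2/r over \<open>{s..1}\<close> is t - b(1) with t
  = b(s). Replacing the factor 3/4 D by \<open>a\<close> turns the integrand into a^2 f^2/r, bounded
  by \<open>C1\<close>; the error 3/4 D - a <= t r^2/2 contributes at most t D/4. Against 3/4 D t on
  the left, half of D t survives: D t <= 3/2 D b(1) + 2 C1. The coefficient 5 in \<open>T\<close> is
  9/2 rounded up.\<close>

lemma b_le_T:
  assumes r0: "0 < r0" shows "b r0 \<le> T"
proof -
  have "0 < D / 4" using D_pos by simp
  then obtain \<delta> where \<delta>: "0 < \<delta>" "\<And>s. 0 < s \<Longrightarrow> s < \<delta> \<Longrightarrow> \<bar>a s - D\<bar> < D / 4" using a_near_0 by blast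
  \<comment> \<open>The estimate is made at a point so close to 0 that a(s) > 3/4 D, and
    monotonicity of \<open>b\<close> carries it to \<open>r0\<close>.\<close>
  define s where "s = min (\<delta> / 2) (min r0 1)"
  have s: "0 < s" "s \<le> r0" "s \<le> 1" "s < \<delta>" using \<delta>(1) r0 by (auto simp: s_def)
  define t where "t = b s"
  have t: "0 \<le> t" using b_nonneg s by (simp add: t_def)
  let ?A = "\<lambda>r. a r * (f r)\<^sup>2 / r" and ?B = "\<lambda>r. (a r)\<^sup>2 * (f r)\<^sup>2 / r"
  have int: "?A integrable_on {s..1}" "?B integrable_on {s..1}" "(\<lambda>r. t * D / 2 * r) integrable_on {s..1}"
    using s by (auto intro!: integrable_Icc_pos continuous_intros continuous)
  have "integral {s..1} ?A = (- b 1) - (- b s)"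
    using s by (intro integral_pos_FTC) (auto intro!: derivative_eq_intros deriv_b)
  then have A: "integral {s..1} ?A = t - b 1" by (simp add: t_def)
  have "integral {s..1} ?B \<le> integral {s..1} (\<lambda>r. r * (deriv f r)\<^sup>2 + ?B r)"
    using s by (intro integral_le) (auto intro!: integrable_Icc_pos continuous_intros continuous)
  also have "\<dots> \<le> C1" using s by (intro bounded_integralsD[OF f_energy_near_0]) auto
  finally have B: "integral {s..1} ?B \<le> C1" .
  have "integral {s..1} (\<lambda>r. t * D / 2 * r) = t * D / 4 * 1\<^sup>2 - t * D / 4 * s\<^sup>2"
    using s by (intro integral_pos_FTC) (auto intro!: derivative_eq_intros)
  then have E: "integral {s..1} (\<lambda>r. t * D / 2 * r) \<le> t * D / 4" using t D_pos by simp
  have "integral {s..1} (\<lambda>r. 3 / 4 * D * ?A r) \<le> integral {s..1} (\<lambda>r. ?B r + t * D / 2 * r)"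
  proof (rule integral_le)
    fix r assume r: "r \<in> {s..1}"
    then have r0: "0 < r" using s by auto
    have "a s - a r \<le> t * (r\<^sup>2 - s\<^sup>2) / 2" using a_decrease_le[of s r t] s r by (auto simp: t_def)
    also have "\<dots> \<le> t * r\<^sup>2 / 2" using t by (simp add: mult_left_mono)
    finally have "3 / 4 * D - a r \<le> t * r\<^sup>2 / 2" using \<delta>(2)[OF s(1,4)] by linarith
    then have "(3 / 4 * D - a r) * (a r * (f r)\<^sup>2 / r) \<le> (t * r\<^sup>2 / 2) * (a r * (f r)\<^sup>2 / r)"
      using a_nonneg[OF r0] r0 by (intro mult_right_mono) auto
    also have "\<dots> = t * r / 2 * (a r * (f r)\<^sup>2)" using r0 by (simp add: power2_eq_square)
    also have "\<dots> \<le> t * r / 2 * (D * 1)"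
      using a_nonneg[OF r0] a_le_D[OF r0] f_sq_le_1[OF r0] D_pos t r0 by (intro mult_left_mono mult_mono) auto
    also have "(3 / 4 * D - a r) * (a r * (f r)\<^sup>2 / r) = 3 / 4 * D * ?A r - ?B r"
      using r0 by (simp add: field_simps power2_eq_square)
    also have "t * r / 2 * (D * 1) = t * D / 2 * r" by simp
    finally show "3 / 4 * D * ?A r \<le> ?B r + t * D / 2 * r" by simp
  qed (use int s in \<open>auto intro!: integrable_Icc_pos continuous_intros continuous\<close>)
  also have "\<dots> = integral {s..1} ?B + integral {s..1} (\<lambda>r. t * D / 2 * r)"
    using int by (intro integral_add) auto
  also have "integral {s..1} (\<lambda>r. 3 / 4 * D * ?A r) = 3 / 4 * D * (t - b 1)"
    unfolding integral_mult_right A ..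
  finally have "3 / 4 * D * (t - b 1) \<le> C1 + t * D / 4" using B E by linarith
  then have "D * t \<le> D * (3 / 2 * b 1) + 2 * C1" by (simp add: algebra_simps)
  also have "\<dots> \<le> D * (3 / 2 * (3 * D)) + 2 * C1" using b_1_le D_pos by auto
  also have "\<dots> \<le> D * T" using D_pos by (simp add: T_def field_simps)
  finally have "t \<le> T" using D_pos by simp
  then show ?thesis using b_antimono[of s r0] s by (simp add: t_def)
qed

lemma T_pos: "0 < T"
  unfolding T_def C1_def using D_pos by (intro add_pos_nonneg) auto

text \<open>The bound of \<open>a_decrease_le\<close> with left endpoint tending to 0, where
  \<open>a\<close> tends to \<open>D\<close>. The quadratic vanishing of \<open>S\<close> that
  results makes (S - St)/r square integrable against dr/r near 0.\<close>

lemma D_minus_a_le: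
  assumes r: "0 < r" shows "D - a r \<le> T / 2 * r\<^sup>2"
proof (rule ccontr)
  assume "\<not> D - a r \<le> T / 2 * r\<^sup>2"
  then have "0 < D - a r - T / 2 * r\<^sup>2" by simp
  then obtain \<delta> where \<delta>: "0 < \<delta>" "\<And>s. 0 < s \<Longrightarrow> s < \<delta> \<Longrightarrow> \<bar>a s - D\<bar> < D - a r - T / 2 * r\<^sup>2" using a_near_0 by blast
  define s where "s = min (\<delta> / 2) r"
  have s: "0 < s" "s \<le> r" "s < \<delta>" using \<delta>(1) r by (auto simp: s_def)
  have "a s - a r \<le> T * (r\<^sup>2 - s\<^sup>2) / 2" using a_decrease_le[of s r T] b_le_T s by auto
  also have "\<dots> \<le> T / 2 * r\<^sup>2" using T_pos by (simp add: algebra_simps)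
  finally show False using \<delta>(2)[OF s(1,3)] by linarith
qed

lemma S_sq_le:
  assumes "0 < r" shows "(S r)\<^sup>2 \<le> (T / 2 * r\<^sup>2)\<^sup>2"
  using D_minus_a_le[OF assms] a_le_D[OF assms]
  by (subst S_eq) (auto simp: power_mult_distrib[of "sgn _"] sgn_sq intro!: power_mono)

subsection \<open>Global bounds\<close>

text \<open>The integrand is the derivative of -a b. The boundary term at \<open>t\<close> has a
  favourable sign, and in the one at \<open>s\<close> the bound \<open>T\<close> stands for
  b(0).\<close>

lemma magnetic_bound: "bounded_integrals {0<..} (\<lambda>r. r * (b r)\<^sup>2 + (a r)\<^sup>2 * (f r)\<^sup>2 / r) (D * T)"
proof (rule bounded_integralsI)
  fix s t :: real assume st: "0 < s" "s \<le> t"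
  have "integral {s..t} (\<lambda>r. r * (b r)\<^sup>2 + (a r)\<^sup>2 * (f r)\<^sup>2 / r) = (- (a t * b t)) - (- (a s * b s))"
    proof (rule integral_pos_FTC)
    show "((\<lambda>r. - (a r * b r)) has_real_derivative r * (b r)\<^sup>2 + (a r)\<^sup>2 * (f r)\<^sup>2 / r) (at r)" if "0 < r" for r
      using DERIV_minus[OF deriv_ab[OF that]] by (simp only: minus_minus)
  qed (use st in auto)
  also have "\<dots> \<le> a s * b s" using ab_nonneg[of t] st by auto
  also have "\<dots> \<le> D * T" using a_le_D b_le_T b_nonneg D_pos st by (intro mult_mono) auto
  finally show "integral {s..t} (\<lambda>r. r * (b r)\<^sup>2 + (a r)\<^sup>2 * (f r)\<^sup>2 / r) \<le> D * T" .
qed (auto intro!: continuous_intros continuous)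

text \<open>Integrating $P'$ gives Pohozaev's identity: $|P| \<le> r^2 e$ tends to $0$ along suitable sequences
  tending to $0$ and to infinity because the energy is finite.\<close>

definition P :: "real \<Rightarrow> real" where
  "P r = ((r * deriv f r)\<^sup>2 + (r * deriv m r)\<^sup>2 + r\<^sup>2 * (b r)\<^sup>2 - (a r)\<^sup>2 * (f r)\<^sup>2
     - \<kappa>\<^sup>2 * g * r\<^sup>2 * (m r)\<^sup>2 - \<kappa>\<^sup>2 / 2 * r\<^sup>2 * (1 - h r)\<^sup>2) / 2"

text \<open>The terms with f' or m' and the products a b f^2 cancel by the equations. What remains
  comes from differentiating the explicit weights r^2, the effect of a dilation.\<close>

lemma deriv_P:
  assumes "0 < r"
  shows "(P has_real_derivative r * (b r)\<^sup>2 - (\<kappa>\<^sup>2 * g * r * (m r)\<^sup>2 + \<kappa>\<^sup>2 / 2 * r * (1 - h r)\<^sup>2)) (at r)"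
  unfolding P_def[abs_def]
  by (rule derivative_eq_intros has_deriv deriv_rf' deriv_rm' deriv_a deriv_b deriv_h refl assms)+
    (use assms in \<open>auto simp: N_def field_simps power2_eq_square\<close>)

lemma P_le:
  assumes "0 < r" shows "\<bar>P r\<bar> \<le> r\<^sup>2 * e r"
proof -
  have "0 \<le> \<kappa>\<^sup>2 * g * r\<^sup>2 * (m r)\<^sup>2" "0 \<le> \<kappa>\<^sup>2 / 2 * r\<^sup>2 * (1 - h r)\<^sup>2" "0 \<le> (a r)\<^sup>2 * (f r)\<^sup>2"
    "0 \<le> (r * deriv f r)\<^sup>2" "0 \<le> (r * deriv m r)\<^sup>2" "0 \<le> r\<^sup>2 * (b r)\<^sup>2" using g_pos by auto
  moreover have "2 * (r\<^sup>2 * e r) = (r * deriv f r)\<^sup>2 + (r * deriv m r)\<^sup>2 + r\<^sup>2 * (b r)\<^sup>2 + (a r)\<^sup>2 * (f r)\<^sup>2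
     + \<kappa>\<^sup>2 * g * r\<^sup>2 * (m r)\<^sup>2 + \<kappa>\<^sup>2 / 2 * r\<^sup>2 * (1 - h r)\<^sup>2"
    using assms by (simp add: e_def field_simps)
  moreover have "2 * P r = (r * deriv f r)\<^sup>2 + (r * deriv m r)\<^sup>2 + r\<^sup>2 * (b r)\<^sup>2 - (a r)\<^sup>2 * (f r)\<^sup>2
     - \<kappa>\<^sup>2 * g * r\<^sup>2 * (m r)\<^sup>2 - \<kappa>\<^sup>2 / 2 * r\<^sup>2 * (1 - h r)\<^sup>2" by (simp add: P_def)
  ultimately show ?thesis by linarith
qed

lemma potential_bound:
  "bounded_integrals {0<..} (\<lambda>r. \<kappa>\<^sup>2 * g * r * (m r)\<^sup>2 + \<kappa>\<^sup>2 / 2 * r * (1 - h r)\<^sup>2) (D * T + 2)"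
proof (rule bounded_integralsI)
  let ?V = "\<lambda>r. \<kappa>\<^sup>2 * g * r * (m r)\<^sup>2 + \<kappa>\<^sup>2 / 2 * r * (1 - h r)\<^sup>2"
  have V0: "0 \<le> ?V r" if "0 < r" for r using that g_pos by auto
  then show "0 \<le> ?V r" if "0 < r" for r using that by auto
  show contV: "continuous_on {0<..} ?V" by (intro continuous_intros continuous)
  fix s t :: real assume st: "0 < s" "s \<le> t"
  \<comment> \<open>Choosing \<epsilon> = 1 at both ends gives r^2 e(r) < 1 there, so the two
    boundary values of \<open>P\<close> are below 1 in modulus. This is the summand 2 of the
    bound.\<close>
  obtain s' where s': "0 < s'" "s' \<le> s" "e s' * s' < 1 / s'"
    using not_dominates_inverse_at_0[OF energy_finite, of 1 s] st by auto
  obtain t' where t': "t \<le> t'" "e t' * t' < 1 / t'"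
    using not_dominates_inverse_at_top[OF energy_finite, of 1 t] st by auto
  have "integral {s..t} ?V \<le> integral {s'..t'} ?V"
    using s' t' contV V0 by (intro integral_mono_interval) auto
  also have "\<dots> = integral {s'..t'} (\<lambda>r. r * (b r)\<^sup>2) - (P t' - P s')"
  proof -
    have "integral {s'..t'} (\<lambda>r. r * (b r)\<^sup>2 - ?V r) = P t' - P s'"
      using s' t' st by (intro integral_pos_FTC deriv_P) auto
    moreover have "integral {s'..t'} (\<lambda>r. r * (b r)\<^sup>2 - ?V r) = integral {s'..t'} (\<lambda>r. r * (b r)\<^sup>2) - integral {s'..t'} ?V"
      using s' contV by (intro integral_diff integrable_Icc_pos continuous_intros continuous) auto
    ultimately show ?thesis by linarith
  qed
  also have "integral {s'..t'} (\<lambda>r. r * (b r)\<^sup>2) \<le> D * T"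
  proof -
    have "integral {s'..t'} (\<lambda>r. r * (b r)\<^sup>2) \<le> integral {s'..t'} (\<lambda>r. r * (b r)\<^sup>2 + (a r)\<^sup>2 * (f r)\<^sup>2 / r)"
      using s' by (intro integral_le integrable_Icc_pos continuous_intros continuous) auto
    also have "\<dots> \<le> D * T" using s' t' st by (intro bounded_integralsD[OF magnetic_bound]) auto
    finally show ?thesis .
  qed
  finally have "integral {s..t} ?V \<le> D * T - (P t' - P s')" by simp
  moreover have "\<bar>P s'\<bar> < 1" using P_le[of s'] s' by (simp add: field_simps power2_eq_square)
  moreover have "\<bar>P t'\<bar> < 1" using P_le[of t'] t' st by (simp add: field_simps power2_eq_square)
  ultimately show "integral {s..t} ?V \<le> D * T + 2" by linarith
qed

text \<open>Bounds for the integrals of m^2 r (\<open>M0\<close>), (1 - h)^2 r (\<open>H0\<close>),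
  (m')^2 r (\<open>M1\<close>), a^2/r from 1/2 on (\<open>A1\<close>), (f')^2 r (\<open>F1\<close>)
  and f^2/r up to 1 (\<open>F0\<close>). In \<open>M0\<close> the lower bound \<open>g0\<close>
  stands for \<open>g\<close>.\<close>

definition M0 :: real where "M0 = (D * T + 2) / (\<kappa>\<^sup>2 * g0)"
definition H0 :: real where "H0 = 2 * (D * T + 2) / \<kappa>\<^sup>2"
definition M1 :: real where "M1 = 1 / ln 2 + \<kappa>\<^sup>2 * M0"
definition A1 :: real where "A1 = 4 / 3 * (D * T) + 16 / 3 * D\<^sup>2 * (M0 + H0)"
definition F1 :: real where "F1 = C1 + (1 / ln 2 + A1)"
definition F0 :: real where "F0 = 2 / D\<^sup>2 * C1 + T / D"

lemma m_bound: "bounded_integrals {0<..} (\<lambda>r. (m r)\<^sup>2 * r) M0"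
proof -
  have "bounded_integrals {0<..} (\<lambda>r. 1 / (\<kappa>\<^sup>2 * g0) * (\<kappa>\<^sup>2 * g * r * (m r)\<^sup>2 + \<kappa>\<^sup>2 / 2 * r * (1 - h r)\<^sup>2)) (1 / (\<kappa>\<^sup>2 * g0) * (D * T + 2))"
    using g0_pos by (intro bounded_integrals_cmult potential_bound) auto
  then show ?thesis
  proof (rule bounded_integrals_mono)
    fix r :: real assume r: "0 < r"
    have "\<kappa>\<^sup>2 * r * (m r)\<^sup>2 * g0 \<le> \<kappa>\<^sup>2 * r * (m r)\<^sup>2 * g" using r g_ge by (intro mult_left_mono) auto
    moreover have "0 \<le> \<kappa>\<^sup>2 / 2 * r * (1 - h r)\<^sup>2" using r by auto
    ultimately have "\<kappa>\<^sup>2 * g0 * ((m r)\<^sup>2 * r) \<le> \<kappa>\<^sup>2 * g * r * (m r)\<^sup>2 + \<kappa>\<^sup>2 / 2 * r * (1 - h r)\<^sup>2"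
      by (simp add: mult_ac)
    then show "(m r)\<^sup>2 * r \<le> 1 / (\<kappa>\<^sup>2 * g0) * (\<kappa>\<^sup>2 * g * r * (m r)\<^sup>2 + \<kappa>\<^sup>2 / 2 * r * (1 - h r)\<^sup>2)"
      using g0_pos \<kappa>_pos by (simp add: pos_le_divide_eq mult.commute)
  qed (auto intro!: continuous_intros continuous simp: M0_def)
qed

lemma h_bound: "bounded_integrals {0<..} (\<lambda>r. (1 - h r)\<^sup>2 * r) H0"
proof -
  have "bounded_integrals {0<..} (\<lambda>r. 2 / \<kappa>\<^sup>2 * (\<kappa>\<^sup>2 * g * r * (m r)\<^sup>2 + \<kappa>\<^sup>2 / 2 * r * (1 - h r)\<^sup>2)) (2 / \<kappa>\<^sup>2 * (D * T + 2))"
    using g0_pos by (intro bounded_integrals_cmult potential_bound) auto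
  then show ?thesis
  proof (rule bounded_integrals_mono)
    fix r :: real assume r: "0 < r"
    have "0 \<le> \<kappa>\<^sup>2 * g * r * (m r)\<^sup>2" using r g_pos by auto
    then have "\<kappa>\<^sup>2 / 2 * ((1 - h r)\<^sup>2 * r) \<le> \<kappa>\<^sup>2 * g * r * (m r)\<^sup>2 + \<kappa>\<^sup>2 / 2 * r * (1 - h r)\<^sup>2"
      by (simp add: mult_ac)
    then show "(1 - h r)\<^sup>2 * r \<le> 2 / \<kappa>\<^sup>2 * (\<kappa>\<^sup>2 * g * r * (m r)\<^sup>2 + \<kappa>\<^sup>2 / 2 * r * (1 - h r)\<^sup>2)"
      using \<kappa>_pos by (simp add: pos_le_divide_eq mult.commute)
  qed (auto intro!: continuous_intros continuous simp: H0_def)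
qed

text \<open>Dyadic averaging with W = m^2: what falls to \<open>q\<close> is at most 2 \<kappa>^2
  m^2 r, already controlled by \<open>M0\<close>.\<close>

lemma m'_bound: "bounded_integrals {0<..} (\<lambda>r. (deriv m r)\<^sup>2 * r) M1"
proof (rule bounded_integralsI)
  let ?p = "\<lambda>r. 2 * (r * (deriv m r)\<^sup>2 + \<kappa>\<^sup>2 * g * r * (m r)\<^sup>2)"
  let ?q = "\<lambda>r. 2 * \<kappa>\<^sup>2 * r * (1 - h r) * (m r)\<^sup>2"
  fix s t :: real assume st: "0 < s" "s \<le> t"
  have q0: "0 \<le> ?q r" if "0 < r" for r
    using that h_le_1[of r] by auto
  have cont: "continuous_on {0<..} ?p" "continuous_on {0<..} ?q"
    by (intro continuous_intros continuous; simp)+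
  have "integral {s..t} (\<lambda>r. 2 * ((deriv m r)\<^sup>2 * r)) \<le> integral {s..t} ?p"
    using st cont g_pos by (intro integral_le integrable_Icc_pos continuous_intros continuous) auto
  also have "\<dots> \<le> 2 / ln 2 + integral {s / 2..2 * t} ?q"
  proof (rule log_average_bound[where W = "\<lambda>r. (m r)\<^sup>2" and K = "\<lambda>r. 2 * m r * (r * deriv m r)"])
    fix r :: real assume r: "0 < r"
    show "((\<lambda>r. (m r)\<^sup>2) has_real_derivative 2 * m r * (r * deriv m r) / r) (at r)"
      using r by (auto intro!: derivative_eq_intros has_deriv)
    show "((\<lambda>r. 2 * m r * (r * deriv m r)) has_real_derivative ?p r - ?q r) (at r)"
      by (rule derivative_eq_intros has_deriv deriv_rm' refl r)+
        (use r in \<open>auto simp: field_simps power2_eq_square\<close>)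
    show "0 \<le> (m r)\<^sup>2 \<and> (m r)\<^sup>2 \<le> 1" using m_sq_le_1[OF r] by simp
    show "0 \<le> ?p r" using r g_pos by auto
  qed (use q0 cont st in auto)
  also have "integral {s / 2..2 * t} ?q \<le> integral {s / 2..2 * t} (\<lambda>r. 2 * \<kappa>\<^sup>2 * ((m r)\<^sup>2 * r))"
  proof (rule integral_le)
    fix r assume r: "r \<in> {s / 2..2 * t}"
    then have "0 < r" using st by auto
    then have "2 * \<kappa>\<^sup>2 * ((m r)\<^sup>2 * r) * (1 - h r) \<le> 2 * \<kappa>\<^sup>2 * ((m r)\<^sup>2 * r) * 1"
      using h_nonneg[of r] by (intro mult_left_mono) auto
    then show "?q r \<le> 2 * \<kappa>\<^sup>2 * ((m r)\<^sup>2 * r)" by (simp add: mult_ac)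
  qed (use st cont in \<open>auto intro!: integrable_Icc_pos continuous_intros continuous\<close>)
  also have "\<dots> \<le> 2 * \<kappa>\<^sup>2 * M0"
    unfolding integral_mult_right using st by (intro mult_left_mono bounded_integralsD[OF m_bound]) auto
  finally show "integral {s..t} (\<lambda>r. (deriv m r)\<^sup>2 * r) \<le> M1"
    by (simp add: M1_def)
qed (auto intro!: continuous_intros continuous)

text \<open>\<open>mass_bound\<close> splits a^2/r: the share of f^2 is magnetic, the rest is at
  most (m^2 + (1 - h)^2) 4 D^2 r, by a <= D and 1/r <= 4 r. The range starts at 1/2 because dyadic
  averaging over intervals in \<open>{1..}\<close> reaches down to s/2.\<close>

lemma a_bound: "bounded_integrals {1/2..} (\<lambda>r. (a r)\<^sup>2 / r) A1"
proof -
  have "bounded_integrals {0<..} (\<lambda>r. 4 / 3 * (r * (b r)\<^sup>2 + (a r)\<^sup>2 * (f r)\<^sup>2 / r)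
      + 16 / 3 * D\<^sup>2 * ((m r)\<^sup>2 * r + (1 - h r)\<^sup>2 * r)) A1"
    unfolding A1_def
    by (intro bounded_integrals_add bounded_integrals_cmult magnetic_bound m_bound h_bound) auto
  then show ?thesis
  proof (rule bounded_integrals_mono)
    fix r :: real assume r: "0 < r" "r \<in> {1/2..}"
    have "1 * ((a r)\<^sup>2 / r) \<le> 4 / 3 * ((f r)\<^sup>2 + ((m r)\<^sup>2 + (1 - h r)\<^sup>2)) * ((a r)\<^sup>2 / r)"
      using mass_bound[of r] r by (intro mult_right_mono) (simp_all add: field_simps)
    also have "\<dots> = 4 / 3 * ((a r)\<^sup>2 * (f r)\<^sup>2 / r) + 4 / 3 * (((m r)\<^sup>2 + (1 - h r)\<^sup>2) * ((a r)\<^sup>2 / r))"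
      by (simp only: distrib_left distrib_right times_divide_eq_right times_divide_eq_left add_divide_distrib mult.assoc mult.commute[of "(a r)\<^sup>2"])
    also have "((m r)\<^sup>2 + (1 - h r)\<^sup>2) * ((a r)\<^sup>2 / r) \<le> ((m r)\<^sup>2 + (1 - h r)\<^sup>2) * (4 * D\<^sup>2 * r)"
    proof (rule mult_left_mono)
      have "(1/2)\<^sup>2 \<le> r\<^sup>2" using r by (intro power_mono) auto
      then have "1 \<le> 4 * r * r" by (simp add: power2_eq_square)
      moreover have "(a r)\<^sup>2 \<le> D\<^sup>2" using a_le_D a_nonneg r by (intro power_mono) auto
      ultimately have "(a r)\<^sup>2 * 1 \<le> D\<^sup>2 * (4 * r * r)" by (intro mult_mono) auto
      then show "(a r)\<^sup>2 / r \<le> 4 * D\<^sup>2 * r" using r by (simp add: field_simps)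
    qed simp
    finally have "1 * ((a r)\<^sup>2 / r) \<le> 4 / 3 * ((a r)\<^sup>2 * (f r)\<^sup>2 / r) + 16 / 3 * D\<^sup>2 * ((m r)\<^sup>2 * r + (1 - h r)\<^sup>2 * r)"
      by (simp add: algebra_simps)
    moreover have "0 \<le> 4 / 3 * (r * (b r)\<^sup>2)" using r by simp
    ultimately show "(a r)\<^sup>2 / r \<le> 4 / 3 * (r * (b r)\<^sup>2 + (a r)\<^sup>2 * (f r)\<^sup>2 / r)
      + 16 / 3 * D\<^sup>2 * ((m r)\<^sup>2 * r + (1 - h r)\<^sup>2 * r)" by (simp add: distrib_left)
  qed (auto intro!: continuous_intros continuous)
qed

text \<open>With W = (1 - f)^2 the potential term joins \<open>p\<close> with the good sign and
  leaves q <= 2 a^2/r. With W = f^2 it would stay in \<open>q\<close> as a multiple of (1 - h) f^2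
  r, whereas only (1 - h)^2 r is controlled.\<close>

lemma f'_bound_at_top: "bounded_integrals {1..} (\<lambda>r. (deriv f r)\<^sup>2 * r) (1 / ln 2 + A1)"
proof (rule bounded_integralsI)
  let ?p = "\<lambda>r. 2 * (r * (deriv f r)\<^sup>2 + \<kappa>\<^sup>2 * r * (1 - h r) * (f r * (1 - f r)))"
  let ?q = "\<lambda>r. 2 * (f r * (1 - f r)) * (a r)\<^sup>2 / r"
  fix s t :: real assume st0: "0 < s" "s \<le> t" "{s..t} \<subseteq> {1..}"
  then have st: "0 < s" "s \<le> t" "1 \<le> s" by auto
  have ff: "0 \<le> f r * (1 - f r)" "f r * (1 - f r) \<le> 1" if "0 < r" for r
    using that f_nonneg[of r] f_le_1[of r] by (auto intro!: mult_le_one)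
  have p0: "0 \<le> \<kappa>\<^sup>2 * r * (1 - h r) * (f r * (1 - f r))" if "0 < r" for r
    using that ff[of r] h_le_1[of r] by (intro mult_nonneg_nonneg[of _ "f r * (1 - f r)"]) auto
  have q0: "0 \<le> ?q r" if "0 < r" for r
    using that ff[of r] by (intro divide_nonneg_pos mult_nonneg_nonneg[of _ "(a r)\<^sup>2"]) auto
  have cont: "continuous_on {0<..} ?p" "continuous_on {0<..} ?q"
    by (intro continuous_intros continuous; simp)+
  have "integral {s..t} (\<lambda>r. 2 * ((deriv f r)\<^sup>2 * r)) \<le> integral {s..t} ?p"
    using st cont p0 by (intro integral_le integrable_Icc_pos continuous_intros continuous) (auto simp: mult.commute)
  also have "\<dots> \<le> 2 / ln 2 + integral {s / 2..2 * t} ?q"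
  proof (rule log_average_bound[where W = "\<lambda>r. (1 - f r)\<^sup>2" and K = "\<lambda>r. - (2 * (1 - f r) * (r * deriv f r))"])
    fix r :: real assume r: "0 < r"
    show "((\<lambda>r. (1 - f r)\<^sup>2) has_real_derivative - (2 * (1 - f r) * (r * deriv f r)) / r) (at r)"
      using r by (auto intro!: derivative_eq_intros has_deriv)
    show "((\<lambda>r. - (2 * (1 - f r) * (r * deriv f r))) has_real_derivative ?p r - ?q r) (at r)"
      by (rule derivative_eq_intros has_deriv deriv_rf' refl r)+
        (use r in \<open>auto simp: field_simps power2_eq_square\<close>)
    show "0 \<le> (1 - f r)\<^sup>2 \<and> (1 - f r)\<^sup>2 \<le> 1" using f_le_1[OF r] f_nonneg[of r] r by (auto simp: power_le_one)
    show "0 \<le> ?p r" using r p0[OF r] by auto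
  qed (use q0 cont st in auto)
  also have "integral {s / 2..2 * t} ?q \<le> integral {s / 2..2 * t} (\<lambda>r. 2 * ((a r)\<^sup>2 / r))"
  proof (rule integral_le)
    fix r assume r: "r \<in> {s / 2..2 * t}"
    then have r0: "0 < r" using st by auto
    then have "2 * ((a r)\<^sup>2 / r) * (f r * (1 - f r)) \<le> 2 * ((a r)\<^sup>2 / r) * 1"
      using ff[of r] by (intro mult_left_mono) auto
    then have "2 * ((a r)\<^sup>2 / r) * (f r * (1 - f r)) \<le> 2 * ((a r)\<^sup>2 / r)" by simp
    also have "2 * ((a r)\<^sup>2 / r) * (f r * (1 - f r)) = ?q r" by simp
    finally show "?q r \<le> 2 * ((a r)\<^sup>2 / r)" .
  qed (use st cont in \<open>auto intro!: integrable_Icc_pos continuous_intros continuous\<close>)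
  also have "\<dots> = 2 * integral {s / 2..2 * t} (\<lambda>r. (a r)\<^sup>2 / r)" by (rule integral_mult_right)
  also have "\<dots> \<le> 2 * A1"
    using st by (intro mult_left_mono bounded_integralsD[OF a_bound]) (auto simp: subset_eq)
  finally show "integral {s..t} (\<lambda>r. (deriv f r)\<^sup>2 * r) \<le> 1 / ln 2 + A1"
    by simp
qed (auto intro!: continuous_intros continuous)

lemma f'_bound: "bounded_integrals {0<..} (\<lambda>r. (deriv f r)\<^sup>2 * r) F1"
  unfolding F1_def
proof (rule bounded_integrals_split[OF _ f'_bound_at_top])
  show "bounded_integrals {0<..1} (\<lambda>r. (deriv f r)\<^sup>2 * r) C1"
    by (rule bounded_integrals_mono[OF f_energy_near_0]) (auto intro!: continuous_intros continuous)
qed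

text \<open>For values of \<open>f\<close> in the unit interval, 1 - f <= 1 - f^2 = (1 - h) + m^2,
  and m^4 <= m^2.\<close>

lemma one_minus_f_bound: "bounded_integrals {0<..} (\<lambda>r. (1 - f r)\<^sup>2 * r) (2 * H0 + 2 * M0)"
proof (rule bounded_integrals_mono)
  show "bounded_integrals {0<..} (\<lambda>r. 2 * ((1 - h r)\<^sup>2 * r) + 2 * ((m r)\<^sup>2 * r)) (2 * H0 + 2 * M0)"
    by (intro bounded_integrals_add bounded_integrals_cmult h_bound m_bound) auto
  fix r :: real assume r: "0 < r"
  have f01: "0 \<le> f r" "f r \<le> 1" using r f_nonneg f_le_1 by auto
  then have "(f r)\<^sup>2 \<le> f r * 1" unfolding power2_eq_square by (intro mult_left_mono) auto
  then have "1 - f r \<le> 1 - (f r)\<^sup>2" by simp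
  then have "(1 - f r)\<^sup>2 \<le> (1 - (f r)\<^sup>2)\<^sup>2" using f01 by (intro power_mono) auto
  also have "1 - (f r)\<^sup>2 = (1 - h r) + (m r)\<^sup>2" by (simp add: h_def)
  also have "((1 - h r) + (m r)\<^sup>2)\<^sup>2 \<le> 2 * (1 - h r)\<^sup>2 + 2 * ((m r)\<^sup>2)\<^sup>2"
    using zero_le_power2[of "(1 - h r) - (m r)\<^sup>2"] by (simp add: power2_eq_square algebra_simps)
  also have "((m r)\<^sup>2)\<^sup>2 \<le> (m r)\<^sup>2 * 1"
    unfolding power2_eq_square[of "(m r)\<^sup>2"] using m_sq_le_1[OF r] by (intro mult_left_mono) auto
  finally have "(1 - f r)\<^sup>2 \<le> 2 * (1 - h r)\<^sup>2 + 2 * (m r)\<^sup>2" by simp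
  then have "(1 - f r)\<^sup>2 * r \<le> (2 * (1 - h r)\<^sup>2 + 2 * (m r)\<^sup>2) * r" using r by (intro mult_right_mono) auto
  then show "(1 - f r)\<^sup>2 * r \<le> 2 * ((1 - h r)\<^sup>2 * r) + 2 * ((m r)\<^sup>2 * r)" by (simp add: distrib_right)
qed (auto intro!: continuous_intros continuous)

text \<open>Removes the weight a^2 from the energy near 0: D^2 <= 2 a^2 + 2 (D - a)^2, and the
  factor r^2 in the bound for (D - a)^2 cancels the singularity.\<close>

lemma f_bound_near_0: "bounded_integrals {0<..1} (\<lambda>r. (f r)\<^sup>2 / r) F0"
proof (rule bounded_integrals_mono)
  show "bounded_integrals {0<..1} (\<lambda>r. 2 / D\<^sup>2 * (r * (deriv f r)\<^sup>2 + (a r)\<^sup>2 * (f r)\<^sup>2 / r) + T / D * r) F0"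
    unfolding F0_def using D_pos T_pos
    by (intro bounded_integrals_add bounded_integrals_cmult f_energy_near_0 bounded_integrals_linear) auto
  fix r :: real assume r: "0 < r"
  have "D\<^sup>2 \<le> 2 * (a r)\<^sup>2 + 2 * (D - a r)\<^sup>2"
    using zero_le_power2[of "a r - (D - a r)"] by (simp add: power2_eq_square algebra_simps)
  also have "(D - a r)\<^sup>2 \<le> D * (T / 2 * r\<^sup>2)"
    unfolding power2_eq_square[of "D - a r"]
    using D_minus_a_le[OF r] a_le_D[OF r] a_nonneg[OF r] D_pos by (intro mult_mono) auto
  finally have "D\<^sup>2 \<le> 2 * (a r)\<^sup>2 + D * T * r\<^sup>2" by simp
  then have "D\<^sup>2 * ((f r)\<^sup>2 / r) \<le> (2 * (a r)\<^sup>2 + D * T * r\<^sup>2) * ((f r)\<^sup>2 / r)"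
    using r by (intro mult_right_mono) auto
  also have "\<dots> = 2 * ((a r)\<^sup>2 * (f r)\<^sup>2 / r) + D * T * r * (f r)\<^sup>2"
    using r by (simp add: field_simps power2_eq_square)
  also have "D * T * r * (f r)\<^sup>2 \<le> D * T * r * 1"
    using f_sq_le_1[OF r] D_pos T_pos r by (intro mult_left_mono) auto
  finally have "(f r)\<^sup>2 / r \<le> (2 * ((a r)\<^sup>2 * (f r)\<^sup>2 / r) + D * T * r * 1) / D\<^sup>2"
    using D_pos by (subst pos_le_divide_eq) (auto simp: mult.commute)
  also have "\<dots> = 2 / D\<^sup>2 * ((a r)\<^sup>2 * (f r)\<^sup>2 / r) + T / D * r"
    using D_pos by (simp add: field_simps power2_eq_square)
  also have "\<dots> \<le> 2 / D\<^sup>2 * (r * (deriv f r)\<^sup>2 + (a r)\<^sup>2 * (f r)\<^sup>2 / r) + T / D * r"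
    using r by (intro add_right_mono mult_left_mono) auto
  finally show "(f r)\<^sup>2 / r \<le> 2 / D\<^sup>2 * (r * (deriv f r)\<^sup>2 + (a r)\<^sup>2 * (f r)\<^sup>2 / r) + T / D * r" .
qed (auto intro!: continuous_intros continuous)

lemma S'_bound: "bounded_integrals {0<..} (\<lambda>r. (deriv S r)\<^sup>2 / r) (D * T)"
proof (rule bounded_integrals_mono[OF magnetic_bound])
  have *: "(deriv S r)\<^sup>2 / r = r * (b r)\<^sup>2" if "0 < r" for r
    using that by (simp add: S'_eq power_mult_distrib sgn_sq) (simp add: power2_eq_square)
  show "continuous_on {0<..} (\<lambda>r. (deriv S r)\<^sup>2 / r)"
    by (rule continuous_on_eq[of _ "\<lambda>r. r * (b r)\<^sup>2"]) (auto simp: * intro!: continuous_intros continuous)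
  show "(deriv S r)\<^sup>2 / r \<le> r * (b r)\<^sup>2 + (a r)\<^sup>2 * (f r)\<^sup>2 / r" if "0 < r" for r
    using that by (simp add: *)
qed auto

end

section \<open>From integral bounds to the spaces H and X and their norms\<close>

lemma radial_norm_integral:
  fixes u u' :: "real \<Rightarrow> real" and Q :: "real \<Rightarrow> real \<Rightarrow> real"
  assumes u: "\<And>r. 0 < r \<Longrightarrow> (u has_real_derivative u' r) (at r)" "continuous_on {0<..} u'"
    and p: "bounded_integrals {0<..} p C" and Q: "\<And>r. 0 < r \<Longrightarrow> Q (u' r) r * r = p r"
  shows "(sqrt (rdr_integral (\<lambda>r. Q (radial_deriv u r) r)))\<^sup>2 \<le> C"
proof -
  have int: "integrable lebesgue (\<lambda>r. indicator {0<..} r *\<^sub>R p r)"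
    using bounded_integrals_LINT(1)[OF p] by (simp add: set_integrable_def)
  \<comment> \<open>\<open>radial_deriv u\<close> agrees with \<open>u'\<close> only almost
    everywhere. \<open>Q\<close> isolates its slot in the integrand, so that one argument serves
    both norms.\<close>
  have eq: "AE r in lebesgue. indicator {0<..} r *\<^sub>R p r = indicator {0<..} r *\<^sub>R (Q (radial_deriv u r) r * r)"
  proof -
    have "AE r in lebesgue. 0 < r \<longrightarrow> radial_deriv u r = u' r" using u by (rule radial_deriv_eq)
    then show ?thesis by eventually_elim (auto simp: indicator_def Q)
  qed
  have "rdr_integral (\<lambda>r. Q (radial_deriv u r) r) = (LINT r:{0<..}|lebesgue. p r)"
    unfolding rdr_integral_def set_lebesgue_integral_def
    using borel_measurable_integrable[OF int] borel_measurable_AE[OF borel_measurable_integrable[OF int] eq] eq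
    by (intro integral_cong_AE) auto
  moreover have "(LINT r:{0<..}|lebesgue. p r) \<le> C" by (rule bounded_integrals_LINT(2)[OF p])
  moreover have "0 \<le> (LINT r:{0<..}|lebesgue. p r)"
    using p unfolding set_lebesgue_integral_def
    by (intro Bochner_Integration.integral_nonneg) (auto simp: bounded_integrals_def indicator_def)
  ultimately show ?thesis by simp
qed

lemma H_norm_le:
  assumes u: "\<And>r. 0 < r \<Longrightarrow> (u has_real_derivative u' r) (at r)" "continuous_on {0<..} u'"
    and b: "bounded_integrals {0<..} (\<lambda>r. (u' r)\<^sup>2 * r) A" "bounded_integrals {0<..} (\<lambda>r. (u r)\<^sup>2 * r) B"
  shows "(H_norm u)\<^sup>2 \<le> A + B"
proof -
  have p: "bounded_integrals {0<..} (\<lambda>r. (u' r)\<^sup>2 * r + (u r)\<^sup>2 * r) (A + B)"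
    by (rule bounded_integrals_add[OF b])
  show ?thesis
    unfolding H_norm_def
    by (rule radial_norm_integral[where Q = "\<lambda>s r. s\<^sup>2 + (u r)\<^sup>2", OF u p]) (simp_all add: distrib_right)
qed

lemma X_norm_le:
  assumes u: "\<And>r. 0 < r \<Longrightarrow> (u has_real_derivative u' r) (at r)" "continuous_on {0<..} u'"
    and b: "bounded_integrals {0<..} (\<lambda>r. (u' r)\<^sup>2 * r) A" "bounded_integrals {0<..} (\<lambda>r. (u r)\<^sup>2 * r) B"
      "bounded_integrals {0<..} (\<lambda>r. (u r)\<^sup>2 / r) C"
  shows "(X_norm u)\<^sup>2 \<le> A + B + C"
proof -
  have p: "bounded_integrals {0<..} (\<lambda>r. (u' r)\<^sup>2 * r + (u r)\<^sup>2 * r + (u r)\<^sup>2 / r) (A + B + C)"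
    by (intro bounded_integrals_add b)
  show ?thesis
    unfolding X_norm_def
    by (rule radial_norm_integral[where Q = "\<lambda>s r. s\<^sup>2 + (u r)\<^sup>2 + (u r)\<^sup>2 / r\<^sup>2", OF u p])
      (simp_all add: distrib_right power2_eq_square)
qed

lemma in_X_space:
  assumes u: "\<And>r. 0 < r \<Longrightarrow> (u has_real_derivative u' r) (at r)" "continuous_on {0<..} u'"
    and bd: "\<And>r. 0 < r \<Longrightarrow> r \<le> 1 \<Longrightarrow> \<bar>u r\<bar> \<le> M"
    and b: "bounded_integrals {0<..} (\<lambda>r. (u' r)\<^sup>2 * r) A" "bounded_integrals {0<..} (\<lambda>r. (u r)\<^sup>2 * r) B"
      "bounded_integrals {0<..} (\<lambda>r. (u r)\<^sup>2 / r) C"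
  shows "u \<in> X_space"
proof -
  interpret radial_profile u u' M
    using u bd bounded_integrals_LINT(1)[OF b(1)] bounded_integrals_LINT(1)[OF b(2)] by unfold_locales
  have "set_integrable lebesgue {0<..} (\<lambda>r. (u r)\<^sup>2 / r)" by (rule bounded_integrals_LINT(1)[OF b(3)])
  moreover have "indicator {0<..} r *\<^sub>R ((u r)\<^sup>2 / r) = indicator {0<..} r *\<^sub>R ((u r)\<^sup>2 / r\<^sup>2 * r)" for r :: real
    by (simp add: indicator_def power2_eq_square)
  ultimately show ?thesis using in_H_space by (simp add: X_space_def set_integrable_def)
qed

lemma power2_diff_le: "(x - y)\<^sup>2 \<le> 2 * x\<^sup>2 + 2 * (y::real)\<^sup>2"
  using zero_le_power2[of "x + y"] by (simp add: power2_eq_square algebra_simps)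

section \<open>Membership in Y and the bound on the norm\<close>

context GL_solution begin

lemma continuous_S: "continuous_on {0<..} S" "continuous_on {0<..} (deriv S)"
proof -
  have "isCont S r" if "0 < r" for r using has_deriv(2)[OF that] by (rule DERIV_isCont)
  then show "continuous_on {0<..} S" by (simp add: continuous_at_imp_continuous_on)
  have "isCont (deriv S) r" if "0 < r" for r using has_deriv(5)[OF that] by (rule DERIV_isCont)
  then show "continuous_on {0<..} (deriv S)" by (simp add: continuous_at_imp_continuous_on)
qed

text \<open>\<open>U1\<close> and \<open>U0\<close> belong to u = f - ft, \<open>V1\<close> and
  \<open>V0\<close> to v = (S - St)/r, index 1 marking the derivative; \<open>V0\<close> bounds both
  v^2 r and v^2/r. Doubled summands come from (x - y)^2 <= 2 x^2 + 2 y^2, with the same bound for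
  both solutions.\<close>

definition U1 :: real where "U1 = 2 * F1 + 2 * F1"
definition U0 :: real where "U0 = 2 * (2 * H0 + 2 * M0) + 2 * (2 * H0 + 2 * M0)"
definition V0 :: real where "V0 = T\<^sup>2 + (2 * A1 + 2 * A1)"
definition V1 :: real where "V1 = (4 * (D * T) + 4 * (D * T)) + 2 * V0"
definition CY :: real where "CY = (U1 + U0 + (4 * F0 + U0)) + (V1 + V0 + V0) + (M1 + M0)"

lemma Y_estimate:
  assumes adm_core: "admissible d \<kappa> g ft St (\<lambda>_. 0)"
  shows "(f, S, m) \<in> Y_space ft St \<and> (Y_norm ft St (f, S, m))\<^sup>2 \<le> CY"
proof -
  \<comment> \<open>The core is itself an admissible solution at the same \<open>g\<close>, so the
    bounds above hold for it, and with identical constants since these depend on d, \<kappa> and g0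
    only.\<close>
  interpret core: GL_solution d \<kappa> g0 g ft St "\<lambda>_. 0"
    using d_nonzero \<kappa>_pos g0_pos g_ge adm_core by unfold_locales
  note cont = continuous continuous_S core.continuous(1-6) core.continuous_S
  define u where "u r = f r - ft r" for r
  define u' where "u' r = deriv f r - deriv ft r" for r
  define v where "v r = (S r - St r) / r" for r
  define v' where "v' r = (deriv S r - deriv St r) / r - (S r - St r) / r\<^sup>2" for r
  have du: "(u has_real_derivative u' r) (at r)" if "0 < r" for r
    unfolding u_def[abs_def] u'_def using that by (intro DERIV_diff has_deriv core.has_deriv)
  have dv: "(v has_real_derivative v' r) (at r)" if "0 < r" for r
    unfolding v_def[abs_def] v'_def
    by (rule derivative_eq_intros has_deriv core.has_deriv refl that)+ (use that in \<open>auto simp: field_simps power2_eq_square\<close>)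
  have cu: "continuous_on {0<..} u" "continuous_on {0<..} u'" "continuous_on {0<..} v" "continuous_on {0<..} v'"
    unfolding u_def[abs_def] u'_def[abs_def] v_def[abs_def] v'_def[abs_def] by (intro continuous_intros cont; simp)+
  have u'_bd: "bounded_integrals {0<..} (\<lambda>r. (u' r)\<^sup>2 * r) U1"
  proof (rule bounded_integrals_mono)
    show "bounded_integrals {0<..} (\<lambda>r. 2 * ((deriv f r)\<^sup>2 * r) + 2 * ((deriv ft r)\<^sup>2 * r)) U1"
      unfolding U1_def by (intro bounded_integrals_add bounded_integrals_cmult f'_bound core.f'_bound) auto
    fix r :: real assume r: "0 < r"
    have "(u' r)\<^sup>2 * r \<le> (2 * (deriv f r)\<^sup>2 + 2 * (deriv ft r)\<^sup>2) * r"
      unfolding u'_def using r by (intro mult_right_mono power2_diff_le) auto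
    then show "(u' r)\<^sup>2 * r \<le> 2 * ((deriv f r)\<^sup>2 * r) + 2 * ((deriv ft r)\<^sup>2 * r)" by (simp add: distrib_right)
  qed (auto intro!: continuous_intros cu)
  have u_bd: "bounded_integrals {0<..} (\<lambda>r. (u r)\<^sup>2 * r) U0"
  proof (rule bounded_integrals_mono)
    show "bounded_integrals {0<..} (\<lambda>r. 2 * ((1 - f r)\<^sup>2 * r) + 2 * ((1 - ft r)\<^sup>2 * r)) U0"
      unfolding U0_def by (intro bounded_integrals_add bounded_integrals_cmult one_minus_f_bound core.one_minus_f_bound) auto
    fix r :: real assume r: "0 < r"
    have "(u r)\<^sup>2 = ((1 - f r) - (1 - ft r))\<^sup>2" by (simp add: u_def power2_commute)
    also have "\<dots> * r \<le> (2 * (1 - f r)\<^sup>2 + 2 * (1 - ft r)\<^sup>2) * r"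
      using r by (intro mult_right_mono power2_diff_le) auto
    finally show "(u r)\<^sup>2 * r \<le> 2 * ((1 - f r)\<^sup>2 * r) + 2 * ((1 - ft r)\<^sup>2 * r)" by (simp add: distrib_right)
  qed (auto intro!: continuous_intros cu)
  have weight: "t / r \<le> t * r" if "1 \<le> r" "0 \<le> t" for t r :: real
  proof -
    have "t / r \<le> t / 1" using that by (intro divide_left_mono) auto
    also have "\<dots> \<le> t * r" using that mult_left_mono[of 1 r t] by simp
    finally show ?thesis .
  qed
  \<comment> \<open>Near 0 the singular weight is handled for \<open>f\<close> and \<open>ft\<close>
    separately; beyond 1 the weight 1/r is at most r, and \<open>u_bd\<close> suffices.\<close>
  have u_bd': "bounded_integrals {0<..} (\<lambda>r. (u r)\<^sup>2 / r) (4 * F0 + U0)"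
  proof (rule bounded_integrals_split)
    show "bounded_integrals {1..} (\<lambda>r. (u r)\<^sup>2 / r) U0"
      by (rule bounded_integrals_mono[OF u_bd]) (use weight in \<open>auto intro!: continuous_intros cu\<close>)
    show "bounded_integrals {0<..1} (\<lambda>r. (u r)\<^sup>2 / r) (4 * F0)"
    proof (rule bounded_integrals_mono)
      show "bounded_integrals {0<..1} (\<lambda>r. 2 * ((f r)\<^sup>2 / r) + 2 * ((ft r)\<^sup>2 / r)) (2 * F0 + 2 * F0)"
        by (intro bounded_integrals_add bounded_integrals_cmult f_bound_near_0 core.f_bound_near_0) auto
      fix r :: real assume r: "0 < r"
      have "(u r)\<^sup>2 / r \<le> (2 * (f r)\<^sup>2 + 2 * (ft r)\<^sup>2) / r"
        unfolding u_def using r by (intro divide_right_mono power2_diff_le) auto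
      then show "(u r)\<^sup>2 / r \<le> 2 * ((f r)\<^sup>2 / r) + 2 * ((ft r)\<^sup>2 / r)" by (simp add: add_divide_distrib)
    qed (auto intro!: continuous_intros cu)
  qed
  have dS_near: "(S r - St r)\<^sup>2 \<le> T\<^sup>2 * (r\<^sup>2)\<^sup>2" if r: "0 < r" for r
  proof -
    have "(S r - St r)\<^sup>2 \<le> 2 * (S r)\<^sup>2 + 2 * (St r)\<^sup>2" by (rule power2_diff_le)
    also have "\<dots> \<le> 2 * (T / 2 * r\<^sup>2)\<^sup>2 + 2 * (T / 2 * r\<^sup>2)\<^sup>2"
      using S_sq_le[OF r] core.S_sq_le[OF r] by (intro add_mono mult_left_mono) auto
    also have "\<dots> = T\<^sup>2 * (r\<^sup>2)\<^sup>2" by (simp add: power_mult_distrib power_divide)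
    finally show ?thesis .
  qed
  \<comment> \<open>Far out the comparison runs through d: up to sign, d - S and d - St are the
    functions \<open>a\<close> of the two solutions.\<close>
  have dS_far: "bounded_integrals {1..} (\<lambda>r. (S r - St r)\<^sup>2 / r) (2 * A1 + 2 * A1)"
  proof (rule bounded_integrals_mono)
    show "bounded_integrals {1/2..} (\<lambda>r. 2 * ((a r)\<^sup>2 / r) + 2 * ((core.a r)\<^sup>2 / r)) (2 * A1 + 2 * A1)"
      by (intro bounded_integrals_add bounded_integrals_cmult a_bound core.a_bound) auto
    fix r :: real assume r: "0 < r"
    have "(S r - St r)\<^sup>2 = ((of_int d - S r) - (of_int d - St r))\<^sup>2" by (simp add: power2_commute)
    also have "\<dots> \<le> 2 * (a r)\<^sup>2 + 2 * (core.a r)\<^sup>2"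
      unfolding a_sq[symmetric] core.a_sq[symmetric] by (rule power2_diff_le)
    finally have "(S r - St r)\<^sup>2 / r \<le> (2 * (a r)\<^sup>2 + 2 * (core.a r)\<^sup>2) / r"
      using r by (intro divide_right_mono) auto
    then show "(S r - St r)\<^sup>2 / r \<le> 2 * ((a r)\<^sup>2 / r) + 2 * ((core.a r)\<^sup>2 / r)" by (simp add: add_divide_distrib)
  qed (auto intro!: continuous_intros cont)
  have v_bd: "bounded_integrals {0<..} (\<lambda>r. (v r)\<^sup>2 * r) V0"
    unfolding V0_def
  proof (rule bounded_integrals_split)
    show "bounded_integrals {1..} (\<lambda>r. (v r)\<^sup>2 * r) (2 * A1 + 2 * A1)"
    proof (rule bounded_integrals_mono[OF dS_far])
      show "(v r)\<^sup>2 * r \<le> (S r - St r)\<^sup>2 / r" if "0 < r" for r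
        using that by (simp add: v_def power2_eq_square)
    qed (auto intro!: continuous_intros cu)
    show "bounded_integrals {0<..1} (\<lambda>r. (v r)\<^sup>2 * r) (T\<^sup>2)"
    proof (rule bounded_integrals_mono)
      show "bounded_integrals {0<..1} (\<lambda>r. T\<^sup>2 * r) (T\<^sup>2)" by (rule bounded_integrals_linear) simp
      fix r :: real assume r: "0 < r" "r \<in> {0<..1}"
      have "(v r)\<^sup>2 = (S r - St r)\<^sup>2 / r\<^sup>2" by (simp add: v_def power_divide)
      also have "\<dots> \<le> T\<^sup>2 * (r\<^sup>2)\<^sup>2 / r\<^sup>2" using dS_near[OF r(1)] by (intro divide_right_mono) auto
      also have "\<dots> = T\<^sup>2 * r\<^sup>2" using r by (simp add: power2_eq_square)
      also have "\<dots> \<le> T\<^sup>2 * 1" using r by (intro mult_left_mono) (auto simp: power_le_one)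
      finally show "(v r)\<^sup>2 * r \<le> T\<^sup>2 * r" using r by (intro mult_right_mono) auto
    qed (auto intro!: continuous_intros cu)
  qed
  have v_bd': "bounded_integrals {0<..} (\<lambda>r. (v r)\<^sup>2 / r) V0"
    unfolding V0_def
  proof (rule bounded_integrals_split)
    show "bounded_integrals {1..} (\<lambda>r. (v r)\<^sup>2 / r) (2 * A1 + 2 * A1)"
    proof (rule bounded_integrals_mono[OF dS_far])
      fix r :: real assume r: "0 < r" "r \<in> {1..}"
      have "(v r)\<^sup>2 / r \<le> (v r)\<^sup>2 * r" using r by (intro weight) auto
      also have "\<dots> = (S r - St r)\<^sup>2 / r" using r by (simp add: v_def power2_eq_square)
      finally show "(v r)\<^sup>2 / r \<le> (S r - St r)\<^sup>2 / r" .
    qed (auto intro!: continuous_intros cu)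
    show "bounded_integrals {0<..1} (\<lambda>r. (v r)\<^sup>2 / r) (T\<^sup>2)"
    proof (rule bounded_integrals_mono)
      show "bounded_integrals {0<..1} (\<lambda>r. T\<^sup>2 * r) (T\<^sup>2)" by (rule bounded_integrals_linear) simp
      fix r :: real assume r: "0 < r"
      have "(v r)\<^sup>2 / r = (S r - St r)\<^sup>2 / (r\<^sup>2 * r)" by (simp add: v_def power_divide)
      also have "\<dots> \<le> T\<^sup>2 * (r\<^sup>2)\<^sup>2 / (r\<^sup>2 * r)" using dS_near[OF r(1)] r by (intro divide_right_mono) auto
      also have "\<dots> = T\<^sup>2 * r" using r by (simp add: power2_eq_square)
      finally show "(v r)\<^sup>2 / r \<le> T\<^sup>2 * r" .
    qed (auto intro!: continuous_intros cu)
  qed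
  \<comment> \<open>The second part of v' is v/r, whose square against r dr is v^2/r. The bound with
    singular weight thus enters that of the derivative.\<close>
  have v'_bd: "bounded_integrals {0<..} (\<lambda>r. (v' r)\<^sup>2 * r) V1"
  proof (rule bounded_integrals_mono)
    show "bounded_integrals {0<..} (\<lambda>r. (4 * ((deriv S r)\<^sup>2 / r) + 4 * ((deriv St r)\<^sup>2 / r)) + 2 * ((v r)\<^sup>2 / r)) V1"
      unfolding V1_def by (intro bounded_integrals_add bounded_integrals_cmult S'_bound core.S'_bound v_bd') auto
    fix r :: real assume r: "0 < r"
    have "(v' r)\<^sup>2 \<le> 2 * ((deriv S r - deriv St r) / r)\<^sup>2 + 2 * ((S r - St r) / r\<^sup>2)\<^sup>2"
      unfolding v'_def by (rule power2_diff_le)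
    then have "(v' r)\<^sup>2 * r \<le> (2 * ((deriv S r - deriv St r) / r)\<^sup>2 + 2 * ((S r - St r) / r\<^sup>2)\<^sup>2) * r"
      using r by (intro mult_right_mono) auto
    also have "\<dots> = 2 * ((deriv S r - deriv St r)\<^sup>2 / r) + 2 * ((v r)\<^sup>2 / r)"
    proof -
      have "((deriv S r - deriv St r) / r)\<^sup>2 * r = (deriv S r - deriv St r)\<^sup>2 / r"
        "((S r - St r) / r\<^sup>2)\<^sup>2 * r = (v r)\<^sup>2 / r"
        using r by (simp_all add: v_def power2_eq_square)
      then show ?thesis by (simp only: distrib_right mult.assoc)
    qed
    also have "(deriv S r - deriv St r)\<^sup>2 / r \<le> (2 * (deriv S r)\<^sup>2 + 2 * (deriv St r)\<^sup>2) / r"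
      using r by (intro divide_right_mono power2_diff_le) auto
    finally show "(v' r)\<^sup>2 * r \<le> (4 * ((deriv S r)\<^sup>2 / r) + 4 * ((deriv St r)\<^sup>2 / r)) + 2 * ((v r)\<^sup>2 / r)"
      by (simp add: add_divide_distrib)
  qed (auto intro!: continuous_intros cu)
  \<comment> \<open>Pointwise bounds near 0, required by \<open>radial_profile\<close> for removing
    the origin.\<close>
  have u_le: "\<bar>u r\<bar> \<le> 1" if "0 < r" for r
    using f_nonneg[of r] f_le_1[OF that] core.f_nonneg[of r] core.f_le_1[OF that] that by (simp add: u_def abs_le_iff)
  have v_le: "\<bar>v r\<bar> \<le> T" if r: "0 < r" "r \<le> 1" for r
  proof (rule power2_le_imp_le)
    have "\<bar>v r\<bar>\<^sup>2 = (S r - St r)\<^sup>2 / r\<^sup>2" by (simp add: v_def power_divide)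
    also have "\<dots> \<le> T\<^sup>2 * (r\<^sup>2)\<^sup>2 / r\<^sup>2" using dS_near[OF r(1)] by (intro divide_right_mono) auto
    also have "\<dots> = T\<^sup>2 * r\<^sup>2" using r by (simp add: power2_eq_square)
    also have "\<dots> \<le> T\<^sup>2 * 1" using r by (intro mult_left_mono) (auto simp: power_le_one)
    finally show "\<bar>v r\<bar>\<^sup>2 \<le> T\<^sup>2" by simp
  qed (use T_pos in simp)
  have "u \<in> X_space" by (rule in_X_space[OF du cu(2) u_le u'_bd u_bd u_bd'])
  moreover have "v \<in> X_space" by (rule in_X_space[OF dv cu(4) v_le v'_bd v_bd v_bd'])
  moreover have "m \<in> H_space"
  proof -
    have "\<bar>m r\<bar> \<le> 1" if "0 < r" for r using m_nonneg[of r] m_le_1[OF that] that by simp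
    then interpret radial_profile m "deriv m" 1
      using has_deriv(3) continuous(6) bounded_integrals_LINT(1)[OF m'_bound] bounded_integrals_LINT(1)[OF m_bound]
      by unfold_locales
    show ?thesis by (rule in_H_space)
  qed
  moreover have "\<forall>r>0. f r = ft r + u r \<and> S r = St r + r * v r" by (simp add: u_def v_def)
  ultimately have "(f, S, m) \<in> Y_space ft St" unfolding Y_space_def by blast
  moreover have "(Y_norm ft St (f, S, m))\<^sup>2 \<le> CY"
  proof -
    have "(X_norm u)\<^sup>2 \<le> U1 + U0 + (4 * F0 + U0)" by (rule X_norm_le[OF du cu(2) u'_bd u_bd u_bd'])
    moreover have "(X_norm v)\<^sup>2 \<le> V1 + V0 + V0" by (rule X_norm_le[OF dv cu(4) v'_bd v_bd v_bd'])
    moreover have "(H_norm m)\<^sup>2 \<le> M1 + M0" by (rule H_norm_le[OF has_deriv(3) continuous(6) m'_bound m_bound])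
    moreover have "(Y_norm ft St (f, S, m))\<^sup>2 = (X_norm u)\<^sup>2 + (X_norm v)\<^sup>2 + (H_norm m)\<^sup>2"
      by (simp add: Y_norm_def u_def[abs_def] v_def[abs_def])
    ultimately show ?thesis unfolding CY_def by linarith
  qed
  ultimately show ?thesis ..
qed

end

theorem theorem4p7:
  fixes d :: int and \<kappa> :: real and ft St :: "real \<Rightarrow> real"
  assumes "d \<noteq> 0" and "0 < \<kappa>"
    and "normal_core d \<kappa> ft St"
  shows "\<forall>J::real set. compact J \<and> is_interval J \<and> J \<subseteq> {0<..} \<longrightarrow>
           (\<exists>C0>0. \<forall>g\<in>J. \<forall>f S m. admissible d \<kappa> g f S m \<longrightarrow>
              (f, S, m) \<in> Y_space ft St \<and> Y_norm ft St (f, S, m) \<le> C0)"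
proof (intro allI impI)
  fix J :: "real set" assume J: "compact J \<and> is_interval J \<and> J \<subseteq> {0<..}"
  show "\<exists>C0>0. \<forall>g\<in>J. \<forall>f S m. admissible d \<kappa> g f S m \<longrightarrow>
              (f, S, m) \<in> Y_space ft St \<and> Y_norm ft St (f, S, m) \<le> C0"
  proof (cases "J = {}")
    case True
    then show ?thesis by (intro exI[of _ 1]) simp
  next
    case False
    then obtain g0 where g0: "g0 \<in> J" "\<And>g. g \<in> J \<Longrightarrow> g0 \<le> g"
      using compact_attains_inf[of J] J by auto
    \<comment> \<open>\<open>CY\<close> depends on \<open>J\<close> only through its minimum
      \<open>g0\<close>. The absolute value makes the square root non-negative, and adding 1 makes
      the constant strictly positive.\<close>
    define C where "C = \<bar>GL_solution.CY d \<kappa> g0\<bar>"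
    show ?thesis
    proof (intro exI[of _ "sqrt C + 1"] conjI ballI allI impI)
      show "0 < sqrt C + 1" by (simp add: C_def add_nonneg_pos)
      fix g f S m assume g: "g \<in> J" and adm: "admissible d \<kappa> g f S m"
      interpret GL_solution d \<kappa> g0 g f S m
        using assms g0 g adm J by unfold_locales auto
      \<comment> \<open>With m = 0 admissibility does not depend on the coupling, so the core is
        available at the current \<open>g\<close>.\<close>
      have "admissible d \<kappa> g ft St (\<lambda>_. 0)" using assms(3) by (simp add: normal_core_iff[of _ _ _ _ g])
      from Y_estimate[OF this] have Y: "(f, S, m) \<in> Y_space ft St" "(Y_norm ft St (f, S, m))\<^sup>2 \<le> C"
        by (auto simp: C_def)
      show "(f, S, m) \<in> Y_space ft St" by (rule Y(1))
      show "Y_norm ft St (f, S, m) \<le> sqrt C + 1" using real_le_rsqrt[OF Y(2)] by simp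
    qed
  qed
qed

end
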